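(* Let $q,Q$ be two positive definite integral quadratic forms over $\mathbb{Z}$ of equal rank $4$. Then the number of representations of $q$ by $Q$ (linear maps $\iota:\mathbb{Z}^4\to\mathbb{Z}^4$ with $Q\circ\iota=q$) is $$\ll_{Q,\varepsilon}\mathsf{m}_1(q)\,\mathsf{m}_2'(q)\,|\operatorname{disc}(q)|^{\varepsilon},$$ where $\mathsf{m}_2'(q)$ is the largest integer with $\mathsf{m}_2'(q)^2\mid\mathsf{m}_2(q)$.
   Context: For a non-degenerate integral quadratic form $q$ in $n$ variables with bilinear form $\langle\cdot,\cdot\rangle_q$ ($q(v)=\langle v,v\rangle_q$), $\operatorname{disc}(q)$ is the determinant of its Gram matrix and $\operatorname{disc}_q(\Lambda)$ the Gram determinant of a sublattice $\Lambda$. For a prime $p$, the elementary divisors $k_1(p,q),\dots,k_n(p,q)$ are the unique integers such that for all $j\le n$, $k_1(p,q)+\dots+k_j(p,q)=\min_{\Lambda_j}\operatorname{ord}_p(2^j\operatorname{disc}_q(\Lambda_j))$, the minimum over all primitive sublattices $\Lambda_j\subset\mathbb{Z}_p^n$ of rank $j$ with non-zero discriminant. Define $\mathsf{m}_j(q)=\prod_p p^{k_j(p,q)}$.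
   Formalization: Since k_2(2,q) can be −1 (e.g. q = x²+xy+y²+z²+zw+w² has m_2(q) = 1/2), m_2(q) need not be an integer and m_2'(q) may be undefined; here m_2'(q) is the largest integer whose square divides the numerator of m_2(q), which agrees with the original whenever m_2(q) is an integer. *)

theory Defs
  imports "HOL-Analysis.Analysis" "HOL-Algebra.Ring" "HOL-Algebra.Divisibility"
begin

section \<open>Integral quadratic forms\<close>

text \<open>Integral means that \<open>q\<close> has integer coefficients, equivalently integer values on
  \<open>\<int>\<^sup>n\<close>; the off-diagonal entries of the Gram matrix may be half-integers.\<close>

definition integral_quadratic_form :: "(int ^ 'n \<Rightarrow> int) \<Rightarrow> bool" where
  "integral_quadratic_form q \<longleftrightarrow>
     (\<exists>a :: int ^ 'n ^ 'n. \<forall>v. q v = (\<Sum>i\<in>UNIV. \<Sum>k\<in>UNIV. a $ i $ k * v $ i * v $ k))"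

definition positive_definite :: "(int ^ 'n \<Rightarrow> int) \<Rightarrow> bool" where
  "positive_definite q \<longleftrightarrow> (\<forall>v. v \<noteq> 0 \<longrightarrow> q v > 0)"

text \<open>\<open>polar q v w\<close> is \<open>2 \<langle>v, w\<rangle>\<^sub>q\<close>, where \<open>\<langle>v, v\<rangle>\<^sub>q = q v\<close>.\<close>

definition polar :: "(int ^ 'n \<Rightarrow> int) \<Rightarrow> int ^ 'n \<Rightarrow> int ^ 'n \<Rightarrow> int" where
  "polar q v w = q (v + w) - q v - q w"

definition bilin :: "(int ^ 'n \<Rightarrow> int) \<Rightarrow> int ^ 'n \<Rightarrow> int ^ 'n \<Rightarrow> rat" where
  "bilin q v w = of_int (polar q v w) / 2"

definition gram :: "(int ^ 'n \<Rightarrow> int) \<Rightarrow> rat ^ 'n ^ 'n" where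
  "gram q = (\<chi> i k. bilin q (axis i 1) (axis k 1))"

definition disc :: "(int ^ 'n \<Rightarrow> int) \<Rightarrow> rat" where
  "disc q = det (gram q)"

definition representations ::
    "(int ^ 'm \<Rightarrow> int) \<Rightarrow> (int ^ 'n \<Rightarrow> int) \<Rightarrow> (int ^ 'm \<Rightarrow> int ^ 'n) set" where
  "representations q Q = {\<iota>. module_hom (*s) (*s) \<iota> \<and> Q \<circ> \<iota> = q}"

lemma bilin_self:
  assumes "integral_quadratic_form q"
  shows "bilin q v v = of_int (q v)"
proof -
  obtain a where a: "\<And>v. q v = (\<Sum>i\<in>UNIV. \<Sum>k\<in>UNIV. a $ i $ k * v $ i * v $ k)"
    using assms unfolding integral_quadratic_form_def by blast
  have "q (v + v) = 4 * q v"
    unfolding a by (simp add: sum_distrib_left algebra_simps flip: mult_2)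
  then show ?thesis by (simp add: bilin_def polar_def)
qed


section \<open>The ring of \<open>p\<close>-adic integers\<close>

text \<open>\<open>\<int>\<^sub>p\<close> is the inverse limit of the rings \<open>\<int>/p\<^sup>N\<int>\<close>, whose elements are represented by
  their least non-negative residues.\<close>

definition padic_int :: "nat \<Rightarrow> (nat \<Rightarrow> int) ring" where
  "padic_int p =
     \<lparr>carrier = {x. \<forall>N. 0 \<le> x N \<and> x N < int p ^ N \<and> x (Suc N) mod int p ^ N = x N},
      monoid.mult = (\<lambda>x y N. (x N * y N) mod int p ^ N),
      one = (\<lambda>N. 1 mod int p ^ N),
      zero = (\<lambda>N. 0),
      add = (\<lambda>x y N. (x N + y N) mod int p ^ N)\<rparr>"

lemma cring_padic_int:
  assumes "p > 0"
  shows "cring (padic_int p)"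
proof -
  have step: "a mod int p ^ Suc N mod int p ^ N = a mod int p ^ N" for a N
    by (simp add: mod_mod_cancel)
  show ?thesis
  proof (rule cringI)
    show "abelian_group (padic_int p)"
    proof (rule abelian_groupI)
      fix x y assume x: "x \<in> carrier (padic_int p)" and y: "y \<in> carrier (padic_int p)"
      have "(x (Suc N) + y (Suc N)) mod int p ^ N = (x N + y N) mod int p ^ N" for N
        using x y by (auto simp: padic_int_def intro!: mod_add_cong)
      then show "x \<oplus>\<^bsub>padic_int p\<^esub> y \<in> carrier (padic_int p)"
        using assms by (simp add: padic_int_def step del: power_Suc)
    next
      fix x assume x: "x \<in> carrier (padic_int p)"
      let ?y = "\<lambda>N. (- x N) mod int p ^ N"
      have "(- x (Suc N)) mod int p ^ N = (- x N) mod int p ^ N" for N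
        using x by (auto simp: padic_int_def intro!: mod_minus_cong)
      then have "?y \<in> carrier (padic_int p)"
        using assms by (simp add: padic_int_def step del: power_Suc)
      moreover have "?y \<oplus>\<^bsub>padic_int p\<^esub> x = \<zero>\<^bsub>padic_int p\<^esub>"
        by (simp add: padic_int_def mod_simps)
      ultimately show "\<exists>y\<in>carrier (padic_int p). y \<oplus>\<^bsub>padic_int p\<^esub> x = \<zero>\<^bsub>padic_int p\<^esub>" by blast
    qed (use assms in \<open>auto simp: padic_int_def fun_eq_iff mod_simps algebra_simps mod_pos_pos_trivial\<close>)
    show "Group.comm_monoid (padic_int p)"
    proof (rule comm_monoidI)
      fix x y assume x: "x \<in> carrier (padic_int p)" and y: "y \<in> carrier (padic_int p)"
      have "(x (Suc N) * y (Suc N)) mod int p ^ N = (x N * y N) mod int p ^ N" for N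
        using x y by (auto simp: padic_int_def intro!: mod_mult_cong)
      then show "x \<otimes>\<^bsub>padic_int p\<^esub> y \<in> carrier (padic_int p)"
        using assms by (simp add: padic_int_def step del: power_Suc)
    next
      show "\<one>\<^bsub>padic_int p\<^esub> \<in> carrier (padic_int p)"
        using assms by (simp add: padic_int_def step del: power_Suc)
    qed (use assms in \<open>auto simp: padic_int_def fun_eq_iff mod_simps algebra_simps mod_pos_pos_trivial\<close>)
  qed (use assms in \<open>auto simp: padic_int_def fun_eq_iff mod_simps algebra_simps mod_pos_pos_trivial\<close>)
qed

text \<open>Only meaningful for \<open>x \<noteq> 0\<close>.\<close>

definition padic_ord :: "nat \<Rightarrow> (nat \<Rightarrow> int) \<Rightarrow> nat" where
  "padic_ord p x =
     (GREATEST N. add_pow (padic_int p) (int p ^ N) \<one>\<^bsub>padic_int p\<^esub> divides\<^bsub>padic_int p\<^esub> x)"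

definition ring_det :: "('a, 'b) ring_scheme \<Rightarrow> nat \<Rightarrow> (nat \<Rightarrow> nat \<Rightarrow> 'a) \<Rightarrow> 'a" where
  "ring_det R j M =
     (\<Oplus>\<^bsub>R\<^esub>\<sigma>\<in>{\<sigma>. \<sigma> permutes {..<j}}. add_pow R (sign \<sigma>) (\<Otimes>\<^bsub>R\<^esub>i\<in>{..<j}. M i (\<sigma> i)))"


section \<open>Primitive sublattices of \<open>\<int>\<^sub>p\<^sup>n\<close>\<close>

definition padic_space :: "nat \<Rightarrow> ('n \<Rightarrow> nat \<Rightarrow> int) set" where
  "padic_space p = {x. \<forall>i. x i \<in> carrier (padic_int p)}"

definition padic_lincomb ::
    "nat \<Rightarrow> nat \<Rightarrow> (nat \<Rightarrow> nat \<Rightarrow> int) \<Rightarrow> (nat \<Rightarrow> 'n \<Rightarrow> nat \<Rightarrow> int) \<Rightarrow> 'n \<Rightarrow> nat \<Rightarrow> int" where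
  "padic_lincomb p j c b = (\<lambda>i. \<Oplus>\<^bsub>padic_int p\<^esub>l\<in>{..<j}. c l \<otimes>\<^bsub>padic_int p\<^esub> b l i)"

text \<open>\<open>b 0, \<dots>, b (j - 1)\<close> is a \<open>\<int>\<^sub>p\<close>-basis of \<open>L\<close>; thus \<open>L\<close> is a sublattice of rank \<open>j\<close>.\<close>

definition padic_basis :: "nat \<Rightarrow> nat \<Rightarrow> (nat \<Rightarrow> 'n \<Rightarrow> nat \<Rightarrow> int) \<Rightarrow> ('n \<Rightarrow> nat \<Rightarrow> int) set \<Rightarrow> bool" where
  "padic_basis p j b L \<longleftrightarrow>
     b \<in> {..<j} \<rightarrow> padic_space p \<and>
     L = {padic_lincomb p j c b | c. c \<in> {..<j} \<rightarrow> carrier (padic_int p)} \<and>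
     (\<forall>c \<in> {..<j} \<rightarrow> carrier (padic_int p).
        padic_lincomb p j c b = (\<lambda>i. \<zero>\<^bsub>padic_int p\<^esub>) \<longrightarrow> (\<forall>l<j. c l = \<zero>\<^bsub>padic_int p\<^esub>))"

text \<open>Primitivity: \<open>\<int>\<^sub>p\<^sup>n / L\<close> is torsion-free, i.e. \<open>L = (L \<otimes> \<rat>\<^sub>p) \<inter> \<int>\<^sub>p\<^sup>n\<close>.\<close>

definition padic_primitive :: "nat \<Rightarrow> ('n \<Rightarrow> nat \<Rightarrow> int) set \<Rightarrow> bool" where
  "padic_primitive p L \<longleftrightarrow>
     (\<forall>a \<in> carrier (padic_int p). \<forall>x \<in> padic_space p.
        a \<noteq> \<zero>\<^bsub>padic_int p\<^esub> \<and> (\<lambda>i. a \<otimes>\<^bsub>padic_int p\<^esub> x i) \<in> L \<longrightarrow> x \<in> L)"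


section \<open>Elementary divisors\<close>

text \<open>The extension of \<open>2 \<langle>v, w\<rangle>\<^sub>q\<close> to \<open>\<int>\<^sub>p\<^sup>n\<close>.\<close>

definition padic_polar ::
    "nat \<Rightarrow> (int ^ 'n \<Rightarrow> int) \<Rightarrow> ('n \<Rightarrow> nat \<Rightarrow> int) \<Rightarrow> ('n \<Rightarrow> nat \<Rightarrow> int) \<Rightarrow> nat \<Rightarrow> int" where
  "padic_polar p q v w =
     (\<Oplus>\<^bsub>padic_int p\<^esub>i\<in>UNIV. \<Oplus>\<^bsub>padic_int p\<^esub>k\<in>UNIV.
        add_pow (padic_int p) (polar q (axis i 1) (axis k 1)) (v i \<otimes>\<^bsub>padic_int p\<^esub> w k))"

text \<open>This is \<open>2\<^sup>j disc\<^sub>q(L)\<close> for the lattice \<open>L\<close> with basis \<open>b\<close>: the factor \<open>2\<^sup>j\<close> is absorbed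
  into the \<open>j \<times> j\<close> Gram matrix, whose entries then lie in \<open>\<int>\<^sub>p\<close> also for \<open>p = 2\<close>. A change of
  basis multiplies it by the square of a unit, so its order depends on \<open>L\<close> only.\<close>

definition padic_scaled_disc ::
    "nat \<Rightarrow> (int ^ 'n \<Rightarrow> int) \<Rightarrow> nat \<Rightarrow> (nat \<Rightarrow> 'n \<Rightarrow> nat \<Rightarrow> int) \<Rightarrow> nat \<Rightarrow> int" where
  "padic_scaled_disc p q j b = ring_det (padic_int p) j (\<lambda>l m. padic_polar p q (b l) (b m))"

definition min_disc_ord :: "nat \<Rightarrow> (int ^ 'n \<Rightarrow> int) \<Rightarrow> nat \<Rightarrow> nat" where
  "min_disc_ord p q j =
     Inf {padic_ord p (padic_scaled_disc p q j b) | L b.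
            padic_basis p j b L \<and> padic_primitive p L \<and>
            padic_scaled_disc p q j b \<noteq> \<zero>\<^bsub>padic_int p\<^esub>}"

definition elementary_divisor :: "nat \<Rightarrow> (int ^ 'n \<Rightarrow> int) \<Rightarrow> nat \<Rightarrow> int" where
  "elementary_divisor p q j =
     int (min_disc_ord p q j) - (if j = 1 then 0 else int (min_disc_ord p q (j - 1)))"

lemma sum_elementary_divisor:
  "j \<ge> 1 \<Longrightarrow> (\<Sum>i = 1..j. elementary_divisor p q i) = int (min_disc_ord p q j)"
  by (induction j rule: dec_induct) (simp_all add: elementary_divisor_def)

text \<open>For non-degenerate \<open>q\<close> only the finitely many primes dividing \<open>2 disc(2q)\<close> contribute.\<close>

definition m_div :: "nat \<Rightarrow> (int ^ 'n \<Rightarrow> int) \<Rightarrow> rat" where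
  "m_div j q = (\<Prod>p | Factorial_Ring.prime p \<and> elementary_divisor p q j \<noteq> 0. of_nat p powi elementary_divisor p q j)"

text \<open>At \<open>p = 2\<close> the second elementary divisor can be \<open>-1\<close> (if \<open>q\<close> is \<open>2\<close>-adically
  \<open>x y + \<dots>\<close> or \<open>x\<^sup>2 + x y + y\<^sup>2 + \<dots>\<close>), and then \<open>m_div 2 q\<close> is not an integer but half of an odd
  one. To cover this case, divisibility is that of the numerator of \<open>m_div 2 q\<close>.\<close>

definition m2' :: "(int ^ 'n \<Rightarrow> int) \<Rightarrow> int" where
  "m2' q = (GREATEST m. m ^ 2 dvd fst (quotient_of (m_div 2 q)))"

end

theory Submission
  imports Defs "HOL-Number_Theory.Cong"
begin

text \<open>
  A representation \<open>\<iota>\<close> of \<open>q\<close> by \<open>Q\<close> is determined, up to the finitely many isometries of \<open>Q\<close>, by the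
  overlattice \<open>\<iota>\<^sup>-\<^sup>1(\<int>\<^sup>4)\<close> of \<open>\<int>\<^sup>4\<close> in \<open>\<rat>\<^sup>4\<close>, hence by its localizations at the primes \<open>p\<close> dividing the
  discriminant of \<open>q\<close>. These are overlattices \<open>L\<close> of \<open>\<int>\<^sub>(\<^sub>p\<^sub>)\<^sup>4\<close> on which the polar form is
  integral and whose dual is contained in \<open>\<beta>\<^sup>-\<^sup>1 L\<close>, where \<open>\<beta>\<close> depends on \<open>Q\<close> only.

  Locally \<open>q\<close> is diagonal with coefficients of orders \<open>\<kappa>\<^sub>1, \<dots>, \<kappa>\<^sub>4\<close> (at \<open>p = 2\<close>: after passing to a
  sublattice of bounded index), and \<open>L\<close> is built along the flag of coordinate subspaces. There are
  at most \<open>p\<^bsup>a\<^esup>\<close> choices for the second generator if its leading coefficient is \<open>p\<^sup>-\<^sup>a\<close>. The third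
  generator, modulo the first two basis vectors, solves \<open>d\<^sub>1 x\<^sup>2 + d\<^sub>2 y\<^sup>2 \<equiv> c\<close>, which has
  \<open>\<lless> p\<^bsup>\<kappa>\<^sub>1 + \<lfloor>\<kappa>\<^sub>2/2\<rfloor>\<^esup>\<close> solutions, and adding multiples of the second generator identifies at least \<open>p\<^bsup>a\<^esup>\<close> of them.
  Given the first three generators, near self-duality of \<open>L\<close> makes the last one a solution
  of \<open>t\<^sup>2 \<equiv> \<beta>\<^sup>2\<close>, which leaves boundedly many choices. Only the exponents of the leading coefficients
  remain; they contribute a factor polynomial in the order of the discriminant, and the product of
  these factors over \<open>p\<close> is \<open>\<lless> |disc q|\<^sup>\<epsilon>\<close>.
\<close>

section \<open>Square roots modulo prime powers\<close>

text \<open>A local loss is judged by its dependence on p. An absolute constant per prime,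
  multiplied over the primes dividing the discriminant, is absorbed by |disc q|^eps; a power of p is
  tolerable only if its exponent vanishes outside a finite set of primes depending on Q. So each
  local count is a constant times p^(O(ord_p(beta) + ord_p(2))), a polynomial in ord_p of the
  discriminant, and the main term. For beta the determinant of the polar Gram matrix of Q serves,
  since it multiplies the dual of Z_(p)^4 into Z_(p)^4. The main term must not involve kappa_3 or
  kappa_4. Counting the last generator by its norm alone, as for the third one, would bring in
  kappa_3; this is why near self-duality is used there. Elementary divisors are defined over Z_p,
  but the counting takes place over Z_(p) inside Q, where the lattices of all primes lie in one
  space and glue. The two sides meet in integer vectors: for each p a separate orthogonal system in
  Z^4 is chosen, with norms of order kappa_i. Only the one-sided estimate kappa_i <= k_i +
  O(ord_p(2)) for i = 1, 2 enters the count.\<close>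

lemma card_residue_class_le:
  fixes p c :: int
  assumes "p > 0" "r \<le> m"
  shows "card {y \<in> {0..<p ^ m}. p ^ r dvd y - c} \<le> nat p ^ (m - r)"
proof -
  have "inj_on (\<lambda>y. y div p ^ r) {y \<in> {0..<p ^ m}. p ^ r dvd y - c}"
  proof (rule inj_onI)
    fix y z assume y: "y \<in> {y \<in> {0..<p ^ m}. p ^ r dvd y - c}"
      and z: "z \<in> {y \<in> {0..<p ^ m}. p ^ r dvd y - c}" and eq: "y div p ^ r = z div p ^ r"
    have "p ^ r dvd y - c" "p ^ r dvd z - c" using y z by auto
    then have "p ^ r dvd (y - c) - (z - c)" by (rule dvd_diff)
    then have "y mod p ^ r = z mod p ^ r" by (simp add: mod_eq_dvd_iff)
    with eq show "y = z" by (metis div_mult_mod_eq)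
  qed
  moreover have "(\<lambda>y. y div p ^ r) ` {y \<in> {0..<p ^ m}. p ^ r dvd y - c} \<subseteq> {0..<p ^ (m - r)}"
  proof clarsimp
    fix y assume y: "0 \<le> y" "y < p ^ m"
    have "y < p ^ (m - r) * p ^ r" using y assms by (simp flip: power_add)
    moreover have "y div p ^ r * p ^ r \<le> y"
      using assms pos_mod_sign[of "p ^ r" y] div_mult_mod_eq[of y "p ^ r"]
      by (smt (verit) zero_less_power)
    ultimately have "y div p ^ r * p ^ r < p ^ (m - r) * p ^ r" by linarith
    then have "y div p ^ r < p ^ (m - r)" using assms by (simp add: mult_less_cancel_right)
    then show "0 \<le> y div p ^ r \<and> y div p ^ r < p ^ (m - r)"
      using y assms by (simp add: pos_imp_zdiv_nonneg_iff)
  qed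
  ultimately have "card {y \<in> {0..<p ^ m}. p ^ r dvd y - c} \<le> card {0..<p ^ (m - r)}"
    by (intro card_inj_on_le) auto
  also have "\<dots> = nat p ^ (m - r)" using assms by (simp add: nat_power_eq)
  finally show ?thesis .
qed

lemma prime_power_multiplicity_two_le:
  assumes "Factorial_Ring.prime (p :: int)"
  shows "nat p ^ multiplicity p 2 \<le> 2"
proof (cases "p = 2")
  case True
  then show ?thesis by simp
next
  case False
  then have "\<not> p dvd 2" using assms primes_dvd_imp_eq two_is_prime by blast
  then show ?thesis by (simp add: not_dvd_imp_multiplicity_0)
qed

text \<open>The factors y - t and y + t differ by 2 t, whose order is at most i + ord_p(2). One
  factor therefore has at most this order, and the other carries the rest of p^k, so y lies in one
  of two residue classes. The term ord_p(2) costs a factor 2, at p = 2 only.\<close>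

lemma card_square_roots_near_le:
  fixes p t :: int
  assumes p: "Factorial_Ring.prime p" and t: "\<not> p ^ Suc i dvd t" and "k \<le> m"
    and Y: "Y \<subseteq> {0..<p ^ m}" "\<And>y. y \<in> Y \<Longrightarrow> p ^ k dvd y\<^sup>2 - t\<^sup>2"
  shows "card Y \<le> 4 * nat p ^ (m - k + i)"
proof -
  define s where "s = multiplicity p 2"
  \<comment> \<open>Truncated subtraction: for k <= i + s the congruences modulo p^r are vacuous,
    and the estimate below still holds.\<close>
  define r where "r = k - (i + s)"
  have p0: "p > 0" using p prime_gt_0_int by blast
  have up: "\<not> is_unit p" and pe: "prime_elem p" using p by auto
  have t0: "t \<noteq> 0" using t by auto
  have mt: "multiplicity p t \<le> i"
    using t t0 up by (simp add: power_dvd_iff_le_multiplicity del: power_Suc)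
  have cov: "p ^ r dvd y - t \<or> p ^ r dvd y - (- t)" if "y \<in> Y" for y
  proof (rule ccontr)
    assume neg: "\<not> ?thesis"
    then have nz: "y - t \<noteq> 0" "y + t \<noteq> 0" by auto
    define e f where "e = multiplicity p (y - t)" and "f = multiplicity p (y + t)"
    have ef: "e < r" "f < r"
      using neg nz up unfolding e_def f_def by (auto simp: power_dvd_iff_le_multiplicity)
    have "p ^ k dvd (y - t) * (y + t)"
      using Y(2)[OF that] by (simp add: power2_eq_square algebra_simps)
    then have "k \<le> e + f"
      using nz up unfolding e_def f_def
      by (simp add: power_dvd_iff_le_multiplicity prime_elem_multiplicity_mult_distrib[OF pe])
    moreover have "min e f \<le> i + s"
    proof -
      have "p ^ min e f dvd y - t" "p ^ min e f dvd y + t"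
        using nz up unfolding e_def f_def by (simp_all add: power_dvd_iff_le_multiplicity)
      then have "p ^ min e f dvd (y + t) - (y - t)" by (metis dvd_diff)
      then have "p ^ min e f dvd 2 * t" by (simp add: algebra_simps)
      then have "min e f \<le> s + multiplicity p t"
        using t0 up unfolding s_def
        by (simp add: power_dvd_iff_le_multiplicity prime_elem_multiplicity_mult_distrib[OF pe])
      with mt show ?thesis by simp
    qed
    ultimately show False using ef unfolding r_def by linarith
  qed
  have fin: "finite {y \<in> {0..<p ^ m}. P y}" for P
    by (rule finite_subset[of _ "{0..<p ^ m}"]) auto
  have rm: "r \<le> m" using \<open>k \<le> m\<close> unfolding r_def by simp
  have "Y \<subseteq> {y \<in> {0..<p ^ m}. p ^ r dvd y - t} \<union> {y \<in> {0..<p ^ m}. p ^ r dvd y - (- t)}"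
    using Y(1) cov by blast
  then have "card Y \<le> card ({y \<in> {0..<p ^ m}. p ^ r dvd y - t} \<union> {y \<in> {0..<p ^ m}. p ^ r dvd y - (- t)})"
    by (intro card_mono finite_UnI fin)
  also have "\<dots> \<le> nat p ^ (m - r) + nat p ^ (m - r)"
    using card_Un_le card_residue_class_le[OF p0 rm] by (meson add_mono order_trans)
  also have "\<dots> \<le> 2 * nat p ^ (m - k + i + s)"
  proof -
    have "nat p ^ (m - r) \<le> nat p ^ (m - k + i + s)"
      using \<open>k \<le> m\<close> p0 by (intro power_increasing) (auto simp: r_def)
    then show ?thesis by simp
  qed
  also have "\<dots> = 2 * (nat p ^ (m - k + i) * nat p ^ s)" by (simp add: power_add)
  also have "\<dots> \<le> 2 * (nat p ^ (m - k + i) * 2)"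
    using prime_power_multiplicity_two_le[OF p] unfolding s_def by (intro mult_left_mono) auto
  finally show ?thesis by simp
qed

text \<open>Here \<open>k - k div 2\<close> is k/2 rounded up. If that power of p divides every
  member, at most p^(k div 2) members remain; otherwise some member t has smaller order, and all
  members are near square roots of t^2. Comparing members with each other means that the common
  value of the squares never has to be named.\<close>

lemma card_congruent_squares_le:
  fixes p :: int
  assumes p: "Factorial_Ring.prime p" and Y: "Y \<subseteq> {0..<p ^ k}"
    and sq: "\<And>y z. y \<in> Y \<Longrightarrow> z \<in> Y \<Longrightarrow> p ^ k dvd y\<^sup>2 - z\<^sup>2"
  shows "card Y \<le> 4 * nat p ^ (k div 2)"
proof (cases "\<forall>y\<in>Y. p ^ (k - k div 2) dvd y")
  case True
  have p0: "p > 0" using p prime_gt_0_int by blast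
  have "Y \<subseteq> {y \<in> {0..<p ^ k}. p ^ (k - k div 2) dvd y - 0}" using True Y by auto
  then have "card Y \<le> card {y \<in> {0..<p ^ k}. p ^ (k - k div 2) dvd y - 0}"
    by (rule card_mono[rotated]) (rule finite_subset[of _ "{0..<p ^ k}"], auto)
  also have "\<dots> \<le> nat p ^ (k - (k - k div 2))" by (intro card_residue_class_le p0) auto
  finally show ?thesis by simp
next
  case False
  then obtain t where t: "t \<in> Y" "\<not> p ^ (k - k div 2) dvd t" by blast
  show ?thesis
  proof (cases "k = 0")
    case True
    then have "Y \<subseteq> {0}" using Y by auto
    then show ?thesis using True card_mono[of "{0}" Y] by simp
  next
    case False
    then obtain i where i: "k - k div 2 = Suc i" by (cases "k - k div 2") auto
    have "card Y \<le> 4 * nat p ^ (k - k + i)"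
      using card_square_roots_near_le[OF p _ order_refl Y sq[OF _ t(1)]] t(2) i by metis
    also have "\<dots> \<le> 4 * nat p ^ (k div 2)"
      using i prime_gt_0_int[OF p] by (auto intro!: power_increasing)
    finally show ?thesis .
  qed
qed

section \<open>The localization of the integers at a prime\<close>

definition loc :: "int \<Rightarrow> rat set" where
  "loc p = {x. \<exists>a b. \<not> p dvd b \<and> x * of_int b = of_int a}"

lemma locI: "\<not> p dvd b \<Longrightarrow> x * of_int b = of_int a \<Longrightarrow> x \<in> loc p"
  unfolding loc_def by blast

lemma loc_of_int [simp]: "Factorial_Ring.prime p \<Longrightarrow> of_int a \<in> loc p"
  by (rule locI[of _ 1 _ a]) (auto simp: not_prime_unit)

lemma loc_0 [simp]: "Factorial_Ring.prime p \<Longrightarrow> 0 \<in> loc p"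
  and loc_1 [simp]: "Factorial_Ring.prime p \<Longrightarrow> 1 \<in> loc p"
  using loc_of_int[of p 0] loc_of_int[of p 1] by auto

lemma loc_mult [intro]:
  assumes "Factorial_Ring.prime p" "x \<in> loc p" "y \<in> loc p"
  shows "x * y \<in> loc p"
proof -
  obtain a b c d where "\<not> p dvd b" "x * of_int b = of_int a" "\<not> p dvd d" "y * of_int d = of_int c"
    using assms unfolding loc_def by blast
  then have "\<not> p dvd b * d \<and> x * y * of_int (b * d) = of_int (a * c)"
    using assms(1) by (auto simp: prime_dvd_mult_iff) (metis mult.assoc mult.commute)
  then show ?thesis unfolding loc_def by blast
qed

lemma loc_add [intro]:
  assumes "Factorial_Ring.prime p" "x \<in> loc p" "y \<in> loc p"
  shows "x + y \<in> loc p"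
proof -
  obtain a b c d where h: "\<not> p dvd b" "x * of_int b = of_int a" "\<not> p dvd d" "y * of_int d = of_int c"
    using assms unfolding loc_def by blast
  have "(x + y) * of_int (b * d) = (x * of_int b) * of_int d + (y * of_int d) * of_int b"
    by (simp add: algebra_simps)
  also have "\<dots> = of_int (a * d + c * b)" using h by simp
  finally have "\<not> p dvd b * d \<and> (x + y) * of_int (b * d) = of_int (a * d + c * b)"
    using assms(1) h by (auto simp: prime_dvd_mult_iff)
  then show ?thesis unfolding loc_def by blast
qed

lemma loc_uminus [intro]:
  assumes "Factorial_Ring.prime p" "x \<in> loc p"
  shows "- x \<in> loc p"
  using loc_mult[OF assms(1) loc_of_int[OF assms(1), of "-1"] assms(2)] by simp

lemma loc_diff [intro]:
  assumes "Factorial_Ring.prime p" "x \<in> loc p" "y \<in> loc p"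
  shows "x - y \<in> loc p"
  using loc_add[OF assms(1,2) loc_uminus[OF assms(1,3)]] by simp

lemma loc_power [intro]:
  "Factorial_Ring.prime p \<Longrightarrow> x \<in> loc p \<Longrightarrow> x ^ k \<in> loc p"
  by (induction k) auto

lemma loc_sum [intro]:
  "Factorial_Ring.prime p \<Longrightarrow> (\<And>i. i \<in> A \<Longrightarrow> f i \<in> loc p) \<Longrightarrow> sum f A \<in> loc p"
  by (induction A rule: infinite_finite_induct) auto

lemma loc_prod [intro]:
  "Factorial_Ring.prime p \<Longrightarrow> (\<And>i. i \<in> A \<Longrightarrow> f i \<in> loc p) \<Longrightarrow> prod f A \<in> loc p"
  by (induction A rule: infinite_finite_induct) auto

lemma loc_det:
  assumes p: "Factorial_Ring.prime p" and "\<And>i j. A $ i $ j \<in> loc p"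
  shows "det (A :: rat ^ 'n ^ 'n) \<in> loc p"
  unfolding det_def using assms by (intro loc_sum loc_mult loc_prod) auto

lemma of_int_div_power_in_loc_iff:
  assumes p: "Factorial_Ring.prime p"
  shows "of_int x / of_int p ^ k \<in> loc p \<longleftrightarrow> p ^ k dvd x"
proof
  have p0: "p \<noteq> 0" using p by auto
  assume "of_int x / of_int p ^ k \<in> loc p"
  then obtain a b where ab: "\<not> p dvd b" "of_int x / of_int p ^ k * of_int b = (of_int a :: rat)"
    unfolding loc_def by blast
  then have "(of_int (x * b) :: rat) = of_int (a * p ^ k)"
    using p0 by (simp add: field_simps)
  then have "x * b = a * p ^ k" by (simp only: of_int_eq_iff)
  then have "p ^ k dvd x * b" by simp
  moreover have "coprime (p ^ k) b"
    using prime_imp_coprime[OF p ab(1)] by simp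
  ultimately show "p ^ k dvd x" by (simp add: coprime_dvd_mult_left_iff)
next
  assume "p ^ k dvd x"
  then show "of_int x / of_int p ^ k \<in> loc p" using p by (elim dvdE) (auto)
qed

lemma loc_residue:
  assumes p: "Factorial_Ring.prime p" and x: "x \<in> loc p"
  obtains r where "0 \<le> r" "r < p ^ k" "(x - of_int r) / of_int p ^ k \<in> loc p"
proof -
  have p0: "p > 0" using p prime_gt_0_int by blast
  obtain a b where ab: "\<not> p dvd b" "x * of_int b = of_int a"
    using x unfolding loc_def by blast
  have "coprime b (p ^ k)"
    using prime_imp_coprime[OF p ab(1)] by (simp add: coprime_commute)
  then obtain c where c: "[b * c = 1] (mod p ^ k)" using cong_solve_coprime_int by blast
  define r where "r = (a * c) mod p ^ k"
  have "p ^ k dvd a * (b * c - 1)" using c by (simp add: cong_iff_dvd_diff)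
  then have "p ^ k dvd b * (a * c) - a" by (simp add: algebra_simps)
  moreover have "p ^ k dvd a * c - r" unfolding r_def by (simp add: minus_mod_eq_mult_div)
  then have "p ^ k dvd b * (a * c - r)" by simp
  ultimately have "p ^ k dvd (b * (a * c) - a) - (b * (a * c - r))" by (rule dvd_diff)
  then have "p ^ k dvd - (a - r * b)" by (simp add: algebra_simps)
  then have "p ^ k dvd a - r * b" by (simp only: dvd_minus_iff)
  then obtain z where z: "a - r * b = p ^ k * z" by (elim dvdE)
  have "(x - of_int r) * of_int b = of_int (a - r * b)" using ab(2) by (simp add: algebra_simps)
  also have "\<dots> = of_int p ^ k * of_int z" by (simp add: z)
  finally have "(x - of_int r) / of_int p ^ k * of_int b = of_int z"
    using p0 by (simp add: field_simps)
  with ab have "(x - of_int r) / of_int p ^ k \<in> loc p" unfolding loc_def by blast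
  moreover have "0 \<le> r" "r < p ^ k" using p0 by (auto simp: r_def)
  ultimately show ?thesis using that by blast
qed

text \<open>Here a' is minus the order of x, and u is the inverse of the unit x p^a'. Scaling by u
  turns a coordinate of x's order into exactly p^(-a').\<close>

lemma not_loc_cases:
  assumes p: "Factorial_Ring.prime p" and x: "x * of_int p ^ a \<notin> loc p"
  obtains a' u where "a' > a" "u \<in> loc p" "u * (x * of_int p ^ a') = 1"
proof -
  have up: "\<not> is_unit p" using p by auto
  obtain m n where mn: "quotient_of x = (m, n)" by fastforce
  then have n: "n > 0" "coprime m n" "x = of_int m / of_int n"
    by (auto intro: quotient_of_denom_pos quotient_of_coprime quotient_of_div)
  obtain c n' where n': "n = p ^ c * n'" "\<not> p dvd n'"
    using multiplicity_decompose'[of n p] n(1) up by (metis less_irrefl)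
  have n0: "n' \<noteq> 0" "p \<noteq> 0" using n' n(1) p by auto
  have nc: "of_int n = (of_int p ^ c * of_int n' :: rat)"
    using n'(1) by simp
  have xc: "x * of_int p ^ c = of_int m / of_int n'"
    unfolding n(3) nc using n0 by (simp add: field_simps)
  have ca: "c > a"
  proof (rule ccontr)
    assume "\<not> ?thesis"
    then have "x * of_int p ^ a = of_int m / of_int n' * of_int p ^ (a - c)"
      unfolding xc[symmetric] by (simp flip: power_add)
    moreover have "of_int m / of_int n' \<in> loc p"
      using n'(2) n0 by (intro locI[of _ n' _ m]) auto
    then have "of_int m / of_int n' * of_int p ^ (a - c) \<in> loc p"
      using p by (intro loc_mult loc_power loc_of_int)
    ultimately show False using x by metis
  qed
  then have "p dvd n" unfolding n'(1) by (intro dvd_mult2 dvd_power) auto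
  then have pm: "\<not> p dvd m" using n(2) up by (metis coprime_common_divisor)
  then have m0: "m \<noteq> 0" by auto
  show ?thesis
  proof (rule that[OF ca])
    show "of_int n' / of_int m \<in> loc p"
      using pm m0 by (intro locI[of _ m _ n']) auto
    show "of_int n' / of_int m * (x * of_int p ^ c) = 1"
      unfolding xc using m0 n0 by simp
  qed
qed

lemma loc_all_primes_imp_int:
  assumes "\<And>p. Factorial_Ring.prime p \<Longrightarrow> x \<in> loc p"
  shows "x \<in> \<int>"
proof -
  obtain m n where mn: "quotient_of x = (m, n)" by fastforce
  then have n: "n > 0" "coprime m n" "x = of_int m / of_int n"
    by (auto intro: quotient_of_denom_pos quotient_of_coprime quotient_of_div)
  have "n = 1"
  proof (rule ccontr)
    assume "n \<noteq> 1"
    then have "\<not> is_unit n" using n(1) by simp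
    then obtain p where p: "Factorial_Ring.prime p" "p dvd n"
      using n(1) by (metis less_irrefl prime_divisor_exists)
    obtain a b where ab: "\<not> p dvd b" "x * of_int b = of_int a"
      using assms[OF p(1)] unfolding loc_def by blast
    then have "(of_int (m * b) :: rat) = of_int (a * n)" using n by (simp add: field_simps)
    then have "m * b = a * n" by (simp only: of_int_eq_iff)
    then have "p dvd m * b" using p(2) by simp
    then have "p dvd m" using ab(1) p(1) by (simp add: prime_dvd_mult_iff)
    then show False using n(2) p by (metis coprime_common_divisor not_prime_unit)
  qed
  then show ?thesis using n(3) by simp
qed

lemma card_fibers_le:
  assumes "finite (f ` S)" "card (f ` S) \<le> t"
    and "\<And>y. y \<in> f ` S \<Longrightarrow> finite {x \<in> S. f x = y} \<and> card {x \<in> S. f x = y} \<le> m"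
  shows "finite S \<and> card S \<le> t * m"
proof -
  have S: "S = (\<Union>y\<in>f ` S. {x \<in> S. f x = y})" by blast
  have "finite S" by (subst S, rule finite_UN_I) (use assms in auto)
  have "card S \<le> (\<Sum>y\<in>f ` S. card {x \<in> S. f x = y})"
    by (subst S, rule card_UN_le) (rule assms(1))
  also have "\<dots> \<le> (\<Sum>y\<in>f ` S. m)" using assms(3) by (intro sum_mono) auto
  also have "\<dots> \<le> t * m" using assms(2) by simp
  finally show ?thesis using \<open>finite S\<close> by simp
qed

lemma loc_cancel:
  assumes p: "Factorial_Ring.prime p" and "\<not> p dvd b" "of_int b * x \<in> loc p"
  shows "x \<in> loc p"
proof -
  obtain a c where "\<not> p dvd c" "of_int b * x * of_int c = of_int a"
    using assms(3) unfolding loc_def by blast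
  then show ?thesis using assms(1,2)
    by (intro locI[of p "b * c" _ a]) (auto simp: prime_dvd_mult_iff mult_ac)
qed

section \<open>Lattices over the localization\<close>

definition loc_module :: "int \<Rightarrow> (rat ^ 'n) set \<Rightarrow> bool" where
  "loc_module p L \<longleftrightarrow>
     0 \<in> L \<and> (\<forall>x\<in>L. \<forall>y\<in>L. x + y \<in> L) \<and> (\<forall>c\<in>loc p. \<forall>x\<in>L. c *s x \<in> L)"

lemma loc_moduleD:
  assumes "loc_module p L"
  shows "0 \<in> L" "x \<in> L \<Longrightarrow> y \<in> L \<Longrightarrow> x + y \<in> L" "c \<in> loc p \<Longrightarrow> x \<in> L \<Longrightarrow> c *s x \<in> L"
  using assms unfolding loc_module_def by auto

lemma loc_module_diff:
  assumes "Factorial_Ring.prime p" "loc_module p L" "x \<in> L" "y \<in> L"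
  shows "x - y \<in> L"
proof -
  have "(-1) *s y \<in> L" using assms loc_uminus[OF assms(1) loc_1] by (intro loc_moduleD(3)) auto
  then have "x + (-1) *s y \<in> L" using assms by (intro loc_moduleD(2))
  moreover have "x + (-1) *s y = x - y" by (simp add: vec_eq_iff)
  ultimately show ?thesis by simp
qed

definition slice :: "'n set \<Rightarrow> ('a :: zero ^ 'n) set \<Rightarrow> ('a ^ 'n) set" where
  "slice J L = {x \<in> L. \<forall>j. j \<notin> J \<longrightarrow> x $ j = 0}"

lemma sliceD: "x \<in> slice J L \<Longrightarrow> x \<in> L" "x \<in> slice J L \<Longrightarrow> j \<notin> J \<Longrightarrow> x $ j = 0"
  unfolding slice_def by auto

lemma slice_slice: "slice I (slice J L) = slice (I \<inter> J) L"
  unfolding slice_def by auto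

lemma loc_module_slice: "loc_module p L \<Longrightarrow> loc_module p (slice J L)"
  unfolding loc_module_def slice_def by auto

text \<open>The \<open>i\<close>-th coordinates of the vectors of \<open>L\<close> supported on \<open>J\<close> form the fractional ideal
  generated by \<open>p\<^sup>-\<^sup>a\<close>.\<close>

definition lead :: "int \<Rightarrow> (rat ^ 'n) set \<Rightarrow> 'n set \<Rightarrow> 'n \<Rightarrow> nat \<Rightarrow> bool" where
  "lead p L J i a \<longleftrightarrow> (\<exists>x\<in>slice J L. x $ i * of_int p ^ a = 1) \<and>
     (\<forall>x\<in>slice J L. x $ i * of_int p ^ a \<in> loc p)"

lemma power_quotient_in_loc_imp_le:
  assumes p: "Factorial_Ring.prime p" and "x * of_int p ^ a = 1" "x * of_int p ^ n \<in> loc p"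
  shows "a \<le> n"
proof (rule ccontr)
  assume "\<not> ?thesis"
  then obtain k where k: "a = n + Suc k" by (metis add_Suc_right less_imp_Suc_add not_le)
  have p0: "(of_int p :: rat) \<noteq> 0" using p by auto
  have "x * of_int p ^ n * of_int p ^ Suc k = 1"
    using assms(2) by (simp only: k power_add mult.assoc)
  then have "x * of_int p ^ n = of_int 1 / of_int p ^ Suc k" using p0 by (simp add: field_simps)
  then have "p ^ Suc k dvd 1" using of_int_div_power_in_loc_iff[OF p] assms(3) by metis
  then have "p dvd 1" by (metis dvd_mult_left power_Suc)
  then show False using p by auto
qed

text \<open>The exponents a such that p^(-a) occurs as an i-th coordinate on the slice are at most
  n, and 0 occurs because of e_i. Their maximum is the leading exponent: a coordinate with a larger
  denominator could be rescaled to a pure power of p with a larger exponent.\<close>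

lemma lead_exists:
  assumes p: "Factorial_Ring.prime p" and L: "loc_module p L" and ax: "axis i 1 \<in> L"
    and "i \<in> J" and bd: "\<And>x. x \<in> L \<Longrightarrow> x $ i * of_int p ^ n \<in> loc p"
  shows "\<exists>a\<le>n. lead p L J i a"
proof -
  define S where "S = {a. \<exists>x\<in>slice J L. x $ i * of_int p ^ a = 1}"
  have Sn: "a \<le> n" if "a \<in> S" for a
    using that bd power_quotient_in_loc_imp_le[OF p] unfolding S_def by (auto dest: sliceD)
  have fin: "finite S" using Sn by (meson finite_nat_set_iff_bounded_le)
  have "0 \<in> S" using ax \<open>i \<in> J\<close> unfolding S_def
    by (auto intro!: bexI[of _ "axis i 1"] simp: slice_def axis_def)
  then have M: "Max S \<in> S" using fin by (intro Max_in) auto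
  have "x $ i * of_int p ^ Max S \<in> loc p" if x: "x \<in> slice J L" for x
  proof (rule ccontr)
    assume "x $ i * of_int p ^ Max S \<notin> loc p"
    then obtain a' u where au: "a' > Max S" "u \<in> loc p" "u * (x $ i * of_int p ^ a') = 1"
      using not_loc_cases[OF p] by blast
    have "u *s x \<in> slice J L" using loc_moduleD(3)[OF loc_module_slice[OF L] au(2) x] .
    moreover have "(u *s x) $ i * of_int p ^ a' = 1" using au(3) by (simp add: mult_ac)
    ultimately have "a' \<in> S" unfolding S_def by blast
    then show False using Max_ge[OF fin] au(1) by force
  qed
  with M Sn[OF M] show ?thesis unfolding lead_def S_def by blast
qed

text \<open>One elimination step of a Hermite normal form: every i-th coordinate is a Z_(p)-multiple
  of that of x, and subtracting this multiple of x clears it.\<close>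

lemma lead_decompose:
  assumes p: "Factorial_Ring.prime p" and L: "loc_module p L" and "lead p L J i a"
    and x: "x \<in> slice J L" "x $ i * of_int p ^ a = 1" and y: "y \<in> slice J L"
  shows "y $ i * of_int p ^ a \<in> loc p"
    and "y - (y $ i * of_int p ^ a) *s x \<in> slice (J - {i}) L"
proof -
  show c: "y $ i * of_int p ^ a \<in> loc p" using assms unfolding lead_def by blast
  have "y - (y $ i * of_int p ^ a) *s x \<in> slice J L"
    by (rule loc_module_diff[OF p loc_module_slice[OF L] y
          loc_moduleD(3)[OF loc_module_slice[OF L] c x(1)]])
  moreover have "(y - (y $ i * of_int p ^ a) *s x) $ i = 0" using x(2) by (simp add: mult_ac)
  ultimately show "y - (y $ i * of_int p ^ a) *s x \<in> slice (J - {i}) L"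
    unfolding slice_def by auto
qed

lemma lead_slice_subset:
  assumes p: "Factorial_Ring.prime p" and L: "loc_module p L" "loc_module p L'"
    and ld: "lead p L J i a" and eq: "slice (J - {i}) L = slice (J - {i}) L'"
    and x: "x \<in> slice J L" "x $ i * of_int p ^ a = 1" and x': "x' \<in> slice J L'"
    and d: "x - x' \<in> L'"
  shows "slice J L \<subseteq> slice J L'"
proof
  fix y assume y: "y \<in> slice J L"
  note dec = lead_decompose[OF p L(1) ld x y]
  have "x \<in> slice J L'" using loc_moduleD(2)[OF L(2) d, of x'] x x' unfolding slice_def by auto
  then have "(y $ i * of_int p ^ a) *s x \<in> slice J L'"
    by (intro loc_moduleD(3)[OF loc_module_slice[OF L(2)] dec(1)])
  moreover have "y - (y $ i * of_int p ^ a) *s x \<in> slice J L'"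
  proof -
    have "slice (J - {i}) L' \<subseteq> slice J L'" unfolding slice_def by blast
    with dec(2) show ?thesis unfolding eq by blast
  qed
  ultimately have "(y - (y $ i * of_int p ^ a) *s x) + (y $ i * of_int p ^ a) *s x \<in> slice J L'"
    using loc_moduleD(2)[OF loc_module_slice[OF L(2)]] by blast
  then show "y \<in> slice J L'" by simp
qed

text \<open>A slice is generated by the next smaller slice and one vector with leading coefficient
  p^(-a). It is thus determined by that smaller slice and the class of this vector; the codes below
  record exactly such classes.\<close>

lemma lead_slice_eq:
  assumes p: "Factorial_Ring.prime p" and L: "loc_module p L" "loc_module p L'"
    and ld: "lead p L J i a" "lead p L' J i a" and eq: "slice (J - {i}) L = slice (J - {i}) L'"
    and x: "x \<in> slice J L" "x $ i * of_int p ^ a = 1"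
    and x': "x' \<in> slice J L'" "x' $ i * of_int p ^ a = 1" and d: "x - x' \<in> L'"
  shows "slice J L = slice J L'"
proof
  have "x $ i = x' $ i" using x(2) x'(2) by (metis mult_cancel_right mult_zero_right zero_neq_one)
  then have "x - x' \<in> slice (J - {i}) L'" using d x(1) x'(1) unfolding slice_def by auto
  then have "x - x' \<in> L" unfolding eq[symmetric] by (rule sliceD)
  then have "0 - (x - x') \<in> L" by (rule loc_module_diff[OF p L(1) loc_moduleD(1)[OF L(1)]])
  then have "x' - x \<in> L" by simp
  show "slice J L \<subseteq> slice J L'" by (rule lead_slice_subset[OF p L ld(1) eq x x'(1) d])
  show "slice J L' \<subseteq> slice J L"
    by (rule lead_slice_subset[OF p L(2,1) ld(2) eq[symmetric] x' x(1) \<open>x' - x \<in> L\<close>])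
qed

definition residue :: "int \<Rightarrow> nat \<Rightarrow> rat \<Rightarrow> int" where
  "residue p k x = (SOME r. 0 \<le> r \<and> r < p ^ k \<and> (x - of_int r) / of_int p ^ k \<in> loc p)"

lemma residue:
  assumes "Factorial_Ring.prime p" "x \<in> loc p"
  shows "residue p k x \<in> {0..<p ^ k}" "(x - of_int (residue p k x)) / of_int p ^ k \<in> loc p"
proof -
  have "\<exists>r. 0 \<le> r \<and> r < p ^ k \<and> (x - of_int r) / of_int p ^ k \<in> loc p"
    using loc_residue[OF assms] by metis
  from someI_ex[OF this] show "residue p k x \<in> {0..<p ^ k}"
    "(x - of_int (residue p k x)) / of_int p ^ k \<in> loc p" unfolding residue_def by auto
qed

lemma residue_eqD:
  assumes p: "Factorial_Ring.prime p" and "x \<in> loc p" "y \<in> loc p" "residue p k x = residue p k y"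
  shows "(x - y) / of_int p ^ k \<in> loc p"
proof -
  have "(x - of_int (residue p k x)) / of_int p ^ k - (y - of_int (residue p k y)) / of_int p ^ k
      \<in> loc p"
    by (intro loc_diff residue p assms)
  then show ?thesis using assms(4) by (simp add: diff_divide_distrib)
qed

section \<open>Overlattices of Z_(p)^4 for a diagonal quaternary form\<close>

locale orthogonal_overlattices =
  fixes p \<beta> :: int and d :: "4 \<Rightarrow> int" and n :: nat
  assumes p: "Factorial_Ring.prime p" and d: "d i \<noteq> 0" and \<beta>: "\<beta> \<noteq> 0"
begin

definition bil :: "rat ^ 4 \<Rightarrow> rat ^ 4 \<Rightarrow> rat" where
  "bil x y = (\<Sum>i\<in>UNIV. of_int (d i) * x $ i * y $ i)"

text \<open>What is retained of the preimage of Z_(p)^4 under a representation, written in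
  coordinates along an orthogonal system. Integrality of \<open>bil\<close> comes from the polar
  form of Q, \<beta> measures the distance from self-duality, and \<open>n\<close> bounds the
  leading exponents and with them the number of shapes of the flag.\<close>

definition overlattice :: "(rat ^ 4) set \<Rightarrow> bool" where
  "overlattice L \<longleftrightarrow> loc_module p L \<and> (\<forall>i. axis i 1 \<in> L) \<and>
     (\<forall>x\<in>L. \<forall>y\<in>L. bil x y \<in> loc p) \<and>
     (\<forall>x. (\<forall>y\<in>L. bil x y \<in> loc p) \<longrightarrow> of_int \<beta> *s x \<in> L) \<and>
     (\<forall>x\<in>L. \<forall>i. x $ i * of_int p ^ n \<in> loc p)"

abbreviation \<pi> :: rat where "\<pi> \<equiv> of_int p"

definition kap :: "4 \<Rightarrow> nat" where "kap i = multiplicity p (d i)"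
definition unt :: "4 \<Rightarrow> int" where "unt i = d i div p ^ kap i"
definition bord where "bord = multiplicity p \<beta>"

lemma p_gt_0: "p > 0" and not_unit_p: "\<not> is_unit p"
  using p prime_gt_0_int by auto

lemma p_ne_0 [simp]: "p \<noteq> 0"
  using p_gt_0 by simp

lemma d_eq: "d i = p ^ kap i * unt i" and unt: "\<not> p dvd unt i"
proof -
  show "d i = p ^ kap i * unt i" unfolding unt_def kap_def by (simp add: multiplicity_dvd)
  show "\<not> p dvd unt i"
    unfolding unt_def kap_def using d not_unit_p by (intro multiplicity_decompose) auto
qed

lemma of_int_d: "of_int (d i) = \<pi> ^ kap i * of_int (unt i)"
  by (subst d_eq) simp

lemma overlatticeD:
  assumes "overlattice L"
  shows "loc_module p L" "axis i 1 \<in> L" "x \<in> L \<Longrightarrow> y \<in> L \<Longrightarrow> bil x y \<in> loc p"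
    "(\<And>y. y \<in> L \<Longrightarrow> bil x y \<in> loc p) \<Longrightarrow> of_int \<beta> *s x \<in> L"
    "x \<in> L \<Longrightarrow> x $ i * \<pi> ^ n \<in> loc p"
  using assms unfolding overlattice_def by auto

lemma overlattice_add: "overlattice L \<Longrightarrow> x \<in> L \<Longrightarrow> y \<in> L \<Longrightarrow> x + y \<in> L"
  and overlattice_scale: "overlattice L \<Longrightarrow> c \<in> loc p \<Longrightarrow> x \<in> L \<Longrightarrow> c *s x \<in> L"
  and overlattice_diff: "overlattice L \<Longrightarrow> x \<in> L \<Longrightarrow> y \<in> L \<Longrightarrow> x - y \<in> L"
  using loc_moduleD[OF overlatticeD(1)] loc_module_diff[OF p overlatticeD(1)] by auto

lemma bil_4:
  "bil x y = of_int (d 1) * x $ 1 * y $ 1 + of_int (d 2) * x $ 2 * y $ 2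
     + of_int (d 3) * x $ 3 * y $ 3 + of_int (d 4) * x $ 4 * y $ 4"
  unfolding bil_def sum_4 ..

lemma bil_add_scale: "bil y (m + c *s x) = bil y m + c * bil y x"
  unfolding bil_4 by (simp add: algebra_simps)

text \<open>Pairing with e_i gives d_i x_i. Modulo Z_(p) the i-th coordinate thus takes one of
  p^kappa_i values.\<close>

lemma overlattice_coord:
  assumes "overlattice L" "x \<in> L"
  shows "x $ i * \<pi> ^ kap i \<in> loc p"
proof -
  have "bil x (axis i 1) = of_int (d i) * x $ i"
    unfolding bil_def by (subst sum.remove[of _ i]) (auto simp: axis_def intro!: sum.neutral)
  then have "of_int (d i) * x $ i \<in> loc p" using overlatticeD(2,3)[OF assms(1)] assms(2) by metis
  then have "of_int (unt i) * (x $ i * \<pi> ^ kap i) \<in> loc p" by (simp add: of_int_d mult_ac)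
  then show ?thesis by (rule loc_cancel[OF p unt])
qed

lemma loc_vector_in_overlattice:
  assumes L: "overlattice L" and "\<And>i. x $ i \<in> loc p"
  shows "x \<in> L"
proof -
  have "x = x $ 1 *s axis 1 1 + x $ 2 *s axis 2 1 + x $ 3 *s axis 3 1 + x $ 4 *s axis 4 1"
    by (simp add: vec_eq_iff forall_4 axis_def)
  also have "\<dots> \<in> L"
    by (intro overlattice_add overlattice_scale L assms overlatticeD(2))
  finally show ?thesis .
qed

section \<open>The first three generators\<close>

definition flagged :: "nat \<Rightarrow> nat \<Rightarrow> nat \<Rightarrow> (rat ^ 4) set set" where
  "flagged a1 a2 a3 = {L. overlattice L \<and> lead p L {1} 1 a1 \<and> lead p L {1,2} 2 a2 \<and>
     lead p L {1,2,3} 3 a3}"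

text \<open>The rank-one slice is p^(-a1) Z_(p) e_1; the exponent alone determines it, so the first
  generator contributes nothing to the count.\<close>

lemma slice_1:
  assumes L: "L \<in> flagged a1 a2 a3"
  shows "slice {1} L = {x. x $ 1 * \<pi> ^ a1 \<in> loc p \<and> x $ 2 = 0 \<and> x $ 3 = 0 \<and> x $ 4 = 0}"
    (is "_ = ?R")
proof
  have ld: "lead p L {1} 1 a1" and ov: "overlattice L" using L unfolding flagged_def by auto
  show "slice {1} L \<subseteq> ?R" using ld unfolding lead_def slice_def by auto
  obtain g where g: "g \<in> slice {1} L" "g $ 1 * \<pi> ^ a1 = 1" using ld unfolding lead_def by blast
  show "?R \<subseteq> slice {1} L"
  proof
    fix x assume x: "x \<in> ?R"
    have "x = (x $ 1 * \<pi> ^ a1) *s g"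
      using x g by (auto simp: vec_eq_iff forall_4 slice_def mult_ac)
    also have "\<dots> \<in> slice {1} L"
      using x g(1) by (intro loc_moduleD(3)[OF loc_module_slice[OF overlatticeD(1)[OF ov]]]) auto
    finally show "x \<in> slice {1} L" .
  qed
qed

text \<open>The choice is made from P and not from the lattice, and sees only the part of P
  supported on {1,2}. Lattices sharing this part therefore share the vector itself, not just its
  class.\<close>

definition gen2 where
  "gen2 a2 P = (SOME x. x \<in> slice {1,2} P \<and> x $ 2 * \<pi> ^ a2 = 1)"
definition gen3 where
  "gen3 a3 P = (SOME x. x \<in> P \<and> x $ 3 * \<pi> ^ a3 = 1)"

lemma gen2:
  assumes "L \<in> flagged a1 a2 a3" "P = slice {1,2,3} L"
  shows "gen2 a2 P \<in> slice {1,2} L" "gen2 a2 P $ 2 * \<pi> ^ a2 = 1"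
proof -
  have sl: "slice {1,2} P = slice {1,2} L" using assms by (simp add: slice_slice Int_absorb2 insert_commute)
  then have "\<exists>x. x \<in> slice {1,2} P \<and> x $ 2 * \<pi> ^ a2 = 1"
    using assms unfolding flagged_def lead_def by auto
  from someI_ex[OF this] show "gen2 a2 P \<in> slice {1,2} L" "gen2 a2 P $ 2 * \<pi> ^ a2 = 1"
    unfolding gen2_def sl by auto
qed

lemma gen3:
  assumes "L \<in> flagged a1 a2 a3" "P = slice {1,2,3} L"
  shows "gen3 a3 P \<in> slice {1,2,3} L" "gen3 a3 P $ 3 * \<pi> ^ a3 = 1"
proof -
  have "\<exists>x. x \<in> P \<and> x $ 3 * \<pi> ^ a3 = 1"
    using assms unfolding flagged_def lead_def by auto
  from someI_ex[OF this] show "gen3 a3 P \<in> slice {1,2,3} L" "gen3 a3 P $ 3 * \<pi> ^ a3 = 1"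
    unfolding gen3_def using assms by auto
qed

text \<open>The class of the second generator modulo the first: its first coordinate modulo p^(-a1),
  rescaled by p^(a1 + a2) to a class modulo p^a2.\<close>

definition code2 where
  "code2 a1 a2 P = residue p a2 (gen2 a2 P $ 1 * \<pi> ^ (a1 + a2))"

lemma gen2_coord:
  assumes L: "L \<in> flagged a1 a2 a3" "P = slice {1,2,3} L"
  shows "gen2 a2 P $ 1 * \<pi> ^ (a1 + a2) \<in> loc p"
proof -
  note g = gen2[OF L]
  have ov: "overlattice L" using L unfolding flagged_def by auto
  \<comment> \<open>Cancelling the second coordinate against e_2 leaves a vector of the rank-one
    slice, whose denominator is at most p^a1.\<close>
  have "\<pi> ^ a2 *s gen2 a2 P - axis 2 1 \<in> L"
    using g(1) by (intro overlattice_diff[OF ov] overlattice_scale[OF ov] overlatticeD(2)[OF ov])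
      (auto dest: sliceD simp: p loc_power)
  then have "\<pi> ^ a2 *s gen2 a2 P - axis 2 1 \<in> slice {1} L"
    using g by (auto simp: slice_def forall_4 axis_def mult_ac)
  then have "(\<pi> ^ a2 *s gen2 a2 P - axis 2 1) $ 1 * \<pi> ^ a1 \<in> loc p"
    unfolding slice_1[OF L(1)] by blast
  then show ?thesis by (simp add: axis_def power_add mult_ac)
qed

lemma code2_eqD:
  assumes L: "L \<in> flagged a1 a2 a3" "P = slice {1,2,3} L"
    and L': "L' \<in> flagged a1 a2 a3" "P' = slice {1,2,3} L'"
    and eq: "code2 a1 a2 P = code2 a1 a2 P'"
  shows "slice {1,2} L = slice {1,2} L'" "gen2 a2 P = gen2 a2 P'"
proof -
  note g = gen2[OF L] and g' = gen2[OF L']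
  have ov: "overlattice L" "overlattice L'" and ld: "lead p L {1,2} 2 a2" "lead p L' {1,2} 2 a2"
    using L L' unfolding flagged_def by auto
  have "gen2 a2 P $ 2 = gen2 a2 P' $ 2"
    using g(2) g'(2) by (metis mult_cancel_right mult_zero_right zero_neq_one)
  moreover have "(gen2 a2 P $ 1 * \<pi> ^ (a1 + a2) - gen2 a2 P' $ 1 * \<pi> ^ (a1 + a2)) / \<pi> ^ a2 \<in> loc p"
    using eq unfolding code2_def by (intro residue_eqD p gen2_coord[OF L] gen2_coord[OF L'])
  moreover have "(gen2 a2 P $ 1 * \<pi> ^ (a1 + a2) - gen2 a2 P' $ 1 * \<pi> ^ (a1 + a2)) / \<pi> ^ a2
      = (gen2 a2 P $ 1 - gen2 a2 P' $ 1) * \<pi> ^ a1"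
    by (simp add: power_add field_simps)
  ultimately have "gen2 a2 P - gen2 a2 P' \<in> slice {1} L'"
    unfolding slice_1[OF L'(1)] using g(1) g'(1) by (auto simp: slice_def)
  then have "gen2 a2 P - gen2 a2 P' \<in> L'" by (rule sliceD)
  moreover have "slice ({1,2} - {2}) L = slice ({1,2} - {2}) L'"
  proof -
    have "{1,2} - {2} = {1 :: 4}" by auto
    then show ?thesis using slice_1[OF L(1)] slice_1[OF L'(1)] by simp
  qed
  ultimately show *: "slice {1,2} L = slice {1,2} L'"
    by (intro lead_slice_eq[OF p _ _ ld _ g g']) (use ov overlatticeD(1) in auto)
  show "gen2 a2 P = gen2 a2 P'"
    using * L(2) L'(2) unfolding gen2_def by (simp add: slice_slice Int_absorb2)
qed

text \<open>The sum is the norm of (r / p^kappa_1, s / p^kappa_2, p^(-a3), 0), a representative of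
  the third generator modulo e_1 and e_2.\<close>

definition sols :: "nat \<Rightarrow> (int \<times> int) set" where
  "sols a3 = {(r, s). r \<in> {0..<p ^ kap 1} \<and> s \<in> {0..<p ^ kap 2} \<and>
     of_int (unt 1 * r\<^sup>2) / \<pi> ^ kap 1 + of_int (unt 2 * s\<^sup>2) / \<pi> ^ kap 2
       + of_int (d 3) / \<pi> ^ (2 * a3) \<in> loc p}"

text \<open>The first coordinate is unrestricted. Once it is fixed, the difference of two integral
  norms is u_2 (s^2 - t^2) / p^kappa_2 with a unit u_2, so all squares s^2 are congruent and the
  exponent of the second coordinate is halved.\<close>

lemma card_sols:
  "finite (sols a3) \<and> card (sols a3) \<le> nat p ^ kap 1 * (4 * nat p ^ (kap 2 div 2))"
proof (rule card_fibers_le[where f = fst])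
  have sub: "fst ` sols a3 \<subseteq> {0..<p ^ kap 1}" unfolding sols_def by auto
  then show "finite (fst ` sols a3)" by (rule finite_subset) simp
  show "card (fst ` sols a3) \<le> nat p ^ kap 1"
    using card_mono[OF _ sub] p_gt_0 by (simp add: nat_power_eq)
  fix r assume "r \<in> fst ` sols a3"
  define Y where "Y = {s. (r, s) \<in> sols a3}"
  have Y: "Y \<subseteq> {0..<p ^ kap 2}" unfolding Y_def sols_def by auto
  have "card Y \<le> 4 * nat p ^ (kap 2 div 2)"
  proof (rule card_congruent_squares_le[OF p Y])
    fix s t assume "s \<in> Y" "t \<in> Y"
    then have "(of_int (unt 1 * r\<^sup>2) / \<pi> ^ kap 1 + of_int (unt 2 * s\<^sup>2) / \<pi> ^ kap 2
       + of_int (d 3) / \<pi> ^ (2 * a3)) - (of_int (unt 1 * r\<^sup>2) / \<pi> ^ kap 1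
       + of_int (unt 2 * t\<^sup>2) / \<pi> ^ kap 2 + of_int (d 3) / \<pi> ^ (2 * a3)) \<in> loc p"
      unfolding Y_def sols_def by (intro loc_diff p) auto
    then have "of_int (unt 2) * (of_int (s\<^sup>2 - t\<^sup>2) / \<pi> ^ kap 2) \<in> loc p"
      by (simp add: algebra_simps diff_divide_distrib)
    then have "of_int (s\<^sup>2 - t\<^sup>2) / \<pi> ^ kap 2 \<in> loc p" by (rule loc_cancel[OF p unt])
    then show "p ^ kap 2 dvd s\<^sup>2 - t\<^sup>2" by (simp only: of_int_div_power_in_loc_iff[OF p])
  qed
  moreover have "{x \<in> sols a3. fst x = r} = Pair r ` Y" unfolding Y_def by auto
  ultimately show "finite {x \<in> sols a3. fst x = r} \<and>
      card {x \<in> sols a3. fst x = r} \<le> 4 * nat p ^ (kap 2 div 2)"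
    using finite_subset[OF Y] by (auto simp: card_image inj_on_def)
qed

text \<open>A slice \<open>P\<close> together with \<open>0 \<le> j < p\<^bsup>a2\<^esup>\<close> is encoded by the class of its second generator and
  by the class, modulo \<open>e\<^sub>1\<close> and \<open>e\<^sub>2\<close>, of its third generator shifted by \<open>j\<close> times the second one.
  The shifts compensate for the \<open>p\<^bsup>a2\<^esup>\<close> possibilities for the second generator.\<close>

definition code3 where
  "code3 a1 a2 a3 = (\<lambda>(P, j). let y = gen3 a3 P + of_int j *s gen2 a2 P in
     (code2 a1 a2 P, residue p (kap 1) (y $ 1 * \<pi> ^ kap 1), residue p (kap 2) (y $ 2 * \<pi> ^ kap 2)))"

text \<open>Equal first components yield a common second generator g. The shifted third generators y
  and y' then differ by a vector of Z_(p)^4, which lies in every overlattice; since the shifts are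
  multiples of g, the third generators agree modulo L', and P = P'. Now y - y' = (j - j') g, and its
  integral second coordinate (j - j') / p^a2 forces j = j'.\<close>

lemma inj_on_code3:
  "inj_on (code3 a1 a2 a3) ((slice {1,2,3} ` flagged a1 a2 a3) \<times> {0..<p ^ a2})"
proof (rule inj_onI)
  fix u v assume u: "u \<in> (slice {1,2,3} ` flagged a1 a2 a3) \<times> {0..<p ^ a2}"
    and v: "v \<in> (slice {1,2,3} ` flagged a1 a2 a3) \<times> {0..<p ^ a2}"
    and eq: "code3 a1 a2 a3 u = code3 a1 a2 a3 v"
  obtain P j where uP: "u = (P, j)" by fastforce
  obtain P' j' where vP: "v = (P', j')" by fastforce
  obtain L L' where L: "L \<in> flagged a1 a2 a3" "P = slice {1,2,3} L"
    and L': "L' \<in> flagged a1 a2 a3" "P' = slice {1,2,3} L'" using u v uP vP by auto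
  note g = gen2[OF L] gen3[OF L] and g' = gen2[OF L'] gen3[OF L']
  have ov: "overlattice L" "overlattice L'"
    and ld: "lead p L {1,2,3} 3 a3" "lead p L' {1,2,3} 3 a3"
    using L L' unfolding flagged_def by auto
  define y where "y = gen3 a3 P + of_int j *s gen2 a2 P"
  define y' where "y' = gen3 a3 P' + of_int j' *s gen2 a2 P'"
  have yL: "y \<in> L" unfolding y_def using g
    by (intro overlattice_add[OF ov(1)] overlattice_scale[OF ov(1)]) (auto dest: sliceD simp: p)
  have yL': "y' \<in> L'" unfolding y'_def using g'
    by (intro overlattice_add[OF ov(2)] overlattice_scale[OF ov(2)]) (auto dest: sliceD simp: p)
  have eqs: "code2 a1 a2 P = code2 a1 a2 P'"
      "residue p (kap 1) (y $ 1 * \<pi> ^ kap 1) = residue p (kap 1) (y' $ 1 * \<pi> ^ kap 1)"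
      "residue p (kap 2) (y $ 2 * \<pi> ^ kap 2) = residue p (kap 2) (y' $ 2 * \<pi> ^ kap 2)"
    using eq unfolding uP vP code3_def y_def y'_def by (auto simp: Let_def)
  note M = code2_eqD[OF L L' eqs(1)]
  have c: "y $ i - y' $ i \<in> loc p"
    if "residue p (kap i) (y $ i * \<pi> ^ kap i) = residue p (kap i) (y' $ i * \<pi> ^ kap i)" for i
  proof -
    have "(y $ i * \<pi> ^ kap i - y' $ i * \<pi> ^ kap i) / \<pi> ^ kap i \<in> loc p"
      using that by (intro residue_eqD p overlattice_coord[OF ov(1) yL] overlattice_coord[OF ov(2) yL'])
    then show ?thesis by (simp flip: left_diff_distrib)
  qed
  have g3: "gen3 a3 P $ 3 = gen3 a3 P' $ 3"
    using g(4) g'(4) by (metis mult_cancel_right mult_zero_right zero_neq_one)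
  have z: "(y - y') $ 3 = 0" "(y - y') $ 4 = 0"
    using g3 g(1,3) g'(1,3) unfolding y_def y'_def slice_def by auto
  have "(y - y') $ i \<in> loc p" for i
    using exhaust_4[of i] c[of 1] c[of 2] eqs z p by auto
  then have "y - y' \<in> L'" by (rule loc_vector_in_overlattice[OF ov(2)])
  moreover have "of_int (j' - j) *s gen2 a2 P' \<in> L'"
    using g' by (intro overlattice_scale[OF ov(2)]) (auto dest: sliceD simp: p simp del: of_int_diff)
  ultimately have "(y - y') + of_int (j' - j) *s gen2 a2 P' \<in> L'" by (rule overlattice_add[OF ov(2)])
  then have "gen3 a3 P - gen3 a3 P' \<in> L'"
    unfolding y_def y'_def M(2) by (simp add: algebra_simps vec_eq_iff vector_sub_rdistrib)
  then have "slice {1,2,3} L = slice {1,2,3} L'"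
    using M(1) by (intro lead_slice_eq[OF p _ _ ld _ g(3,4) g'(3,4)])
      (use ov overlatticeD(1) in \<open>auto simp: insert_Diff_if\<close>)
  then have PP: "P = P'" using L L' by simp
  have "of_int (j - j') / \<pi> ^ a2 = y $ 2 - y' $ 2"
    using g(2) unfolding y_def y'_def PP
    by (simp add: field_simps)
  also have "\<dots> \<in> loc p" using c eqs by blast
  finally have "p ^ a2 dvd j - j'" by (simp only: of_int_div_power_in_loc_iff[OF p])
  then have "j mod p ^ a2 = j' mod p ^ a2" by (simp add: mod_eq_dvd_iff)
  then have "j = j'" using u v uP vP by simp
  with PP show "u = v" using uP vP by simp
qed

lemma code3_range:
  "code3 a1 a2 a3 ` ((slice {1,2,3} ` flagged a1 a2 a3) \<times> {0..<p ^ a2})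
     \<subseteq> {0..<p ^ a2} \<times> sols a3"
proof
  fix v assume "v \<in> code3 a1 a2 a3 ` ((slice {1,2,3} ` flagged a1 a2 a3) \<times> {0..<p ^ a2})"
  then obtain L j where L0: "L \<in> flagged a1 a2 a3" and v: "v = code3 a1 a2 a3 (slice {1,2,3} L, j)"
    by auto
  define P where "P = slice {1,2,3} L"
  note L = L0 P_def
  note g = gen2[OF L] gen3[OF L]
  have ov: "overlattice L" using L unfolding flagged_def by auto
  define y where "y = gen3 a3 P + of_int j *s gen2 a2 P"
  have yL: "y \<in> L" unfolding y_def using g
    by (intro overlattice_add[OF ov] overlattice_scale[OF ov]) (auto dest: sliceD simp: p)
  define r where "r i = residue p (kap i) (y $ i * \<pi> ^ kap i)" for i
  have r: "r i \<in> {0..<p ^ kap i}" "(y $ i * \<pi> ^ kap i - of_int (r i)) / \<pi> ^ kap i \<in> loc p" for i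
    unfolding r_def using residue[OF p overlattice_coord[OF ov yL]] by auto
  \<comment> \<open>With y_i = z + r_i / p^kappa_i and z integral, both d_i z^2 and the mixed term 2
    u_i z r_i are integral, so passing to the representative keeps the norm modulo Z_(p).\<close>
  have sq: "of_int (d i) * y $ i * y $ i - of_int (unt i * (r i)\<^sup>2) / \<pi> ^ kap i \<in> loc p" for i
  proof -
    define z where "z = (y $ i * \<pi> ^ kap i - of_int (r i)) / \<pi> ^ kap i"
    have y: "y $ i = z + of_int (r i) / \<pi> ^ kap i" unfolding z_def by (simp add: field_simps)
    have "of_int (d i) * y $ i * y $ i - of_int (unt i * (r i)\<^sup>2) / \<pi> ^ kap i
        = of_int (unt i) * (z * (\<pi> ^ kap i * z + of_int (2 * r i)))"
      unfolding y of_int_d by (simp add: field_simps power2_eq_square)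
    also have "\<dots> \<in> loc p" using r(2)[of i] p unfolding z_def[symmetric]
      by (intro loc_mult loc_add loc_power loc_of_int)
    finally show ?thesis .
  qed
  have y34: "y $ 3 = 1 / \<pi> ^ a3" "y $ 4 = 0"
    using g unfolding y_def by (auto simp: slice_def field_simps)
  have "bil y y - (of_int (d 1) * y $ 1 * y $ 1 - of_int (unt 1 * (r 1)\<^sup>2) / \<pi> ^ kap 1)
      - (of_int (d 2) * y $ 2 * y $ 2 - of_int (unt 2 * (r 2)\<^sup>2) / \<pi> ^ kap 2) \<in> loc p"
    by (intro loc_diff p sq overlatticeD(3)[OF ov] yL)
  then have "of_int (unt 1 * (r 1)\<^sup>2) / \<pi> ^ kap 1 + of_int (unt 2 * (r 2)\<^sup>2) / \<pi> ^ kap 2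
       + of_int (d 3) / \<pi> ^ (2 * a3) \<in> loc p"
    unfolding bil_4 y34 by (simp add: mult_2 power_add add_ac)
  then have "(r 1, r 2) \<in> sols a3" using r(1) unfolding sols_def by auto
  moreover have "code2 a1 a2 P \<in> {0..<p ^ a2}"
    unfolding code2_def by (intro residue p gen2_coord[OF L])
  ultimately show "v \<in> {0..<p ^ a2} \<times> sols a3"
    unfolding v code3_def r_def y_def P_def by (simp add: Let_def)
qed

text \<open>p^a2 copies of the set of slices inject into p^a2 copies of the set of solutions. After
  cancellation the bound is free of the leading exponents.\<close>

lemma card_slices:
  "finite (slice {1,2,3} ` flagged a1 a2 a3) \<and>
   card (slice {1,2,3} ` flagged a1 a2 a3) \<le> nat p ^ kap 1 * (4 * nat p ^ (kap 2 div 2))"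
proof
  let ?S = "slice {1,2,3} ` flagged a1 a2 a3"
  have fin: "finite ({0..<p ^ a2} \<times> sols a3)" using card_sols by simp
  have pa: "p ^ a2 > 0" using p_gt_0 by simp
  have "finite (?S \<times> {0..<p ^ a2})"
    by (rule inj_on_finite[OF inj_on_code3 code3_range fin])
  then show "finite ?S" using pa by (auto simp: finite_cartesian_product_iff)
  have "card ?S * nat (p ^ a2) \<le> nat (p ^ a2) * card (sols a3)"
    using card_inj_on_le[OF inj_on_code3 code3_range fin] by (simp add: card_cartesian_product)
  then have "card ?S \<le> card (sols a3)" using pa by simp
  with card_sols show "card ?S \<le> nat p ^ kap 1 * (4 * nat p ^ (kap 2 div 2))"
    by (meson order_trans)
qed

section \<open>The last generator over a fixed rank-three slice, measured against a reference
  lattice\<close>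

definition proj :: "rat ^ 4 \<Rightarrow> rat ^ 4" where "proj x = x - x $ 4 *s axis 4 1"

lemma proj_nth [simp]: "proj x $ 1 = x $ 1" "proj x $ 2 = x $ 2" "proj x $ 3 = x $ 3" "proj x $ 4 = 0"
  unfolding proj_def by (simp_all add: axis_def)

lemma inverse_unit_in_loc: "\<not> p dvd c \<Longrightarrow> 1 / of_int c \<in> loc p"
  by (rule locI[of p c _ 1]) auto

definition unit_beta :: int where "unit_beta = \<beta> div p ^ bord"

lemma beta_eq: "\<beta> = p ^ bord * unit_beta" and unit_beta: "\<not> p dvd unit_beta"
proof -
  show "\<beta> = p ^ bord * unit_beta" unfolding unit_beta_def bord_def by (simp add: multiplicity_dvd)
  show "\<not> p dvd unit_beta"
    unfolding unit_beta_def bord_def using \<beta> not_unit_p by (intro multiplicity_decompose) auto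
qed

lemma of_int_beta: "of_int \<beta> = \<pi> ^ bord * of_int unit_beta"
  by (subst beta_eq) simp

context
  fixes a1 a2 a3 a4 :: nat and L0 :: "(rat ^ 4) set" and x0 :: "rat ^ 4"
  assumes L0: "L0 \<in> flagged a1 a2 a3" "lead p L0 UNIV 4 a4"
    and x0: "x0 \<in> L0" "x0 $ 4 * \<pi> ^ a4 = 1"
begin

abbreviation (input) "P \<equiv> slice {1,2,3} L0"

lemma ov0: "overlattice L0"
  using L0(1) unfolding flagged_def by auto

lemma P_iff: "x \<in> P \<longleftrightarrow> x \<in> L0 \<and> x $ 4 = 0"
  using exhaust_4 by (auto simp: slice_def)

lemma P_module: "loc_module p P"
  by (rule loc_module_slice[OF overlatticeD(1)[OF ov0]])

lemma decompose4:
  assumes "w \<in> L0"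
  shows "w $ 4 * \<pi> ^ a4 \<in> loc p" "w - (w $ 4 * \<pi> ^ a4) *s x0 \<in> P"
proof -
  have sl: "slice UNIV L0 = L0" by (auto simp: slice_def)
  have P: "slice (UNIV - {4}) L0 = P" by (auto simp: slice_def) (metis exhaust_4)
  show "w $ 4 * \<pi> ^ a4 \<in> loc p" "w - (w $ 4 * \<pi> ^ a4) *s x0 \<in> P"
    using lead_decompose[OF p overlatticeD(1)[OF ov0] L0(2), of x0 w] x0 assms
    unfolding sl P by auto
qed

text \<open>Fourth coordinates have denominator at most p^a4, so p^(a4 - kappa_4) e_4 is dual to
  \<open>L0\<close> and its multiple by \<beta> lies in \<open>L0\<close>. Its fourth coordinate
  gives the bound on kappa_4. Subtracting it, up to a unit, from p^g x0 with g = bord + 2 a4 -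
  kappa_4 puts p^g \<open>proj x0\<close> into P; hence coefficients of \<open>proj x0\<close>
  matter only modulo p^g.\<close>

lemma last_axis:
  shows "kap 4 \<le> bord + 2 * a4" "\<pi> ^ (bord + 2 * a4 - kap 4) *s proj x0 \<in> P"
proof -
  define g where "g = bord + 2 * a4 - kap 4"
  define y where "y = (\<pi> ^ a4 / \<pi> ^ kap 4) *s (axis 4 1 :: rat ^ 4)"
  have "of_int \<beta> *s y \<in> L0"
  proof (rule overlatticeD(4)[OF ov0])
    fix w assume w: "w \<in> L0"
    have "bil y w = of_int (unt 4) * (w $ 4 * \<pi> ^ a4)"
      unfolding bil_4 y_def of_int_d by (simp add: axis_def field_simps)
    also have "\<dots> \<in> loc p" by (rule loc_mult[OF p loc_of_int[OF p] decompose4(1)[OF w]])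
    finally show "bil y w \<in> loc p" .
  qed
  then have "(1 / of_int unit_beta) *s (of_int \<beta> *s y) \<in> L0"
    by (rule overlattice_scale[OF ov0 inverse_unit_in_loc[OF unit_beta]])
  moreover have "of_int unit_beta \<noteq> (0 :: rat)" using unit_beta by auto
  ultimately have e: "(\<pi> ^ bord * (\<pi> ^ a4 / \<pi> ^ kap 4)) *s axis 4 1 \<in> L0"
    unfolding y_def of_int_beta by (simp add: vector_smult_assoc)
  have "\<pi> ^ bord * (\<pi> ^ a4 / \<pi> ^ kap 4) * \<pi> ^ a4 \<in> loc p"
    using decompose4(1)[OF e] by (simp add: axis_def)
  also have "\<pi> ^ bord * (\<pi> ^ a4 / \<pi> ^ kap 4) * \<pi> ^ a4 = 1 / \<pi> ^ kap 4 * \<pi> ^ (bord + 2 * a4)"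
    by (simp add: power_add mult_2)
  finally show le: "kap 4 \<le> bord + 2 * a4"
    by (rule power_quotient_in_loc_imp_le[OF p, rotated]) simp
  then have pw: "\<pi> ^ g * \<pi> ^ kap 4 = \<pi> ^ bord * \<pi> ^ a4 * \<pi> ^ a4"
    unfolding g_def by (simp add: mult_2 add.assoc flip: power_add)
  have x4: "x0 $ 4 = 1 / \<pi> ^ a4" using x0(2) by (simp add: field_simps)
  have "\<pi> ^ g * x0 $ 4 = \<pi> ^ bord * (\<pi> ^ a4 / \<pi> ^ kap 4)"
    using pw unfolding x4 by (simp add: field_simps)
  then have "\<pi> ^ g *s proj x0 = \<pi> ^ g *s x0 - (\<pi> ^ bord * (\<pi> ^ a4 / \<pi> ^ kap 4)) *s axis 4 1"
    by (simp add: vec_eq_iff forall_4 axis_def)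
  also have "\<dots> \<in> L0"
    by (intro overlattice_diff[OF ov0] overlattice_scale[OF ov0] e x0) (auto simp: p loc_power)
  finally show "\<pi> ^ (bord + 2 * a4 - kap 4) *s proj x0 \<in> P"
    unfolding P_iff g_def by simp
qed

text \<open>The projection of \<open>x\<close> lies, up to the factor \<open>\<beta>\<close>, in the projection of \<open>L0\<close>, which is
  generated by \<open>P\<close> and \<open>proj x0\<close>; integrality of the norms of \<open>x\<close> and \<open>x0\<close> then forces the
  coefficient of \<open>proj x0\<close> to be a square root of \<open>\<beta>\<^sup>2\<close>.\<close>

lemma coefficient_exists:
  assumes L: "overlattice L" "slice {1,2,3} L = P" and x: "x \<in> L" "x $ 4 * \<pi> ^ a4 = 1"
  shows "\<exists>t. t \<in> {0..<p ^ (bord + 2 * a4 - kap 4)} \<and> p ^ (2 * a4 - kap 4) dvd t\<^sup>2 - \<beta>\<^sup>2 \<and>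
    of_int \<beta> *s proj x - of_int t *s proj x0 \<in> P"
proof -
  define g k where "g = bord + 2 * a4 - kap 4" and "k = 2 * a4 - kap 4"
  have kg: "k \<le> g" unfolding k_def g_def by simp
  have x4: "x0 $ 4 = 1 / \<pi> ^ a4" "x $ 4 = 1 / \<pi> ^ a4" using x0(2) x(2) by (simp_all add: field_simps)
  have d4: "of_int (d 4) \<noteq> (0 :: rat)" using d by simp
  \<comment> \<open>The multiple of e_4 makes y orthogonal to \<open>x0\<close> without changing its
    pairing with P. As \<open>L0\<close> is generated by P and \<open>x0\<close>, the vector y is in
    the dual of \<open>L0\<close>.\<close>
  define y where "y = proj x + (- (\<pi> ^ a4 * bil (proj x) x0 / of_int (d 4))) *s axis 4 1"
  have y_x0: "bil y x0 = 0" unfolding bil_4 y_def x4 using d4 by (simp add: axis_def field_simps)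
  have PL: "m \<in> L" if "m \<in> P" for m using that L(2) by (auto dest: sliceD)
  have bilP: "bil y m = bil x m" "bil (proj x) m = bil x m" "bil (proj x0) m = bil x0 m"
    if "m \<in> P" for m
    using that unfolding P_iff bil_4 y_def by (auto simp: axis_def)
  have "of_int \<beta> *s y \<in> L0"
  proof (rule overlatticeD(4)[OF ov0])
    fix w assume w: "w \<in> L0"
    define m where "m = w - (w $ 4 * \<pi> ^ a4) *s x0"
    have m: "m \<in> P" unfolding m_def by (rule decompose4(2)[OF w])
    have "w = m + (w $ 4 * \<pi> ^ a4) *s x0" unfolding m_def by simp
    then have "bil y w = bil y m + (w $ 4 * \<pi> ^ a4) * bil y x0"
      by (metis bil_add_scale)
    also have "\<dots> = bil x m" using y_x0 bilP(1)[OF m] by simp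
    also have "\<dots> \<in> loc p" by (rule overlatticeD(3)[OF L(1) x(1) PL[OF m]])
    finally show "bil y w \<in> loc p" .
  qed
  from decompose4[OF this] obtain t where t: "t \<in> loc p" and m0: "of_int \<beta> *s y - t *s x0 \<in> P"
    by blast
  define m where "m = of_int \<beta> *s proj x - t *s proj x0"
  have "m = of_int \<beta> *s y - t *s x0"
    using m0 unfolding P_iff m_def y_def by (auto simp: vec_eq_iff forall_4 axis_def)
  with m0 have m: "m \<in> P" by simp
  \<comment> \<open>The fourth coordinates of x and \<open>x0\<close> are both p^(-a4), so both
    norms drop by the same \<delta> under projection. Comparing norms, (t^2 - \<beta>^2) \<delta>
    equals an expression in integral terms only.\<close>
  define \<delta> where "\<delta> = of_int (d 4) / \<pi> ^ (2 * a4)"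
  have nx: "bil (proj x) (proj x) = bil x x - \<delta>" "bil (proj x0) (proj x0) = bil x0 x0 - \<delta>"
    unfolding bil_4 \<delta>_def by (simp_all add: x4 mult_2 power_add)
  have "bil (of_int \<beta> *s proj x) (of_int \<beta> *s proj x) = (of_int \<beta>)\<^sup>2 * bil (proj x) (proj x)"
    unfolding bil_4 by (simp add: power2_eq_square algebra_simps)
  moreover have "bil (t *s proj x0 + m) (t *s proj x0 + m)
      = t\<^sup>2 * bil (proj x0) (proj x0) + 2 * t * bil (proj x0) m + bil m m"
    unfolding bil_4 by (simp add: power2_eq_square algebra_simps)
  moreover have "of_int \<beta> *s proj x = t *s proj x0 + m" unfolding m_def by simp
  ultimately have "(of_int \<beta>)\<^sup>2 * (bil x x - \<delta>) = t\<^sup>2 * (bil x0 x0 - \<delta>) + 2 * t * bil x0 m + bil m m"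
    unfolding nx bilP[OF m] by metis
  then have "(t\<^sup>2 - (of_int \<beta>)\<^sup>2) * \<delta> =
      t\<^sup>2 * bil x0 x0 + of_int 2 * t * bil x0 m + bil m m - (of_int \<beta>)\<^sup>2 * bil x x"
    by (simp add: algebra_simps)
  also have "\<dots> \<in> loc p"
    using m by (intro loc_diff loc_add loc_mult loc_power p t overlatticeD(3)[OF L(1)]
        overlatticeD(3)[OF ov0] loc_of_int x x0) (auto dest: sliceD simp: p)
  finally have "of_int (unt 4) * ((t\<^sup>2 - (of_int \<beta>)\<^sup>2) * \<pi> ^ kap 4 / \<pi> ^ (2 * a4)) \<in> loc p"
    unfolding \<delta>_def of_int_d by (simp add: mult_ac)
  then have sq: "(t\<^sup>2 - (of_int \<beta>)\<^sup>2) * \<pi> ^ kap 4 / \<pi> ^ (2 * a4) \<in> loc p"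
    by (rule loc_cancel[OF p unt])
  \<comment> \<open>By \<open>last_axis\<close>, t may be replaced by its residue modulo p^g; since
    k <= g, the congruence between t^2 and \<beta>^2 modulo p^k survives.\<close>
  define r where "r = residue p g t"
  have r: "r \<in> {0..<p ^ g}" "(t - of_int r) / \<pi> ^ g \<in> loc p"
    using residue[OF p t] unfolding r_def by auto
  have "p ^ k dvd r\<^sup>2 - \<beta>\<^sup>2"
  proof (cases "k = 0")
    case False
    then have pk: "\<pi> ^ k * \<pi> ^ kap 4 = \<pi> ^ (2 * a4)" unfolding k_def by (simp flip: power_add)
    have "(t\<^sup>2 - (of_int \<beta>)\<^sup>2) * \<pi> ^ kap 4 / \<pi> ^ (2 * a4) = (t\<^sup>2 - (of_int \<beta>)\<^sup>2) / \<pi> ^ k"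
      unfolding pk[symmetric] by simp
    with sq have s1: "(t\<^sup>2 - (of_int \<beta>)\<^sup>2) / \<pi> ^ k \<in> loc p" by simp
    have "(t - of_int r) / \<pi> ^ g * (\<pi> ^ (g - k) * (t + of_int r)) \<in> loc p"
      using r(2) t p by (intro loc_mult loc_power loc_add loc_of_int)
    also have "(t - of_int r) / \<pi> ^ g * (\<pi> ^ (g - k) * (t + of_int r)) = (t\<^sup>2 - (of_int r)\<^sup>2) / \<pi> ^ k"
    proof -
      have "\<pi> ^ g = \<pi> ^ (g - k) * \<pi> ^ k" using kg by (simp flip: power_add)
      then show ?thesis by (simp add: field_simps power2_eq_square)
    qed
    finally have s2: "(t\<^sup>2 - (of_int r)\<^sup>2) / \<pi> ^ k \<in> loc p" .
    have "of_int (r\<^sup>2 - \<beta>\<^sup>2) / \<pi> ^ k = (t\<^sup>2 - (of_int \<beta>)\<^sup>2) / \<pi> ^ k - (t\<^sup>2 - (of_int r)\<^sup>2) / \<pi> ^ k"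
      by (simp add: diff_divide_distrib)
    also have "\<dots> \<in> loc p" by (rule loc_diff[OF p s1 s2])
    finally show ?thesis by (simp only: of_int_div_power_in_loc_iff[OF p])
  qed simp
  moreover have "of_int \<beta> *s proj x - of_int r *s proj x0 \<in> P"
  proof -
    have "m + ((t - of_int r) / \<pi> ^ g) *s (\<pi> ^ g *s proj x0) \<in> P"
      by (rule loc_moduleD(2)[OF P_module m
            loc_moduleD(3)[OF P_module r(2) last_axis(2)[folded g_def]]])
    then show ?thesis unfolding m_def by (simp add: vector_smult_assoc vector_sub_rdistrib)
  qed
  ultimately show ?thesis using r(1) unfolding g_def k_def by blast
qed

lemma P_generators:
  assumes "x \<in> P"
  shows "\<exists>c1\<in>loc p. \<exists>c2\<in>loc p. \<exists>c3\<in>loc p.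
    x = c1 *s ((1 / \<pi> ^ a1) *s axis 1 1) + c2 *s gen2 a2 P + c3 *s gen3 a3 P"
proof -
  note g = gen2[OF L0(1) refl] gen3[OF L0(1) refl]
  have M: "loc_module p L0" by (rule overlatticeD(1)[OF ov0])
  have ld: "lead p L0 {1,2} 2 a2" "lead p L0 {1,2,3} 3 a3"
    using L0 unfolding flagged_def by auto
  define c3 where "c3 = x $ 3 * \<pi> ^ a3"
  define y where "y = x - c3 *s gen3 a3 P"
  have c3: "c3 \<in> loc p" and y: "y \<in> slice {1,2} L0"
    using lead_decompose[OF p M ld(2) g(3,4) assms] unfolding c3_def y_def
    by (simp_all add: insert_Diff_if)
  define c2 where "c2 = y $ 2 * \<pi> ^ a2"
  define z where "z = y - c2 *s gen2 a2 P"
  have c2: "c2 \<in> loc p" and z: "z \<in> slice {1} L0"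
    using lead_decompose[OF p M ld(1) g(1,2) y] unfolding c2_def z_def
    by (simp_all add: insert_Diff_if)
  have "z $ 1 * \<pi> ^ a1 \<in> loc p" and "z $ 2 = 0" "z $ 3 = 0" "z $ 4 = 0"
    using z unfolding slice_1[OF L0(1)] by auto
  moreover from this have "z = (z $ 1 * \<pi> ^ a1) *s ((1 / \<pi> ^ a1) *s axis 1 1)"
    by (simp add: vec_eq_iff forall_4 axis_def)
  moreover have "x = z + c2 *s gen2 a2 P + c3 *s gen3 a3 P" unfolding z_def y_def by simp
  ultimately show ?thesis using c2 c3 by metis
qed

lemma generator1_in: "(1 / \<pi> ^ a1) *s axis 1 1 \<in> P"
  and generator2_in: "gen2 a2 P \<in> P" and generator3_in: "gen3 a3 P \<in> P"
proof -
  have "(1 / \<pi> ^ a1) *s axis 1 1 \<in> slice {1} L0"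
    unfolding slice_1[OF L0(1)] by (simp add: axis_def p)
  then show "(1 / \<pi> ^ a1) *s axis 1 1 \<in> P" by (auto simp: slice_def)
  show "gen2 a2 P \<in> P" "gen3 a3 P \<in> P"
    using gen2[OF L0(1) refl] gen3[OF L0(1) refl] by (auto simp: slice_def)
qed

lemma divide_difference_combination:
  fixes a F :: rat
  assumes "a \<noteq> 0" "a * F = (c1 * x + c2 * y + c3 * z) - (d1 * x + d2 * y + d3 * z)"
  shows "F = (c1 - d1) / a * x + (c2 - d2) / a * y + (c3 - d3) / a * z"
proof -
  have "F = (a * F) / a" using assms(1) by simp
  also have "\<dots> = (c1 - d1) / a * x + (c2 - d2) / a * y + (c3 - d3) / a * z"
    unfolding assms(2) by (simp add: diff_divide_distrib add_divide_distrib left_diff_distrib)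
  finally show ?thesis .
qed

text \<open>All f s lie in one coset of p^(-bord) P, and the quotient of p^(-bord) P by P has order
  p^(3 bord) because P has rank 3. The explicit generators turn its elements into triples of
  residues modulo p^bord.\<close>

lemma card_torsion_classes:
  assumes fS: "\<And>s. s \<in> S \<Longrightarrow> \<pi> ^ bord *s (f s - v) \<in> P"
    and inj: "\<And>s s'. s \<in> S \<Longrightarrow> s' \<in> S \<Longrightarrow> f s - f s' \<in> P \<Longrightarrow> s = s'"
  shows "finite S \<and> card S \<le> nat p ^ (3 * bord)"
proof -
  define g1 :: "rat ^ 4" where "g1 = (1 / \<pi> ^ a1) *s axis 1 1"
  let ?g = "\<lambda>c1 c2 c3. c1 *s g1 + c2 *s gen2 a2 P + c3 *s gen3 a3 P"
  have "\<exists>c. fst c \<in> loc p \<and> fst (snd c) \<in> loc p \<and> snd (snd c) \<in> loc p \<and>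
      \<pi> ^ bord *s (f s - v) = ?g (fst c) (fst (snd c)) (snd (snd c))" if "s \<in> S" for s
    using P_generators[OF fS[OF that]] unfolding g1_def by (metis fst_conv snd_conv)
  then obtain c where c: "\<And>s. s \<in> S \<Longrightarrow> fst (c s) \<in> loc p"
    "\<And>s. s \<in> S \<Longrightarrow> fst (snd (c s)) \<in> loc p" "\<And>s. s \<in> S \<Longrightarrow> snd (snd (c s)) \<in> loc p"
    "\<And>s. s \<in> S \<Longrightarrow> \<pi> ^ bord *s (f s - v) = ?g (fst (c s)) (fst (snd (c s))) (snd (snd (c s)))"
    by metis
  define h where "h s = (residue p bord (fst (c s)), residue p bord (fst (snd (c s))),
    residue p bord (snd (snd (c s))))" for s
  have "inj_on h S"
  proof (rule inj_onI)
    fix s s' assume s: "s \<in> S" "s' \<in> S" and "h s = h s'"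
    then have e: "(fst (c s) - fst (c s')) / \<pi> ^ bord \<in> loc p"
      "(fst (snd (c s)) - fst (snd (c s'))) / \<pi> ^ bord \<in> loc p"
      "(snd (snd (c s)) - snd (snd (c s'))) / \<pi> ^ bord \<in> loc p"
      unfolding h_def using c by (auto intro!: residue_eqD p)
    have "\<pi> ^ bord *s (f s - f s') = \<pi> ^ bord *s (f s - v) - \<pi> ^ bord *s (f s' - v)"
      by (simp add: vec_eq_iff algebra_simps)
    also have "\<dots> = ?g (fst (c s)) (fst (snd (c s))) (snd (snd (c s)))
        - ?g (fst (c s')) (fst (snd (c s'))) (snd (snd (c s')))"
      using c(4) s by simp
    finally have eq: "\<pi> ^ bord *s (f s - f s') = \<dots>" .
    have "(f s - f s') $ i = (?g ((fst (c s) - fst (c s')) / \<pi> ^ bord)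
        ((fst (snd (c s)) - fst (snd (c s'))) / \<pi> ^ bord)
        ((snd (snd (c s)) - snd (snd (c s'))) / \<pi> ^ bord)) $ i" for i
      unfolding vector_add_component vector_smult_component
      by (rule divide_difference_combination)
        (use arg_cong[OF eq, of "\<lambda>v. v $ i"] in \<open>simp_all add: right_diff_distrib\<close>)
    then have "f s - f s' = ?g ((fst (c s) - fst (c s')) / \<pi> ^ bord)
        ((fst (snd (c s)) - fst (snd (c s'))) / \<pi> ^ bord)
        ((snd (snd (c s)) - snd (snd (c s'))) / \<pi> ^ bord)"
      unfolding vec_eq_iff by blast
    also have "\<dots> \<in> P"
      by (intro loc_moduleD(2)[OF P_module] loc_moduleD(3)[OF P_module] e
          generator1_in[folded g1_def] generator2_in generator3_in)
    finally show "s = s'" using inj s by blast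
  qed
  moreover have "h ` S \<subseteq> {0..<p ^ bord} \<times> {0..<p ^ bord} \<times> {0..<p ^ bord}"
    unfolding h_def using residue(1)[OF p] c by blast
  moreover have "finite ({0..<p ^ bord} \<times> {0..<p ^ bord} \<times> {0..<p ^ bord})" by simp
  ultimately have "finite S" "card S \<le> card ({0..<p ^ bord} \<times> {0..<p ^ bord} \<times> {0..<p ^ bord})"
    using inj_on_finite card_inj_on_le by blast+
  then show ?thesis using p_gt_0
    by (simp add: card_cartesian_product nat_power_eq power_mult power3_eq_cube mult.commute[of 3] power_mult_distrib add.assoc flip: power_add)
qed

text \<open>Two losses occur, both controlled by \<beta>. Among the 2 bord in the number of
  coefficients t, one bord is the gap between the modulus p^g for t and the modulus of the
  congruence of squares, the other the order of \<beta> itself. For equal t, the last generators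
  agree only after multiplication by \<beta>, that is, modulo p^(-bord) P.\<close>

lemma card_last_fiber:
  defines "S \<equiv> {L \<in> flagged a1 a2 a3. lead p L UNIV 4 a4 \<and> slice {1,2,3} L = P}"
  shows "finite S \<and> card S \<le> (4 * nat p ^ (2 * bord)) * nat p ^ (3 * bord)"
proof -
  define x where "x L = (SOME x. x \<in> L \<and> x $ 4 * \<pi> ^ a4 = 1)" for L :: "(rat ^ 4) set"
  have x: "x L \<in> L" "x L $ 4 * \<pi> ^ a4 = 1" if "L \<in> S" for L
  proof -
    have "\<exists>x. x \<in> L \<and> x $ 4 * \<pi> ^ a4 = 1"
      using that unfolding S_def lead_def slice_def by blast
    from someI_ex[OF this] show "x L \<in> L" "x L $ 4 * \<pi> ^ a4 = 1" unfolding x_def by auto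
  qed
  have S: "overlattice L" "slice {1,2,3} L = P" "lead p L UNIV 4 a4" if "L \<in> S" for L
    using that unfolding S_def flagged_def by auto
  define Y where "Y = {t \<in> {0..<p ^ (bord + 2 * a4 - kap 4)}. p ^ (2 * a4 - kap 4) dvd t\<^sup>2 - \<beta>\<^sup>2}"
  have "\<exists>t. t \<in> Y \<and> of_int \<beta> *s proj (x L) - of_int t *s proj x0 \<in> P" if "L \<in> S" for L
    using coefficient_exists[OF S(1,2)[OF that] x[OF that]] unfolding Y_def by blast
  then obtain \<tau> where \<tau>: "\<And>L. L \<in> S \<Longrightarrow> \<tau> L \<in> Y"
    "\<And>L. L \<in> S \<Longrightarrow> of_int \<beta> *s proj (x L) - of_int (\<tau> L) *s proj x0 \<in> P" by metis
  show ?thesis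
  proof (rule card_fibers_le[where f = \<tau>])
    have sub: "\<tau> ` S \<subseteq> Y" using \<tau>(1) by blast
    have Y: "Y \<subseteq> {0..<p ^ (bord + 2 * a4 - kap 4)}" unfolding Y_def by blast
    then have fin: "finite Y" by (rule finite_subset) simp
    with sub show "finite (\<tau> ` S)" by (rule finite_subset)
    have nd: "\<not> p ^ Suc bord dvd \<beta>"
      unfolding bord_def using \<beta> not_unit_p by (simp add: power_dvd_iff_le_multiplicity del: power_Suc)
    have "card (\<tau> ` S) \<le> card Y" by (rule card_mono[OF fin sub])
    also have "\<dots> \<le> 4 * nat p ^ ((bord + 2 * a4 - kap 4) - (2 * a4 - kap 4) + bord)"
      by (rule card_square_roots_near_le[OF p nd _ Y]) (auto simp: Y_def)
    also have "\<dots> \<le> 4 * nat p ^ (2 * bord)"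
      using p_gt_0 by (intro mult_left_mono power_increasing) auto
    finally show "card (\<tau> ` S) \<le> 4 * nat p ^ (2 * bord)" .
    fix t assume "t \<in> \<tau> ` S"
    then obtain L1 where L1: "L1 \<in> S" "\<tau> L1 = t" by blast
    show "finite {L \<in> S. \<tau> L = t} \<and> card {L \<in> S. \<tau> L = t} \<le> nat p ^ (3 * bord)"
    proof (rule card_torsion_classes[where f = x and v = "x L1"])
      fix L assume L: "L \<in> {L \<in> S. \<tau> L = t}"
      have eq4: "x L $ 4 = x L1 $ 4"
        using x(2)[of L] x(2)[of L1] L L1 by (metis (lifting) mem_Collect_eq mult_cancel_right mult_zero_right zero_neq_one)
      have "(of_int \<beta> *s proj (x L) - of_int (\<tau> L) *s proj x0)
          - (of_int \<beta> *s proj (x L1) - of_int (\<tau> L1) *s proj x0) \<in> P"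
        using L L1 by (intro loc_module_diff[OF p P_module] \<tau>(2)) auto
      then have "of_int \<beta> *s (proj (x L) - proj (x L1)) \<in> P"
        using L L1 by (simp add: vector_sub_rdistrib vector_ssub_ldistrib)
      moreover have "proj (x L) - proj (x L1) = x L - x L1"
        using eq4 unfolding proj_def by simp
      ultimately have "of_int \<beta> *s (x L - x L1) \<in> P" by metis
      then have "(1 / of_int unit_beta) *s (of_int \<beta> *s (x L - x L1)) \<in> P"
        by (rule loc_moduleD(3)[OF P_module inverse_unit_in_loc[OF unit_beta]])
      moreover have "of_int unit_beta \<noteq> (0 :: rat)" using unit_beta by auto
      ultimately show "\<pi> ^ bord *s (x L - x L1) \<in> P"
        unfolding of_int_beta by (simp add: vector_smult_assoc)
    next
      fix L L' assume L: "L \<in> {L \<in> S. \<tau> L = t}" and L': "L' \<in> {L \<in> S. \<tau> L = t}"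
        and xx: "x L - x L' \<in> P"
      have sl: "slice UNIV K = K" for K :: "(rat ^ 4) set" by (auto simp: slice_def)
      have P4: "slice (UNIV - {4}) K = slice {1,2,3} K" for K :: "(rat ^ 4) set"
        by (auto simp: slice_def) (metis exhaust_4)
      have "slice UNIV L = slice UNIV L'"
      proof (rule lead_slice_eq[OF p])
        show "slice (UNIV - {4}) L = slice (UNIV - {4}) L'" unfolding P4 using L L' S(2) by auto
        show "x L - x L' \<in> L'" using xx L' S(2)[of L'] by (auto dest: sliceD)
      qed (use L L' S x overlatticeD(1) in \<open>auto simp: sl\<close>)
      then show "L = L'" unfolding sl .
    qed
  qed
qed

end

text \<open>The four leading exponents range over 0, ..., n. For each choice the number of slices
  times the size of a fibre is bounded independently of the exponents, so the choice costs only the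
  factor (n + 1)^4.\<close>

theorem card_overlattices:
  "finite {L. overlattice L} \<and> card {L. overlattice L} \<le>
     Suc n ^ 4 * (nat p ^ kap 1 * (4 * nat p ^ (kap 2 div 2)) * (4 * nat p ^ (2 * bord) * nat p ^ (3 * bord)))"
proof -
  define T where "T = nat p ^ kap 1 * (4 * nat p ^ (kap 2 div 2)) * (4 * nat p ^ (2 * bord) * nat p ^ (3 * bord))"
  define S where "S = (\<lambda>(a1, a2, a3, a4). {L \<in> flagged a1 a2 a3. lead p L UNIV 4 a4})"
  have S: "finite (S a) \<and> card (S a) \<le> T" for a
  proof -
    obtain a1 a2 a3 a4 where a: "a = (a1, a2, a3, a4)" by (metis prod.exhaust)
    have Sa: "S a = {L \<in> flagged a1 a2 a3. lead p L UNIV 4 a4}" unfolding a S_def by simp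
    show ?thesis unfolding T_def
    proof (rule card_fibers_le[where f = "slice {1,2,3}"])
      have sub: "slice {1,2,3} ` S a \<subseteq> slice {1,2,3} ` flagged a1 a2 a3" unfolding Sa by blast
      then show "finite (slice {1,2,3} ` S a)" using card_slices finite_subset by blast
      show "card (slice {1,2,3} ` S a) \<le> nat p ^ kap 1 * (4 * nat p ^ (kap 2 div 2))"
        using card_slices card_mono[OF _ sub] order_trans by blast
      fix P assume "P \<in> slice {1,2,3} ` S a"
      then obtain L0 where L0: "L0 \<in> flagged a1 a2 a3" "lead p L0 UNIV 4 a4" "P = slice {1,2,3} L0"
        unfolding Sa by auto
      then obtain x0 where x0: "x0 \<in> L0" "x0 $ 4 * \<pi> ^ a4 = 1" unfolding lead_def slice_def by auto
      have "{L \<in> S a. slice {1,2,3} L = P}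
          = {L \<in> flagged a1 a2 a3. lead p L UNIV 4 a4 \<and> slice {1,2,3} L = slice {1,2,3} L0}"
        unfolding Sa L0(3) by auto
      then show "finite {L \<in> S a. slice {1,2,3} L = P} \<and>
          card {L \<in> S a. slice {1,2,3} L = P} \<le> 4 * nat p ^ (2 * bord) * nat p ^ (3 * bord)"
        using card_last_fiber[OF L0(1,2) x0] by simp
    qed
  qed
  let ?A = "{..n} \<times> {..n} \<times> {..n} \<times> {..n}"
  have cover: "{L. overlattice L} \<subseteq> (\<Union>a\<in>?A. S a)"
  proof
    fix L assume "L \<in> {L. overlattice L}"
    then have L: "overlattice L" by simp
    have ex: "\<exists>a\<le>n. lead p L J i a" if "i \<in> J" for i J
      by (rule lead_exists[OF p overlatticeD(1)[OF L] overlatticeD(2)[OF L] that])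
        (rule overlatticeD(5)[OF L])
    obtain a1 a2 a3 a4 where "a1 \<le> n" "a2 \<le> n" "a3 \<le> n" "a4 \<le> n" "lead p L {1} 1 a1"
      "lead p L {1,2} 2 a2" "lead p L {1,2,3} 3 a3" "lead p L UNIV 4 a4"
      using ex[of 1 "{1}"] ex[of 2 "{1,2}"] ex[of 3 "{1,2,3}"] ex[of 4 UNIV] by auto
    then show "L \<in> (\<Union>a\<in>?A. S a)"
      using L unfolding S_def flagged_def by (intro UN_I[of "(a1, a2, a3, a4)"]) auto
  qed
  have fin: "finite (\<Union>a\<in>?A. S a)" using S by auto
  have "card {L. overlattice L} \<le> card (\<Union>a\<in>?A. S a)" by (rule card_mono[OF fin cover])
  also have "\<dots> \<le> (\<Sum>a\<in>?A. card (S a))" by (rule card_UN_le) simp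
  also have "\<dots> \<le> (\<Sum>a\<in>?A. T)" using S by (intro sum_mono) auto
  also have "\<dots> = Suc n ^ 4 * T" by (simp add: card_cartesian_product power4_eq_xxxx)
  finally show ?thesis using finite_subset[OF cover fin] unfolding T_def by simp
qed

end

section \<open>Orthogonal sublattices\<close>

definition int_submodule :: "(int ^ 'n) set \<Rightarrow> bool" where
  "int_submodule S \<longleftrightarrow> 0 \<in> S \<and> (\<forall>x\<in>S. \<forall>y\<in>S. x + y \<in> S) \<and> (\<forall>c. \<forall>x\<in>S. c *s x \<in> S)"

definition int_span :: "(int ^ 'n) set \<Rightarrow> (int ^ 'n) set" where
  "int_span A = \<Inter>{S. int_submodule S \<and> A \<subseteq> S}"

lemma int_span_superset: "A \<subseteq> int_span A"
  unfolding int_span_def by blast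

lemma int_span_minimal: "int_submodule S \<Longrightarrow> A \<subseteq> S \<Longrightarrow> int_span A \<subseteq> S"
  unfolding int_span_def by blast

lemma int_submodule_span: "int_submodule (int_span A)"
  unfolding int_span_def int_submodule_def by auto

lemma int_span_add: "x \<in> int_span A \<Longrightarrow> y \<in> int_span A \<Longrightarrow> x + y \<in> int_span A"
  and int_span_scale: "x \<in> int_span A \<Longrightarrow> c *s x \<in> int_span A"
  using int_submodule_span[of A] unfolding int_submodule_def by auto

lemma int_span_diff:
  assumes "x \<in> int_span A" "y \<in> int_span A"
  shows "x - y \<in> int_span A"
proof -
  have "x + (-1) *s y \<in> int_span A" by (intro int_span_add int_span_scale assms)
  moreover have "x + (-1) *s y = x - y" by (simp add: vec_eq_iff)
  ultimately show ?thesis by simp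
qed

lemma int_span_subset: "A \<subseteq> int_span B \<Longrightarrow> int_span A \<subseteq> int_span B"
  by (rule int_span_minimal[OF int_submodule_span])

locale int_bilinear =
  fixes B :: "int ^ 'n \<Rightarrow> int ^ 'n \<Rightarrow> int"
  assumes add_left: "B (x + y) z = B x z + B y z"
    and scale_left: "B (c *s x) z = c * B x z"
    and commute: "B x y = B y x"
begin

lemma add_right: "B z (x + y) = B z x + B z y"
  and scale_right: "B z (c *s x) = c * B z x"
  using add_left scale_left commute by metis+

lemma zero_left: "B 0 z = 0"
  using scale_left[of 0 0 z] by simp

lemma diff_right: "B z (x - y) = B z x - B z y"
  using add_right[of z "x - y" y] by simp

lemma dvd_span:
  assumes "\<And>x y. x \<in> A \<Longrightarrow> y \<in> A \<Longrightarrow> c dvd B x y" and "x \<in> int_span A" "y \<in> int_span A"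
  shows "c dvd B x y"
proof -
  have "int_submodule {x. \<forall>y\<in>A. c dvd B x y}"
    unfolding int_submodule_def by (auto simp: add_left scale_left zero_left)
  then have 1: "int_span A \<subseteq> {x. \<forall>y\<in>A. c dvd B x y}" using assms(1) by (intro int_span_minimal) auto
  have "int_submodule {y. \<forall>x\<in>int_span A. c dvd B y x}"
    unfolding int_submodule_def by (auto simp: add_left scale_left zero_left)
  moreover have "A \<subseteq> {y. \<forall>x\<in>int_span A. c dvd B y x}"
  proof (intro subsetI CollectI ballI)
    fix y x assume "y \<in> A" "x \<in> int_span A"
    then have "c dvd B x y" using 1 by blast
    then show "c dvd B y x" by (simp only: commute[of y x])
  qed
  ultimately have "int_span A \<subseteq> {y. \<forall>x\<in>int_span A. c dvd B y x}" by (rule int_span_minimal)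
  then show ?thesis using assms(2,3) by auto
qed

text \<open>A Gram--Schmidt process in which each vector is chosen so that its norm has the least
  possible order at \<open>p\<close>, up to the order \<open>s\<close> of \<open>2\<close>.\<close>

lemma pivot_exists:
  fixes p :: int and ws :: "(int ^ 'n) list"
  assumes p: "Factorial_Ring.prime p"
    and m: "\<not> (\<forall>x\<in>set ws. \<forall>y\<in>set ws. p ^ Suc m dvd B x y)"
  defines "s \<equiv> multiplicity p 2"
  shows "\<exists>v i. i < length ws \<and> (v = ws ! i \<or> (\<exists>j<length ws. j \<noteq> i \<and> v = ws ! i + ws ! j)) \<and>
    \<not> p ^ Suc (m + s) dvd B v v"
proof (cases "\<exists>i<length ws. \<not> p ^ Suc (m + s) dvd B (ws ! i) (ws ! i)")
  case True
  then show ?thesis by blast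
next
  case False
  then have diag: "p ^ Suc (m + s) dvd B (ws ! i) (ws ! i)" if "i < length ws" for i
    using that by blast
  obtain i j where ij: "i < length ws" "j < length ws" "\<not> p ^ Suc m dvd B (ws ! i) (ws ! j)"
    using m by (auto simp: in_set_conv_nth)
  have "p ^ Suc m dvd B (ws ! i) (ws ! i)"
    using diag[OF ij(1)] by (rule dvd_trans[rotated]) (simp add: power_add)
  then have "i \<noteq> j" using ij by auto
  define x y where "x = ws ! i" and "y = ws ! j"
  have n0: "B x y \<noteq> 0" using ij unfolding x_def y_def by auto
  have up: "\<not> is_unit p" and pe: "prime_elem p" using p by auto
  \<comment> \<open>Polarization: both norms are too divisible, so B(x + y, x + y) is congruent to 2
    B(x, y), of order at most m + s. A plain sum of two list members suffices, which later keeps the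
    pivot primitive.\<close>
  have "\<not> p ^ Suc (m + s) dvd B (x + y) (x + y)"
  proof
    assume "p ^ Suc (m + s) dvd B (x + y) (x + y)"
    then have "p ^ Suc (m + s) dvd B (x + y) (x + y) - B x x - B y y"
      using diag ij unfolding x_def y_def by (intro dvd_diff) auto
    also have "B (x + y) (x + y) - B x x - B y y = 2 * B x y"
      using commute[of y x] by (simp add: add_left add_right)
    finally have "Suc (m + s) \<le> s + multiplicity p (B x y)"
      using n0 up unfolding s_def
      by (simp add: power_dvd_iff_le_multiplicity prime_elem_multiplicity_mult_distrib[OF pe]
          del: power_Suc)
    then have "Suc m \<le> multiplicity p (B x y)" by simp
    then have "p ^ Suc m dvd B x y" by (rule multiplicity_dvd')
    then show False using ij unfolding x_def y_def by blast
  qed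
  then show ?thesis using ij \<open>i \<noteq> j\<close> unfolding x_def y_def by blast
qed

text \<open>Let m be the least order of a pairing. A pivot v with norm of order between m and m + s
  is split off, and the remaining vectors are made orthogonal to it after multiplication by a factor
  of order at most s; \<open>length ws\<close> such factors make up K. At odd p one has s = 0, so
  over Z_(p) nothing is lost. Later vectors stay in the span of \<open>ws\<close>, where p^m divides
  all pairings; this gives the ordering of the norms. The form of the head is recorded because it
  will show that the first vector is primitive.\<close>

lemma orthogonalize:
  fixes p :: int and ws :: "(int ^ 'n) list"
  assumes p: "Factorial_Ring.prime p"
  defines "s \<equiv> multiplicity p 2"
  shows "\<exists>fs K. length fs = length ws \<and> K \<noteq> 0 \<and> multiplicity p K \<le> length ws * s \<and>
    sorted_wrt (\<lambda>f g. B f g = 0 \<and> (\<forall>m. p ^ (m + s) dvd B f f \<longrightarrow> p ^ m dvd B g g)) fs \<and>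
    (\<forall>w\<in>set ws. K *s w \<in> int_span (set fs)) \<and> set fs \<subseteq> int_span (set ws) \<and>
    (ws \<noteq> [] \<longrightarrow> (\<exists>i<length ws. hd fs = ws ! i \<or> (\<exists>j<length ws. j \<noteq> i \<and> hd fs = ws ! i + ws ! j)) \<and>
      (\<forall>m. p ^ (m + s) dvd B (hd fs) (hd fs) \<longrightarrow> (\<forall>x\<in>set ws. \<forall>y\<in>set ws. p ^ m dvd B x y)))"
proof (induction "length ws" arbitrary: ws)
  case 0
  then show ?case by (intro exI[of _ "[]"] exI[of _ 1]) auto
next
  case (Suc r)
  have up: "\<not> is_unit p" and pe: "prime_elem p" using p by auto
  have p0: "p \<noteq> 0" using p by auto
  have ne: "ws \<noteq> []" using Suc by auto
  show ?case
  proof (cases "\<forall>x\<in>set ws. \<forall>y\<in>set ws. B x y = 0")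
    case True
    have "ws ! 0 = hd ws" using ne by (simp add: hd_conv_nth)
    then show ?thesis using True ne
      by (intro exI[of _ ws] exI[of _ 1])
        (auto simp: sorted_wrt_iff_nth_less int_span_superset subsetD[OF int_span_superset]
          intro!: exI[of _ 0])
  next
    case False
    then obtain x0 y0 where xy0: "x0 \<in> set ws" "y0 \<in> set ws" "B x0 y0 \<noteq> 0" by blast
    define Ms where "Ms = {m. \<forall>x\<in>set ws. \<forall>y\<in>set ws. p ^ m dvd B x y}"
    have "Ms \<subseteq> {..multiplicity p (B x0 y0)}"
    proof
      fix m assume "m \<in> Ms"
      then have "p ^ m dvd B x0 y0" using xy0 unfolding Ms_def by blast
      then show "m \<in> {..multiplicity p (B x0 y0)}"
        using xy0 up by (simp add: power_dvd_iff_le_multiplicity)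
    qed
    then have finM: "finite Ms" by (rule finite_subset) simp
    define m where "m = Max Ms"
    have "0 \<in> Ms" unfolding Ms_def by simp
    then have "m \<in> Ms" unfolding m_def using finM by (intro Max_in) auto
    then have m1: "p ^ m dvd B x y" if "x \<in> set ws" "y \<in> set ws" for x y
      using that unfolding Ms_def by blast
    have "Suc m \<notin> Ms" using Max_ge[OF finM, of "Suc m"] unfolding m_def by auto
    then have "\<not> (\<forall>x\<in>set ws. \<forall>y\<in>set ws. p ^ Suc m dvd B x y)" unfolding Ms_def by blast
    from pivot_exists[OF p this] obtain v i where i: "i < length ws"
      and v: "v = ws ! i \<or> (\<exists>j<length ws. j \<noteq> i \<and> v = ws ! i + ws ! j)"
      and vv: "\<not> p ^ Suc (m + s) dvd B v v" unfolding s_def by blast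
    have mle: "m' \<le> m" if "p ^ (m' + s) dvd B v v" for m'
    proof (rule ccontr)
      assume "\<not> m' \<le> m"
      then have "Suc (m + s) \<le> m' + s" by simp
      then have "p ^ Suc (m + s) dvd p ^ (m' + s)" by (rule le_imp_power_dvd)
      then show False using that vv dvd_trans by blast
    qed
    define rest where "rest = take i ws @ drop (Suc i) ws"
    have len: "length rest = r" using i Suc(2) unfolding rest_def by simp
    have sws: "set ws = insert (ws ! i) (set rest)"
      unfolding rest_def using i by (subst id_take_nth_drop[OF i]) auto
    have jrest: "ws ! j \<in> set rest" if "j < length ws" "j \<noteq> i" for j
    proof (cases "j < i")
      case True
      then have "ws ! j = take i ws ! j" "j < length (take i ws)" using that i by auto
      then show ?thesis unfolding rest_def by (metis UnI1 nth_mem set_append)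
    next
      case False
      then have "ws ! j = drop (Suc i) ws ! (j - Suc i)" "j - Suc i < length (drop (Suc i) ws)"
        using that i by auto
      then show ?thesis unfolding rest_def by (metis UnI2 nth_mem set_append)
    qed
    note sup = subsetD[OF int_span_superset]
    have wsp: "ws ! k \<in> int_span (set ws)" if "k < length ws" for k
      using that by (intro sup nth_mem)
    have v_span: "v \<in> int_span (set ws)"
      using v i wsp int_span_add by blast
    have "ws ! i \<in> int_span (insert v (set rest))"
    proof -
      consider "v = ws ! i" | j where "j < length ws" "j \<noteq> i" "v = ws ! i + ws ! j" using v by blast
      then show ?thesis
      proof cases
        case (2 j)
        then have "ws ! i = v - ws ! j" by simp
        also have "\<dots> \<in> int_span (insert v (set rest))"
          using jrest[OF 2(1,2)] by (intro int_span_diff sup) auto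
        finally show ?thesis .
      qed (auto intro: sup)
    qed
    then have ws_span: "set ws \<subseteq> int_span (insert v (set rest))"
      unfolding sws using int_span_superset by blast
    have dv: "p ^ m dvd B v w" if "w \<in> set ws" for w
      using dvd_span[of "set ws" "p ^ m" v w] m1 v_span sup[OF that] by blast
    have dvv: "p ^ m dvd B v v" using dvd_span[of "set ws" "p ^ m" v v] m1 v_span by blast
    define \<alpha> where "\<alpha> = B v v div p ^ m"
    define \<gamma> where "\<gamma> w = B v w div p ^ m" for w
    have \<alpha>: "B v v = p ^ m * \<alpha>" using dvv unfolding \<alpha>_def by simp
    have \<gamma>: "B v w = p ^ m * \<gamma> w" if "w \<in> set ws" for w using dv[OF that] unfolding \<gamma>_def by simp
    have \<alpha>0: "\<alpha> \<noteq> 0" using vv \<alpha> by auto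
    have "\<not> p ^ Suc s dvd \<alpha>"
    proof
      assume "p ^ Suc s dvd \<alpha>"
      then have "p ^ m * p ^ Suc s dvd B v v" unfolding \<alpha> by (rule mult_dvd_mono[OF dvd_refl])
      then show False using vv by (simp add: power_add mult_ac)
    qed
    then have m\<alpha>: "multiplicity p \<alpha> \<le> s"
      using \<alpha>0 up by (simp add: power_dvd_iff_le_multiplicity del: power_Suc)
    \<comment> \<open>The common factor p^m of B(v, v) and B(v, w) is removed first. With B(v, v)
      itself as multiplier, the order of K could not be bounded in terms of s.\<close>
    define rest' where "rest' = map (\<lambda>w. \<alpha> *s w - \<gamma> w *s v) rest"
    have len': "r = length rest'" unfolding rest'_def using len by simp
    from Suc(1)[OF len'] obtain fs K where IH: "length fs = length rest'" "K \<noteq> 0"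
      "multiplicity p K \<le> length rest' * s"
      "sorted_wrt (\<lambda>f g. B f g = 0 \<and> (\<forall>m. p ^ (m + s) dvd B f f \<longrightarrow> p ^ m dvd B g g)) fs"
      "\<forall>w\<in>set rest'. K *s w \<in> int_span (set fs)" "set fs \<subseteq> int_span (set rest')"
      by blast
    have rest_ws: "w \<in> set ws" if "w \<in> set rest" for w using that sws by blast
    have "set rest' \<subseteq> int_span (set ws)"
    proof
      fix u assume "u \<in> set rest'"
      then obtain w where w: "w \<in> set rest" "u = \<alpha> *s w - \<gamma> w *s v"
        unfolding rest'_def by auto
      show "u \<in> int_span (set ws)"
        unfolding w(2) by (intro int_span_diff int_span_scale sup[OF rest_ws[OF w(1)]] v_span)
    qed
    then have fs_ws: "set fs \<subseteq> int_span (set ws)" using IH(6) int_span_subset by blast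
    have "int_submodule {x. B v x = 0}"
      unfolding int_submodule_def by (auto simp: add_right scale_right commute[of v 0] zero_left)
    moreover have "set rest' \<subseteq> {x. B v x = 0}"
      unfolding rest'_def using rest_ws by (auto simp: diff_right scale_right \<alpha> \<gamma>)
    ultimately have "int_span (set rest') \<subseteq> {x. B v x = 0}" by (rule int_span_minimal)
    then have orth: "B v g = 0" if "g \<in> set fs" for g using IH(6) that by blast
    have gg: "p ^ m' dvd B g g" if "g \<in> set fs" "p ^ (m' + s) dvd B v v" for g m'
    proof -
      have "p ^ m dvd B g g" using dvd_span[of "set ws" "p ^ m" g g] m1 fs_ws that(1) by blast
      moreover have "p ^ m' dvd p ^ m" using mle[OF that(2)] by (rule le_imp_power_dvd)
      ultimately show ?thesis using dvd_trans by blast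
    qed
    have sp: "(K * \<alpha>) *s w \<in> int_span (set (v # fs))" if "w \<in> set ws" for w
    proof -
      have "int_submodule {x. (K * \<alpha>) *s x \<in> int_span (set (v # fs))}"
        using int_submodule_span[of "set (v # fs)"] unfolding int_submodule_def
        by (auto simp: vector_add_ldistrib) (metis mult.commute vector_smult_assoc)
      moreover have "insert v (set rest) \<subseteq> {x. (K * \<alpha>) *s x \<in> int_span (set (v # fs))}"
      proof clarsimp
        have vs: "c *s v \<in> int_span (insert v (set fs))" for c by (intro int_span_scale sup) simp
        have "(K * \<alpha>) *s w \<in> int_span (insert v (set fs))" if "w \<in> set rest" for w
        proof -
          have "\<alpha> *s w - \<gamma> w *s v \<in> set rest'" unfolding rest'_def using that by simp
          then have "K *s (\<alpha> *s w - \<gamma> w *s v) \<in> int_span (set fs)" using IH(5) by blast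
          then have "K *s (\<alpha> *s w - \<gamma> w *s v) \<in> int_span (insert v (set fs))"
            using int_span_subset[of "set fs" "insert v (set fs)"] sup by blast
          then have "K *s (\<alpha> *s w - \<gamma> w *s v) + (K * \<gamma> w) *s v \<in> int_span (insert v (set fs))"
            using vs by (rule int_span_add)
          moreover have "K *s (\<alpha> *s w - \<gamma> w *s v) + (K * \<gamma> w) *s v = (K * \<alpha>) *s w"
            by (simp add: vec_eq_iff algebra_simps)
          ultimately show ?thesis by simp
        qed
        then show "(K * \<alpha>) *s v \<in> int_span (insert v (set fs)) \<and>
            set rest \<subseteq> {x. (K * \<alpha>) *s x \<in> int_span (insert v (set fs))}"
          using vs by blast
      qed
      ultimately have "int_span (insert v (set rest)) \<subseteq> {x. (K * \<alpha>) *s x \<in> int_span (set (v # fs))}"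
        by (rule int_span_minimal)
      then show ?thesis using ws_span that by blast
    qed
    show ?thesis
    proof (intro exI[of _ "v # fs"] exI[of _ "K * \<alpha>"] conjI impI)
      show "length (v # fs) = length ws" using IH(1) len' Suc(2) by simp
      show "K * \<alpha> \<noteq> 0" using IH(2) \<alpha>0 by simp
      have "multiplicity p (K * \<alpha>) = multiplicity p K + multiplicity p \<alpha>"
        using IH(2) \<alpha>0 by (intro prime_elem_multiplicity_mult_distrib pe)
      also have "\<dots> \<le> length rest' * s + s" using IH(3) m\<alpha> by simp
      also have "\<dots> = length ws * s" using len' Suc(2) by (metis add.commute mult_Suc)
      finally show "multiplicity p (K * \<alpha>) \<le> length ws * s" .
      show "sorted_wrt (\<lambda>f g. B f g = 0 \<and> (\<forall>m. p ^ (m + s) dvd B f f \<longrightarrow> p ^ m dvd B g g)) (v # fs)"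
        using IH(4) orth gg by simp
      show "\<forall>w\<in>set ws. (K * \<alpha>) *s w \<in> int_span (set (v # fs))" using sp by blast
      show "set (v # fs) \<subseteq> int_span (set ws)" using v_span fs_ws by simp
      show "\<exists>i<length ws. hd (v # fs) = ws ! i \<or> (\<exists>j<length ws. j \<noteq> i \<and> hd (v # fs) = ws ! i + ws ! j)"
        using i v by auto
      show "\<forall>m. p ^ (m + s) dvd B (hd (v # fs)) (hd (v # fs)) \<longrightarrow> (\<forall>x\<in>set ws. \<forall>y\<in>set ws. p ^ m dvd B x y)"
        using mle m1 le_imp_power_dvd[of _ m p] dvd_trans by (metis list.sel(1))
    qed
  qed
qed

end

lemma int_span_range:
  fixes f :: "'a::finite \<Rightarrow> int ^ 'n"
  assumes "x \<in> int_span (range f)"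
  shows "\<exists>c. x = (\<Sum>i\<in>UNIV. c i *s f i)"
proof -
  let ?S = "{x. \<exists>c. x = (\<Sum>i\<in>UNIV. c i *s f i)}"
  have "int_submodule ?S"
    unfolding int_submodule_def
  proof (intro conjI ballI allI)
    show "0 \<in> ?S" by (auto intro!: exI[of _ "\<lambda>_. 0"])
    fix x assume "x \<in> ?S"
    then obtain c where c: "x = (\<Sum>i\<in>UNIV. c i *s f i)" by blast
    { fix y assume "y \<in> ?S"
      then obtain e where "y = (\<Sum>i\<in>UNIV. e i *s f i)" by blast
      then have "x + y = (\<Sum>i\<in>UNIV. (c i + e i) *s f i)"
        unfolding c by (simp add: vector_sadd_rdistrib sum.distrib)
      then show "x + y \<in> ?S" by (intro CollectI exI) }
    fix k
    have "k *s x = (\<Sum>i\<in>UNIV. (k * c i) *s f i)"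
      unfolding c by (simp add: vec_eq_iff sum_distrib_left mult.assoc)
    then show "k *s x \<in> ?S" by (intro CollectI exI)
  qed
  moreover have "range f \<subseteq> ?S"
  proof
    fix x assume "x \<in> range f"
    then obtain j where j: "x = f j" by blast
    have "x = (\<Sum>i\<in>UNIV. (if i = j then 1 else 0) *s f i)"
      unfolding j by (subst sum.remove[of _ j]) (auto intro!: sum.neutral)
    then show "x \<in> ?S" by (intro CollectI exI)
  qed
  ultimately have "int_span (range f) \<subseteq> ?S" by (rule int_span_minimal)
  then show ?thesis using assms by blast
qed

lemma (in int_bilinear) dvd_all:
  assumes "\<And>i j. c dvd B (axis i 1) (axis j 1)"
  shows "c dvd B x y"
proof -
  have "z \<in> int_span (range (\<lambda>i. axis i 1))" for z :: "int ^ 'n"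
  proof -
    have s: "sum g A \<in> int_span S" if "\<And>i. i \<in> A \<Longrightarrow> g i \<in> int_span S" for g :: "'n \<Rightarrow> int ^ 'n" and A S
      using that int_submodule_span[of S] unfolding int_submodule_def
      by (induction A rule: infinite_finite_induct) auto
    have "z = (\<Sum>i\<in>UNIV. z $ i *s axis i 1)"
      by (simp add: vec_eq_iff axis_def if_distrib[of "\<lambda>x. _ * x"] cong: if_cong)
    also have "\<dots> \<in> int_span (range (\<lambda>i. axis i 1))"
      by (intro s int_span_scale subsetD[OF int_span_superset]) auto
    finally show ?thesis .
  qed
  then show ?thesis using dvd_span[of "range (\<lambda>i. axis i 1)" c x y] assms by blast
qed

text \<open>Starting from the standard basis, the head is e_i or e_i + e_j with i distinct from j.
  It therefore has a coordinate equal to 1 and spans a primitive line, a competitor in the minimum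
  that defines k_1.\<close>

lemma orthogonal_basis_4:
  fixes B :: "int ^ 4 \<Rightarrow> int ^ 4 \<Rightarrow> int"
  assumes "int_bilinear B" and p: "Factorial_Ring.prime (p :: int)"
  defines "s \<equiv> multiplicity p 2"
  obtains f :: "4 \<Rightarrow> int ^ 4" and K where "K \<noteq> 0" "multiplicity p K \<le> 4 * s"
    "\<And>i j. i \<noteq> j \<Longrightarrow> B (f i) (f j) = 0"
    "\<And>x. \<exists>c. K *s x = (\<Sum>i\<in>UNIV. c i *s f i)"
    "\<exists>i. f 1 $ i = 1"
    "\<And>m x y. p ^ (m + s) dvd B (f 1) (f 1) \<Longrightarrow> p ^ m dvd B x y"
    "\<And>m i. p ^ (m + s) dvd B (f 2) (f 2) \<Longrightarrow> i = 3 \<or> i = 4 \<Longrightarrow> p ^ m dvd B (f i) (f i)"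
proof -
  interpret int_bilinear B by fact
  let ?ws = "[axis 1 1, axis 2 1, axis 3 1, axis 4 1] :: (int ^ 4) list"
  obtain fs K where h: "length fs = length ?ws" "K \<noteq> 0" "multiplicity p K \<le> length ?ws * s"
    "sorted_wrt (\<lambda>f g. B f g = 0 \<and> (\<forall>m. p ^ (m + s) dvd B f f \<longrightarrow> p ^ m dvd B g g)) fs"
    "\<forall>w\<in>set ?ws. K *s w \<in> int_span (set fs)"
    "\<exists>i<length ?ws. hd fs = ?ws ! i \<or> (\<exists>j<length ?ws. j \<noteq> i \<and> hd fs = ?ws ! i + ?ws ! j)"
    "\<forall>m. p ^ (m + s) dvd B (hd fs) (hd fs) \<longrightarrow> (\<forall>x\<in>set ?ws. \<forall>y\<in>set ?ws. p ^ m dvd B x y)"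
    using orthogonalize[OF p, of ?ws] unfolding s_def by blast
  obtain g1 g2 g3 g4 where fs: "fs = [g1, g2, g3, g4]"
    using h(1) by (auto simp: length_Suc_conv)
  define f :: "4 \<Rightarrow> int ^ 4" where "f i = (if i = 1 then g1 else if i = 2 then g2 else if i = 3 then g3 else g4)" for i
  have f: "f 1 = g1" "f 2 = g2" "f 3 = g3" "f 4 = g4" unfolding f_def by simp_all
  have ax: "axis i (1 :: int) \<in> set ?ws" for i :: 4 using exhaust_4[of i] by auto
  have rf: "set fs = range f" unfolding fs using f by (auto simp: UNIV_4)
  show ?thesis
  proof (rule that[of K f])
    show "K \<noteq> 0" "multiplicity p K \<le> 4 * s" using h by auto
    have o: "B g1 g2 = 0" "B g1 g3 = 0" "B g1 g4 = 0" "B g2 g3 = 0" "B g2 g4 = 0" "B g3 g4 = 0"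
      using h(4) unfolding fs by auto
    show "B (f i) (f j) = 0" if "i \<noteq> j" for i j
      using exhaust_4[of i] exhaust_4[of j] that o commute f by metis
    show "\<exists>c. K *s x = (\<Sum>i\<in>UNIV. c i *s f i)" for x
    proof (rule int_span_range)
      have "x = x $ 1 *s axis 1 1 + x $ 2 *s axis 2 1 + x $ 3 *s axis 3 1 + x $ 4 *s axis 4 1"
        by (simp add: vec_eq_iff forall_4 axis_def)
      then have "K *s x = x $ 1 *s (K *s axis 1 1) + x $ 2 *s (K *s axis 2 1)
          + x $ 3 *s (K *s axis 3 1) + x $ 4 *s (K *s axis 4 1)"
        by (simp add: vec_eq_iff forall_4 axis_def)
      also have "\<dots> \<in> int_span (range f)"
      proof -
        have K: "K *s axis i 1 \<in> int_span (range f)" for i using h(5) ax unfolding rf by blast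
        show ?thesis by (intro int_span_add int_span_scale[OF K])
      qed
      finally show "K *s x \<in> int_span (range f)" .
    qed
    have ex_4: "(\<exists>i :: 4. P i) \<longleftrightarrow> P 1 \<or> P 2 \<or> P 3 \<or> P 4" for P
      using forall_4[of "\<lambda>i. \<not> P i"] by blast
    show "\<exists>i. f 1 $ i = 1"
      using h(6) unfolding fs f by (auto simp: less_Suc_eq numeral_eq_Suc axis_def ex_4)
    show "p ^ m dvd B x y" if "p ^ (m + s) dvd B (f 1) (f 1)" for m x y
    proof (rule dvd_all)
      fix i j show "p ^ m dvd B (axis i 1) (axis j 1)"
        using h(7) that ax unfolding fs f list.sel(1) by blast
    qed
    show "p ^ m dvd B (f i) (f i)" if "p ^ (m + s) dvd B (f 2) (f 2)" "i = 3 \<or> i = 4" for m i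
      using h(4) that f unfolding fs by auto
  qed
qed

section \<open>Polar forms\<close>

lemma polar_eq:
  assumes "\<And>v. q v = (\<Sum>i\<in>UNIV. \<Sum>k\<in>UNIV. a $ i $ k * v $ i * v $ k)"
  shows "polar q v w = (\<Sum>i\<in>UNIV. \<Sum>k\<in>UNIV. a $ i $ k * (v $ i * w $ k + w $ i * v $ k))"
  unfolding polar_def assms by (simp add: algebra_simps sum.distrib sum_subtractf)

lemma int_bilinear_polar:
  assumes "integral_quadratic_form (q :: int ^ 'n \<Rightarrow> int)"
  shows "int_bilinear (polar q)"
proof -
  obtain a where a: "\<And>v. q v = (\<Sum>i\<in>UNIV. \<Sum>k\<in>UNIV. a $ i $ k * v $ i * v $ k)"
    using assms unfolding integral_quadratic_form_def by blast
  show ?thesis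
  proof
    show "polar q (x + y) z = polar q x z + polar q y z" for x y z
      unfolding polar_eq[OF a] by (simp add: algebra_simps sum.distrib)
    show "polar q (c *s x) z = c * polar q x z" for c x z
      unfolding polar_eq[OF a] by (simp add: algebra_simps sum.distrib sum_distrib_left)
    show "polar q x y = polar q y x" for x y
      unfolding polar_def by (simp add: add.commute)
  qed
qed

lemma quadratic_form_scale:
  assumes "integral_quadratic_form q"
  shows "q (c *s v) = c\<^sup>2 * q v"
proof -
  obtain a where a: "\<And>v. q v = (\<Sum>i\<in>UNIV. \<Sum>k\<in>UNIV. a $ i $ k * v $ i * v $ k)"
    using assms unfolding integral_quadratic_form_def by blast
  show ?thesis unfolding a by (simp add: sum_distrib_left power2_eq_square algebra_simps)
qed

lemma polar_self:
  assumes "integral_quadratic_form q"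
  shows "polar q v v = 2 * q v"
proof -
  have "v + v = 2 *s v" by (simp add: vec_eq_iff)
  then show ?thesis using quadratic_form_scale[OF assms, of 2 v] unfolding polar_def by simp
qed

lemma polar_self_pos:
  assumes "integral_quadratic_form q" "positive_definite q" "v \<noteq> 0"
  shows "polar q v v > 0"
  using assms polar_self[OF assms(1)] unfolding positive_definite_def by simp

lemma (in int_bilinear) sum_left: "B (sum f A) y = (\<Sum>i\<in>A. B (f i) y)"
  by (induction A rule: infinite_finite_induct) (simp_all add: zero_left add_left)

lemma (in int_bilinear) sum_right: "B y (sum f A) = (\<Sum>i\<in>A. B y (f i))"
  using sum_left[of f A y] by (simp add: commute[of y])

lemma vector_eq_sum_axis:
  fixes v :: "'a :: semiring_1 ^ 'n"
  shows "v = (\<Sum>i\<in>UNIV. v $ i *s axis i 1)"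
  by (simp add: vec_eq_iff axis_def if_distrib[of "\<lambda>x. _ * x"] cong: if_cong)

lemma (in int_bilinear) expand:
  "B v w = (\<Sum>i\<in>UNIV. \<Sum>k\<in>UNIV. B (axis i 1) (axis k 1) * (v $ i * w $ k))"
proof -
  have "B v w = B (\<Sum>i\<in>UNIV. v $ i *s axis i 1) (\<Sum>k\<in>UNIV. w $ k *s axis k 1)"
    by (simp only: vector_eq_sum_axis[symmetric])
  also have "\<dots> = (\<Sum>i\<in>UNIV. \<Sum>k\<in>UNIV. B (axis i 1) (axis k 1) * (v $ i * w $ k))"
    unfolding sum_left unfolding sum_right by (simp add: scale_left scale_right mult_ac)
  finally show ?thesis .
qed

text \<open>The vector u is B(v, v) times the component of w orthogonal to v, and its norm is B(v,
  v) times the minor.\<close>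

lemma polar_minor_pos:
  assumes q: "integral_quadratic_form q" "positive_definite q" and "i \<noteq> (k :: 'n :: finite)"
  shows "polar q (axis i 1) (axis i 1) * polar q (axis k 1) (axis k 1)
    - polar q (axis i 1) (axis k 1) * polar q (axis k 1) (axis i 1) > 0"
proof -
  interpret int_bilinear "polar q" by (rule int_bilinear_polar[OF q(1)])
  define v w :: "int ^ 'n" where "v = axis i 1" and "w = axis k 1"
  have "v \<noteq> 0" unfolding v_def by (simp add: axis_eq_0_iff)
  then have vv: "polar q v v > 0" by (rule polar_self_pos[OF q])
  define u where "u = polar q v v *s w - polar q v w *s v"
  have "u $ k = polar q v v" using \<open>i \<noteq> k\<close> unfolding u_def v_def w_def by (simp add: axis_def)
  then have "u \<noteq> 0" using vv by auto
  then have "polar q u u > 0" by (rule polar_self_pos[OF q])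
  moreover have "polar q u u = polar q v v * (polar q v v * polar q w w - polar q v w * polar q w v)"
  proof -
    have "polar q u u = polar q v v * polar q u w - polar q v w * polar q u v"
      unfolding u_def[symmetric] by (subst (2) u_def) (simp add: diff_right scale_right)
    moreover have "polar q v u = 0" using commute[of w v]
      unfolding u_def by (simp add: diff_right scale_right)
    moreover have "polar q w u = polar q v v * polar q w w - polar q v w * polar q w v"
      unfolding u_def by (simp add: diff_right scale_right)
    ultimately show ?thesis by (simp add: commute[of u v] commute[of u w])
  qed
  ultimately show ?thesis using vv unfolding v_def w_def by (simp add: zero_less_mult_iff)
qed

section \<open>Coordinates of \<open>p\<close>-adic integers\<close>

lemma padic_carrier_iff:
  "x \<in> carrier (padic_int p) \<longleftrightarrow> (\<forall>N. 0 \<le> x N \<and> x N < int p ^ N \<and> x (Suc N) mod int p ^ N = x N)"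
  unfolding padic_int_def by simp

lemma padic_mult_nth: "(x \<otimes>\<^bsub>padic_int p\<^esub> y) N = (x N * y N) mod int p ^ N"
  and padic_add_nth: "(x \<oplus>\<^bsub>padic_int p\<^esub> y) N = (x N + y N) mod int p ^ N"
  and padic_one_nth: "\<one>\<^bsub>padic_int p\<^esub> N = 1 mod int p ^ N"
  and padic_zero_nth: "\<zero>\<^bsub>padic_int p\<^esub> N = 0"
  unfolding padic_int_def by simp_all

lemma padic_mod [simp]: "x \<in> carrier (padic_int p) \<Longrightarrow> x N mod int p ^ N = x N"
  unfolding padic_carrier_iff by (simp add: mod_pos_pos_trivial)

lemma padic_coherent:
  assumes "x \<in> carrier (padic_int p)"
  shows "x (N + M) mod int p ^ N = x N"
proof (induction M)
  case 0
  then show ?case using assms by simp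
next
  case (Suc M)
  have "x (N + Suc M) mod int p ^ N = (x (Suc (N + M)) mod int p ^ (N + M)) mod int p ^ N"
    by (simp add: mod_mod_cancel le_imp_power_dvd)
  also have "\<dots> = x N" using assms Suc unfolding padic_carrier_iff by simp
  finally show ?case .
qed

context
  fixes p :: nat
  assumes p: "Factorial_Ring.prime p"
begin

interpretation R: cring "padic_int p"
  using cring_padic_int p prime_gt_0_nat by blast

lemma pN: "int p ^ N > 0"
  using p prime_gt_0_nat by simp

text \<open>Evaluation at level N is the ring homomorphism from Z_p to Z/p^N. This and the following
  rules turn sums, products, determinants and the polar form into integer expressions reduced modulo
  p^N, where all p-adic computations are done.\<close>

lemma padic_finsum_nth:
  assumes "\<And>a. a \<in> A \<Longrightarrow> f a \<in> carrier (padic_int p)"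
  shows "finsum (padic_int p) f A N = (\<Sum>a\<in>A. f a N) mod int p ^ N"
  using assms
proof (induction A rule: infinite_finite_induct)
  case (insert x F)
  then show ?case
    by (subst R.finsum_insert) (auto simp: padic_add_nth mod_simps)
qed (simp_all add: padic_zero_nth)

lemma padic_finprod_nth:
  assumes "\<And>a. a \<in> A \<Longrightarrow> f a \<in> carrier (padic_int p)"
  shows "finprod (padic_int p) f A N = (\<Prod>a\<in>A. f a N) mod int p ^ N"
  using assms
proof (induction A rule: infinite_finite_induct)
  case (insert x F)
  then show ?case
    by (subst R.finprod_insert) (auto simp: padic_mult_nth mod_simps)
qed (simp_all add: padic_one_nth)

lemma padic_minus_nth:
  assumes x: "x \<in> carrier (padic_int p)"
  shows "(\<ominus>\<^bsub>padic_int p\<^esub> x) N = (- x N) mod int p ^ N"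
proof -
  let ?y = "\<ominus>\<^bsub>padic_int p\<^esub> x"
  have y: "?y \<in> carrier (padic_int p)" using x by simp
  have "(?y \<oplus>\<^bsub>padic_int p\<^esub> x) N = 0" using x by (simp add: R.l_neg padic_zero_nth)
  then have "(?y N + x N) mod int p ^ N = 0" by (simp add: padic_add_nth)
  then have "?y N mod int p ^ N = (- x N) mod int p ^ N"
    by (metis (no_types, opaque_lifting) add.inverse_inverse diff_minus_eq_add mod_0_imp_dvd mod_eq_dvd_iff)
  then show ?thesis using y by simp
qed

lemma padic_add_pow_nth:
  assumes x: "x \<in> carrier (padic_int p)"
  shows "add_pow (padic_int p) (k :: int) x N = (k * x N) mod int p ^ N"
proof -
  have nat: "add_pow (padic_int p) n x N = (int n * x N) mod int p ^ N" for n :: nat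
    by (induction n) (use x in \<open>auto simp: padic_zero_nth padic_add_nth algebra_simps mod_simps\<close>)
  show ?thesis
  proof (cases "k \<ge> 0")
    case True
    then show ?thesis by (simp add: add_pow_int_ge nat)
  next
    case False
    then show ?thesis using x by (simp add: add_pow_int_lt padic_minus_nth nat mod_simps)
  qed
qed

lemma ring_det_term_closed:
  assumes "\<And>i k. i < j \<Longrightarrow> k < j \<Longrightarrow> M i k \<in> carrier (padic_int p)" and "\<sigma> permutes {..<j}"
  shows "(\<Otimes>\<^bsub>padic_int p\<^esub>i\<in>{..<j}. M i (\<sigma> i)) \<in> carrier (padic_int p)"
  using assms permutes_in_image[OF assms(2)] by (intro R.finprod_closed) auto

lemma ring_det_closed:
  assumes "\<And>i k. i < j \<Longrightarrow> k < j \<Longrightarrow> M i k \<in> carrier (padic_int p)"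
  shows "ring_det (padic_int p) j M \<in> carrier (padic_int p)"
  unfolding ring_det_def using ring_det_term_closed[where M = M and j = j, OF assms]
  by (intro R.finsum_closed) auto

lemma ring_det_nth:
  assumes M: "\<And>i k. i < j \<Longrightarrow> k < j \<Longrightarrow> M i k \<in> carrier (padic_int p)"
  shows "ring_det (padic_int p) j M N =
    (\<Sum>\<sigma> | \<sigma> permutes {..<j}. sign \<sigma> * (\<Prod>i<j. M i (\<sigma> i) N)) mod int p ^ N"
proof -
  have "add_pow (padic_int p) (sign \<sigma> :: int) (\<Otimes>\<^bsub>padic_int p\<^esub>i\<in>{..<j}. M i (\<sigma> i)) N =
      (sign \<sigma> * (\<Prod>i<j. M i (\<sigma> i) N)) mod int p ^ N" if \<sigma>: "\<sigma> permutes {..<j}" for \<sigma>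
  proof -
    have "(\<Otimes>\<^bsub>padic_int p\<^esub>i\<in>{..<j}. M i (\<sigma> i)) N = (\<Prod>i<j. M i (\<sigma> i) N) mod int p ^ N"
      using M permutes_in_image[OF \<sigma>] by (intro padic_finprod_nth) auto
    then show ?thesis
      by (simp add: padic_add_pow_nth[OF ring_det_term_closed[where M = M and j = j, OF M \<sigma>]] mod_mult_right_eq)
  qed
  then have "ring_det (padic_int p) j M N = (\<Sum>\<sigma> | \<sigma> permutes {..<j}.
      (sign \<sigma> * (\<Prod>i<j. M i (\<sigma> i) N)) mod int p ^ N) mod int p ^ N"
    unfolding ring_det_def using ring_det_term_closed[where M = M and j = j, OF M]
    by (subst padic_finsum_nth) auto
  then show ?thesis by (simp add: mod_sum_eq)
qed

lemma ring_det_1_nth: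
  assumes "M 0 0 \<in> carrier (padic_int p)"
  shows "ring_det (padic_int p) 1 M N = M 0 0 N"
proof -
  have "{..<1::nat} = {0}" by auto
  then show ?thesis
    using assms by (subst ring_det_nth[where M = M and j = 1]) (simp_all add: permutes_sing sign_id)
qed

lemma ring_det_2_nth:
  assumes "\<And>i k. i < 2 \<Longrightarrow> k < 2 \<Longrightarrow> M i k \<in> carrier (padic_int p)"
  shows "ring_det (padic_int p) 2 M N = (M 0 0 N * M 1 1 N - M 0 1 N * M 1 0 N) mod int p ^ N"
proof -
  have s: "{..<2::nat} = {0, 1}" by auto
  have f: "finite {1 :: nat}" "0 \<notin> {1 :: nat}" by auto
  have "ring_det (padic_int p) 2 M N =
      (\<Sum>\<sigma> | \<sigma> permutes {..<2}. sign \<sigma> * (\<Prod>i<2. M i (\<sigma> i) N)) mod int p ^ N"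
    by (rule ring_det_nth) (rule assms)
  then show ?thesis
    unfolding s sum_over_permutations_insert[OF f] permutes_sing
    by (simp add: sign_swap_id sign_id swap_id_eq)
qed

definition padic_vec :: "nat \<Rightarrow> ('n \<Rightarrow> nat \<Rightarrow> int) \<Rightarrow> int ^ 'n" where
  "padic_vec N v = (\<chi> i. v i N)"

lemma padic_polar_closed:
  assumes "v \<in> padic_space p" "w \<in> padic_space p"
  shows "padic_polar p q v w \<in> carrier (padic_int p)"
  unfolding padic_polar_def using assms unfolding padic_space_def
  by (intro R.finsum_closed R.add.int_pow_closed funcsetI R.m_closed) auto

lemma padic_polar_nth:
  assumes q: "integral_quadratic_form q" and v: "v \<in> padic_space p" and w: "w \<in> padic_space p"
  shows "padic_polar p q v w N = polar q (padic_vec N v) (padic_vec N w) mod int p ^ N"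
proof -
  interpret int_bilinear "polar q" by (rule int_bilinear_polar[OF q])
  have c: "v i \<otimes>\<^bsub>padic_int p\<^esub> w k \<in> carrier (padic_int p)" for i k
    using v w unfolding padic_space_def by auto
  have c2: "add_pow (padic_int p) (z :: int) (v i \<otimes>\<^bsub>padic_int p\<^esub> w k) \<in> carrier (padic_int p)" for z i k
    using c by simp
  have c3: "(\<Oplus>\<^bsub>padic_int p\<^esub>k\<in>UNIV. add_pow (padic_int p) (polar q (axis i 1) (axis k 1))
      (v i \<otimes>\<^bsub>padic_int p\<^esub> w k)) \<in> carrier (padic_int p)" for i
    using c2 by (intro R.finsum_closed) auto
  show ?thesis
    unfolding padic_polar_def expand[of "padic_vec N v"]
    by (simp add: padic_finsum_nth c2 c3 padic_add_pow_nth c padic_mult_nth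
        padic_vec_def mod_sum_eq mod_mult_right_eq)
qed

text \<open>If x vanishes modulo p^N, its quotient by p^N is the shifted sequence with M-th term x
  (N + M) / p^N. For nonzero x, \<open>padic_ord\<close> is thus the last level at which x
  vanishes.\<close>

lemma padic_dvd_iff:
  assumes x: "x \<in> carrier (padic_int p)"
  shows "add_pow (padic_int p) (int p ^ N) \<one>\<^bsub>padic_int p\<^esub> divides\<^bsub>padic_int p\<^esub> x \<longleftrightarrow> x N = 0"
proof
  have pw: "add_pow (padic_int p) (int p ^ N) \<one>\<^bsub>padic_int p\<^esub> M = int p ^ N mod int p ^ M" for M
    by (simp add: padic_add_pow_nth padic_one_nth mod_simps)
  show "x N = 0" if dv: "add_pow (padic_int p) (int p ^ N) \<one>\<^bsub>padic_int p\<^esub> divides\<^bsub>padic_int p\<^esub> x"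
  proof -
    obtain c where "x = add_pow (padic_int p) (int p ^ N) \<one>\<^bsub>padic_int p\<^esub> \<otimes>\<^bsub>padic_int p\<^esub> c"
      using dv unfolding factor_def by blast
    then have "x N = (add_pow (padic_int p) (int p ^ N) \<one>\<^bsub>padic_int p\<^esub> N * c N) mod int p ^ N"
      by (simp only: padic_mult_nth)
    then show ?thesis unfolding pw by simp
  qed
  assume xN: "x N = 0"
  define c where "c M = x (N + M) div int p ^ N" for M
  have c: "x (N + M) = int p ^ N * c M" for M
    using padic_coherent[OF x, of N M] xN unfolding c_def by auto
  have b: "0 \<le> c M \<and> c M < int p ^ M" for M
  proof -
    have "0 \<le> x (N + M)" "x (N + M) < int p ^ (N + M)" using x unfolding padic_carrier_iff by auto
    then have "0 \<le> int p ^ N * c M" "int p ^ N * c M < int p ^ N * int p ^ M"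
      unfolding c by (simp_all add: power_add)
    then show ?thesis using pN[of N] by (simp add: zero_le_mult_iff)
  qed
  have "c \<in> carrier (padic_int p)"
    unfolding padic_carrier_iff
  proof
    fix M
    have "int p ^ N * c (Suc M) mod int p ^ (N + M) = int p ^ N * c M"
      using padic_coherent[OF x, of "N + M" 1] by (simp flip: c)
    then have "int p ^ N * (c (Suc M) mod int p ^ M) = int p ^ N * c M"
      by (simp only: power_add mult_mod_right)
    then show "0 \<le> c M \<and> c M < int p ^ M \<and> c (Suc M) mod int p ^ M = c M"
      using b prime_gt_0_nat[OF p] by auto
  qed
  moreover have "x = add_pow (padic_int p) (int p ^ N) \<one>\<^bsub>padic_int p\<^esub> \<otimes>\<^bsub>padic_int p\<^esub> c"
  proof
    fix M
    have "x M = (int p ^ N * c M) mod int p ^ M"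
      using padic_coherent[OF x, of M N] c[of M] by (simp add: add.commute)
    then show "x M = (add_pow (padic_int p) (int p ^ N) \<one>\<^bsub>padic_int p\<^esub> \<otimes>\<^bsub>padic_int p\<^esub> c) M"
      unfolding padic_mult_nth pw by (simp add: mod_simps)
  qed
  ultimately show "add_pow (padic_int p) (int p ^ N) \<one>\<^bsub>padic_int p\<^esub> divides\<^bsub>padic_int p\<^esub> x"
    unfolding factor_def by blast
qed

lemma padic_nth_eq_0_mono:
  assumes "x \<in> carrier (padic_int p)" "x N = 0" "M \<le> N"
  shows "x M = 0"
  using padic_coherent[OF assms(1), of M "N - M"] assms by simp

text \<open>Vanishing at a level implies vanishing at all lower ones. One nonzero level hence bounds
  the levels of vanishing, and the greatest of them exists.\<close>

lemma padic_ord_le: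
  assumes x: "x \<in> carrier (padic_int p)" and "x (Suc m) \<noteq> 0"
  shows "padic_ord p x \<le> m"
proof -
  have le: "N \<le> m" if "x N = 0" for N
    using that padic_nth_eq_0_mono[OF x that, of "Suc m"] assms(2) by (meson not_less_eq_eq)
  have "x 0 = 0" using x[unfolded padic_carrier_iff, rule_format, of 0] by simp
  then have "x (GREATEST N. x N = 0) = 0"
    using le GreatestI_nat[where P = "\<lambda>N. x N = 0" and k = 0 and b = m] by blast
  then show ?thesis using le unfolding padic_ord_def padic_dvd_iff[OF x] by blast
qed

lemma padic_ord_ge:
  assumes x: "x \<in> carrier (padic_int p)" and "x \<noteq> \<zero>\<^bsub>padic_int p\<^esub>" "x m = 0"
  shows "padic_ord p x \<ge> m"
proof -
  obtain M where M: "x M \<noteq> 0" using assms(2) by (metis ext padic_zero_nth)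
  have "N \<le> M" if "x N = 0" for N
    using that padic_nth_eq_0_mono[OF x that, of M] M by (meson nat_le_linear)
  then show ?thesis unfolding padic_ord_def padic_dvd_iff[OF x]
    using assms(3) Greatest_le_nat[where P = "\<lambda>N. x N = 0" and k = m and b = M] by blast
qed

text \<open>Z_p has no zero divisors: if a is nonzero at level M, its order is below M, so a
  congruence between a u and a v at level M + N leaves one between u and v at level N.\<close>

lemma padic_cancel:
  assumes c: "a \<in> carrier (padic_int p)" "u \<in> carrier (padic_int p)" "v \<in> carrier (padic_int p)"
    and a: "a \<noteq> \<zero>\<^bsub>padic_int p\<^esub>" and eq: "\<And>N. (a N * u N) mod int p ^ N = (a N * v N) mod int p ^ N"
  shows "u = v"
proof
  fix N
  obtain M where M: "a M \<noteq> 0" using a by (metis ext padic_zero_nth)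
  have pp: "Factorial_Ring.prime (int p)" using p by simp
  then have up: "\<not> is_unit (int p)" and pe: "prime_elem (int p)" by auto
  have nd: "\<not> int p ^ M dvd a (M + N)"
    using padic_coherent[OF c(1), of M N] M by (metis dvd_imp_mod_0)
  then have a0: "a (M + N) \<noteq> 0" by auto
  have "int p ^ (M + N) dvd a (M + N) * u (M + N) - a (M + N) * v (M + N)"
    using eq by (simp add: mod_eq_dvd_iff)
  then have d: "int p ^ (M + N) dvd a (M + N) * (u (M + N) - v (M + N))"
    by (simp add: right_diff_distrib)
  have "int p ^ N dvd u (M + N) - v (M + N)"
  proof (cases "u (M + N) - v (M + N) = 0")
    case False
    have "M + N \<le> multiplicity (int p) (a (M + N)) + multiplicity (int p) (u (M + N) - v (M + N))"
      using d a0 False up by (simp add: power_dvd_iff_le_multiplicity prime_elem_multiplicity_mult_distrib[OF pe])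
    moreover have "multiplicity (int p) (a (M + N)) < M"
      using nd a0 up by (simp add: power_dvd_iff_le_multiplicity)
    ultimately have "N \<le> multiplicity (int p) (u (M + N) - v (M + N))" by simp
    then show ?thesis by (rule multiplicity_dvd')
  qed simp
  then have "u (M + N) mod int p ^ N = v (M + N) mod int p ^ N" by (simp add: mod_eq_dvd_iff)
  then show "u N = v N"
    using padic_coherent[OF c(2), of N M] padic_coherent[OF c(3), of N M] by (simp add: add.commute)
qed

section \<open>Bounds for the elementary divisors\<close>

lemma scaled_disc_closed:
  assumes "b \<in> {..<j} \<rightarrow> padic_space p"
  shows "padic_scaled_disc p q j b \<in> carrier (padic_int p)"
  unfolding padic_scaled_disc_def using assms by (intro ring_det_closed padic_polar_closed) auto

lemma scaled_disc_1_nth: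
  assumes q: "integral_quadratic_form q" and b: "b \<in> {..<1} \<rightarrow> padic_space p"
  shows "padic_scaled_disc p q 1 b N =
    polar q (padic_vec N (b 0)) (padic_vec N (b 0)) mod int p ^ N"
proof -
  have b0: "b 0 \<in> padic_space p" using b by auto
  show ?thesis unfolding padic_scaled_disc_def
    by (subst ring_det_1_nth) (simp_all only: padic_polar_closed[OF b0 b0] padic_polar_nth[OF q b0 b0])
qed

lemma scaled_disc_2_nth:
  assumes q: "integral_quadratic_form q" and b: "b \<in> {..<2} \<rightarrow> padic_space p"
  shows "padic_scaled_disc p q 2 b N =
    (polar q (padic_vec N (b 0)) (padic_vec N (b 0)) * polar q (padic_vec N (b 1)) (padic_vec N (b 1))
      - polar q (padic_vec N (b 0)) (padic_vec N (b 1)) * polar q (padic_vec N (b 1)) (padic_vec N (b 0)))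
     mod int p ^ N"
proof -
  have b01: "b 0 \<in> padic_space p" "b 1 \<in> padic_space p" using b by auto
  have "padic_scaled_disc p q 2 b N =
      (padic_polar p q (b 0) (b 0) N * padic_polar p q (b 1) (b 1) N
       - padic_polar p q (b 0) (b 1) N * padic_polar p q (b 1) (b 0) N) mod int p ^ N"
    unfolding padic_scaled_disc_def using b by (intro ring_det_2_nth padic_polar_closed) auto
  also have "\<dots> = (polar q (padic_vec N (b 0)) (padic_vec N (b 0)) * polar q (padic_vec N (b 1)) (padic_vec N (b 1))
      - polar q (padic_vec N (b 0)) (padic_vec N (b 1)) * polar q (padic_vec N (b 1)) (padic_vec N (b 0)))
     mod int p ^ N"
    unfolding padic_polar_nth[OF q b01(1) b01(1)] padic_polar_nth[OF q b01] padic_polar_nth[OF q b01(2,1)]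
      padic_polar_nth[OF q b01(2) b01(2)] by (intro mod_diff_cong mod_mult_cong mod_mod_trivial)
  finally show ?thesis .
qed

section \<open>Primitive sublattices spanned by integer vectors\<close>

definition padic_of_int_vec :: "int ^ 'n \<Rightarrow> 'n \<Rightarrow> nat \<Rightarrow> int" where
  "padic_of_int_vec x = (\<lambda>i N. x $ i mod int p ^ N)"

lemma padic_of_int_vec_closed: "padic_of_int_vec x \<in> padic_space p"
  unfolding padic_space_def padic_of_int_vec_def padic_carrier_iff
  using prime_gt_0_nat[OF p] by (auto simp: mod_mod_cancel)

lemma padic_lincomb_nth:
  assumes "c \<in> {..<j} \<rightarrow> carrier (padic_int p)"
  shows "padic_lincomb p j c (\<lambda>l. padic_of_int_vec (f l)) i N = (\<Sum>l<j. c l N * f l $ i) mod int p ^ N"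
proof -
  have c: "c l \<otimes>\<^bsub>padic_int p\<^esub> padic_of_int_vec (f l) i \<in> carrier (padic_int p)" if "l < j" for l
    using assms that padic_of_int_vec_closed[of "f l"] unfolding padic_space_def by auto
  have "padic_lincomb p j c (\<lambda>l. padic_of_int_vec (f l)) i N =
      (\<Sum>l<j. (c l \<otimes>\<^bsub>padic_int p\<^esub> padic_of_int_vec (f l) i) N) mod int p ^ N"
    unfolding padic_lincomb_def using c by (intro padic_finsum_nth) auto
  also have "(\<Sum>l<j. (c l \<otimes>\<^bsub>padic_int p\<^esub> padic_of_int_vec (f l) i) N) =
      (\<Sum>l<j. (c l N * f l $ i) mod int p ^ N)"
    by (simp add: padic_mult_nth padic_of_int_vec_def mod_mult_right_eq)
  finally have "padic_lincomb p j c (\<lambda>l. padic_of_int_vec (f l)) i N =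
      (\<Sum>l<j. (c l N * f l $ i) mod int p ^ N) mod int p ^ N" .
  then show ?thesis by (simp add: mod_sum_eq)
qed

lemma padic_lincomb_closed:
  assumes "c \<in> {..<j} \<rightarrow> carrier (padic_int p)"
  shows "padic_lincomb p j c (\<lambda>l. padic_of_int_vec (f l)) i \<in> carrier (padic_int p)"
  unfolding padic_lincomb_def using assms padic_of_int_vec_closed unfolding padic_space_def
  by (intro R.finsum_closed) auto

text \<open>The coordinates \<open>idx 0\<close>, ..., \<open>idx (j - 1)\<close> of a combination
  are its coefficients, whence independence. If a x is a combination, its coefficients are a times
  the coordinates \<open>x (idx l)\<close>; cancelling a exhibits x as an integral
  combination.\<close>

lemma echelon_vectors_primitive:
  fixes f :: "nat \<Rightarrow> int ^ 'n"
  assumes ech: "\<And>l m. l < j \<Longrightarrow> m < j \<Longrightarrow> f l $ idx m = (if l = m then 1 else 0)"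
  shows "\<exists>L. padic_basis p j (\<lambda>l. padic_of_int_vec (f l)) L \<and> padic_primitive p L"
proof -
  let ?b = "\<lambda>l. padic_of_int_vec (f l)"
  let ?C = "{..<j} \<rightarrow> carrier (padic_int p)"
  define L where "L = {padic_lincomb p j c ?b | c. c \<in> ?C}"
  have coord: "padic_lincomb p j c ?b (idx m) = c m" if c: "c \<in> ?C" and m: "m < j" for c m
  proof
    fix N
    have "(\<Sum>l<j. c l N * f l $ idx m) = c m N"
      using m ech by (subst sum.remove[of _ m]) (auto intro!: sum.neutral)
    moreover have "c m \<in> carrier (padic_int p)" using c m by auto
    ultimately show "padic_lincomb p j c ?b (idx m) N = c m N"
      by (simp add: padic_lincomb_nth[OF c])
  qed
  have "padic_basis p j ?b L"
    unfolding padic_basis_def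
  proof (intro conjI ballI impI allI)
    show "?b \<in> {..<j} \<rightarrow> padic_space p" using padic_of_int_vec_closed by auto
    show "L = {padic_lincomb p j c ?b |c. c \<in> ?C}" by (simp add: L_def)
    fix c m assume c: "c \<in> ?C" "padic_lincomb p j c ?b = (\<lambda>i. \<zero>\<^bsub>padic_int p\<^esub>)" and "m < j"
    then show "c m = \<zero>\<^bsub>padic_int p\<^esub>" using coord[OF c(1)] by metis
  qed
  moreover have "padic_primitive p L"
    unfolding padic_primitive_def
  proof (intro ballI impI, elim conjE)
    fix a x assume a: "a \<in> carrier (padic_int p)" and x: "x \<in> padic_space p"
      and a0: "a \<noteq> \<zero>\<^bsub>padic_int p\<^esub>" and ax: "(\<lambda>i. a \<otimes>\<^bsub>padic_int p\<^esub> x i) \<in> L"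
    obtain c where c: "c \<in> ?C" "(\<lambda>i. a \<otimes>\<^bsub>padic_int p\<^esub> x i) = padic_lincomb p j c ?b"
      using ax unfolding L_def by auto
    have xc: "x i \<in> carrier (padic_int p)" for i using x unfolding padic_space_def by auto
    define e where "e l = x (idx l)" for l
    have e: "e \<in> ?C" unfolding e_def using xc by auto
    have ce: "c m = a \<otimes>\<^bsub>padic_int p\<^esub> e m" if "m < j" for m
      using coord[OF c(1) that] c(2) unfolding e_def by metis
    have "x i = padic_lincomb p j e ?b i" for i
    proof (rule padic_cancel[OF a xc padic_lincomb_closed[OF e] a0])
      fix N
      have "(a N * x i N) mod int p ^ N = (a \<otimes>\<^bsub>padic_int p\<^esub> x i) N"
        by (simp only: padic_mult_nth)
      also have "\<dots> = (\<Sum>l<j. c l N * f l $ i) mod int p ^ N"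
        using padic_lincomb_nth[OF c(1), of f i N] fun_cong[OF c(2), of i] by simp
      also have "(\<Sum>l<j. c l N * f l $ i) = (\<Sum>l<j. ((a N * e l N) mod int p ^ N) * f l $ i)"
        by (intro sum.cong) (auto simp: ce padic_mult_nth)
      also have "\<dots> mod int p ^ N = (\<Sum>l<j. (((a N * e l N) mod int p ^ N) * f l $ i) mod int p ^ N) mod int p ^ N"
        by (simp only: mod_sum_eq)
      also have "\<dots> = (\<Sum>l<j. (a N * (e l N * f l $ i)) mod int p ^ N) mod int p ^ N"
        by (simp add: mod_mult_left_eq mult.assoc)
      also have "\<dots> = (a N * padic_lincomb p j e ?b i N) mod int p ^ N"
        by (simp add: mod_sum_eq padic_lincomb_nth[OF e] mod_mult_right_eq sum_distrib_left)
      finally show "(a N * x i N) mod int p ^ N = (a N * padic_lincomb p j e ?b i N) mod int p ^ N" .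
    qed
    then show "x \<in> L" unfolding L_def using e by blast
  qed
  ultimately show ?thesis by blast
qed

lemma polar_mod_cong:
  assumes q: "integral_quadratic_form q" and "\<And>i. v $ i mod c = v' $ i mod c" "\<And>i. w $ i mod c = w' $ i mod c"
  shows "polar q v w mod c = polar q v' w' mod c"
proof -
  interpret int_bilinear "polar q" by (rule int_bilinear_polar[OF q])
  have "(v $ i * w $ k) mod c = (v' $ i * w' $ k) mod c" for i k
    using assms(2,3) by (intro mod_mult_cong) auto
  then have "(polar q (axis i 1) (axis k 1) * (v $ i * w $ k)) mod c =
      (polar q (axis i 1) (axis k 1) * (v' $ i * w' $ k)) mod c" for i k
    by (rule mod_mult_cong[OF refl])
  then have "(\<Sum>i\<in>UNIV. (\<Sum>k\<in>UNIV. (polar q (axis i 1) (axis k 1) * (v $ i * w $ k)) mod c) mod c) mod c =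
      (\<Sum>i\<in>UNIV. (\<Sum>k\<in>UNIV. (polar q (axis i 1) (axis k 1) * (v' $ i * w' $ k)) mod c) mod c) mod c"
    by simp
  then show ?thesis unfolding expand[of v w] expand[of v' w'] by (simp only: mod_sum_eq)
qed

lemma polar_padic_vec:
  assumes "integral_quadratic_form q"
  shows "polar q (padic_vec N (padic_of_int_vec x)) (padic_vec N (padic_of_int_vec y)) mod int p ^ N
    = polar q x y mod int p ^ N"
  by (rule polar_mod_cong[OF assms]) (auto simp: padic_vec_def padic_of_int_vec_def)

section \<open>Estimates for the minimal orders of discriminants\<close>

lemma min_disc_ord_le:
  assumes "padic_basis p j b L" "padic_primitive p L" "padic_scaled_disc p q j b (Suc m) \<noteq> 0"
  shows "min_disc_ord p q j \<le> m"
proof -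
  have c: "padic_scaled_disc p q j b \<in> carrier (padic_int p)"
    using assms(1) unfolding padic_basis_def by (intro scaled_disc_closed) auto
  have "padic_scaled_disc p q j b \<noteq> \<zero>\<^bsub>padic_int p\<^esub>" using assms(3) by (auto simp: padic_zero_nth)
  then have "min_disc_ord p q j \<le> padic_ord p (padic_scaled_disc p q j b)"
    unfolding min_disc_ord_def using assms(1,2) by (intro wellorder_Inf_le1) blast
  also have "\<dots> \<le> m" by (rule padic_ord_le[OF c assms(3)])
  finally show ?thesis .
qed

text \<open>The infimum of an empty set of naturals would carry no information. A lower bound
  therefore takes one primitive lattice of nonzero discriminant in addition to divisibility for all
  families b'.\<close>

lemma min_disc_ord_ge:
  assumes "padic_basis p j b L" "padic_primitive p L" "padic_scaled_disc p q j b \<noteq> \<zero>\<^bsub>padic_int p\<^esub>"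
    and "\<And>b'. b' \<in> {..<j} \<rightarrow> padic_space p \<Longrightarrow> padic_scaled_disc p q j b' m = 0"
  shows "min_disc_ord p q j \<ge> m"
  unfolding min_disc_ord_def
proof (rule cInf_greatest)
  show "{padic_ord p (padic_scaled_disc p q j b) |L b. padic_basis p j b L \<and> padic_primitive p L \<and>
      padic_scaled_disc p q j b \<noteq> \<zero>\<^bsub>padic_int p\<^esub>} \<noteq> {}" using assms(1-3) by blast
  fix k assume "k \<in> {padic_ord p (padic_scaled_disc p q j b) |L b. padic_basis p j b L \<and>
      padic_primitive p L \<and> padic_scaled_disc p q j b \<noteq> \<zero>\<^bsub>padic_int p\<^esub>}"
  then obtain L' b' where b': "k = padic_ord p (padic_scaled_disc p q j b')" "padic_basis p j b' L'"
    "padic_scaled_disc p q j b' \<noteq> \<zero>\<^bsub>padic_int p\<^esub>" by blast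
  then have sp: "b' \<in> {..<j} \<rightarrow> padic_space p" unfolding padic_basis_def by blast
  show "m \<le> k" unfolding b'(1) by (rule padic_ord_ge[OF scaled_disc_closed[OF sp] b'(3) assms(4)[OF sp]])
qed

lemma exists_power_not_dvd:
  assumes "(D :: int) \<noteq> 0"
  obtains m where "D mod int p ^ Suc m \<noteq> 0"
proof -
  have "\<not> is_unit (int p)" using p by auto
  then have "\<not> int p ^ Suc (multiplicity (int p) D) dvd D"
    using assms by (simp add: power_dvd_iff_le_multiplicity del: power_Suc)
  then show ?thesis using that by (metis dvd_eq_mod_eq_0)
qed

lemma min_disc_ord_1_le:
  assumes q: "integral_quadratic_form q" and "x $ i = 1" "\<not> int p ^ Suc m dvd polar q x x"
  shows "min_disc_ord p q 1 \<le> m"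
proof -
  obtain L where L: "padic_basis p 1 (\<lambda>l. padic_of_int_vec x) L" "padic_primitive p L"
    using echelon_vectors_primitive[of 1 "\<lambda>_. x" "\<lambda>_. i"] assms(2) by auto
  have sp: "(\<lambda>l. padic_of_int_vec x) \<in> {..<1} \<rightarrow> padic_space p" using padic_of_int_vec_closed by auto
  have "padic_scaled_disc p q 1 (\<lambda>l. padic_of_int_vec x) (Suc m) \<noteq> 0"
    unfolding scaled_disc_1_nth[OF q sp] polar_padic_vec[OF q]
    using assms(3) by (simp add: mod_eq_0_iff_dvd del: power_Suc)
  then show ?thesis by (rule min_disc_ord_le[OF L])
qed

lemma min_disc_ord_1_ge:
  fixes q :: "int ^ 'n \<Rightarrow> int"
  assumes q: "integral_quadratic_form q" "positive_definite q" and d: "\<And>v. int p ^ m dvd polar q v v"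
  shows "min_disc_ord p q 1 \<ge> m"
proof -
  obtain i :: 'n where True by simp
  define x :: "int ^ 'n" where "x = axis i 1"
  obtain L where L: "padic_basis p 1 (\<lambda>l. padic_of_int_vec x) L" "padic_primitive p L"
    using echelon_vectors_primitive[of 1 "\<lambda>_. x" "\<lambda>_. i"] unfolding x_def by (auto simp: axis_def)
  have sp: "(\<lambda>l. padic_of_int_vec x) \<in> {..<1} \<rightarrow> padic_space p" using padic_of_int_vec_closed by auto
  have "x \<noteq> 0" unfolding x_def by (simp add: axis_eq_0_iff)
  then have "polar q x x \<noteq> 0" using polar_self_pos[OF q] by fastforce
  then obtain M where "polar q x x mod int p ^ Suc M \<noteq> 0" by (rule exists_power_not_dvd)
  then have "padic_scaled_disc p q 1 (\<lambda>l. padic_of_int_vec x) (Suc M) \<noteq> 0"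
    unfolding scaled_disc_1_nth[OF q(1) sp] polar_padic_vec[OF q(1)] .
  then have "padic_scaled_disc p q 1 (\<lambda>l. padic_of_int_vec x) \<noteq> \<zero>\<^bsub>padic_int p\<^esub>"
    by (auto simp: padic_zero_nth)
  then show ?thesis
    by (rule min_disc_ord_ge[OF L], subst scaled_disc_1_nth[OF q(1)])
      (use d in \<open>simp_all add: mod_eq_0_iff_dvd\<close>)
qed

context
  fixes q :: "int ^ 4 \<Rightarrow> int"
  assumes q: "integral_quadratic_form q" "positive_definite q"
begin

text \<open>The scaled discriminant of the plane spanned by e_1 and e_2. Being positive, it provides
  a rank-two competitor at every p, and off its prime divisors the rank-two minimum is 0.\<close>

definition axis_minor :: int where
  "axis_minor = polar q (axis 1 1) (axis 1 1) * polar q (axis 2 1) (axis 2 1)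
    - polar q (axis 1 1) (axis 2 1) * polar q (axis 2 1) (axis 1 1)"

lemma axis_minor_pos: "axis_minor > 0"
  unfolding axis_minor_def by (rule polar_minor_pos[OF q]) simp

definition axes :: "nat \<Rightarrow> int ^ 4" where "axes l = (if l = 0 then axis 1 1 else axis 2 1)"

lemma axes_primitive:
  "\<exists>L. padic_basis p 2 (\<lambda>l. padic_of_int_vec (axes l)) L \<and> padic_primitive p L"
  by (rule echelon_vectors_primitive[where idx = "\<lambda>l. if l = 0 then 1 else 2"])
    (auto simp: axes_def axis_def)

lemma axes_disc:
  "padic_scaled_disc p q 2 (\<lambda>l. padic_of_int_vec (axes l)) N = axis_minor mod int p ^ N"
proof -
  have "(\<lambda>l. padic_of_int_vec (axes l)) \<in> {..<2} \<rightarrow> padic_space p"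
    using padic_of_int_vec_closed by auto
  note scaled_disc_2_nth[OF q(1) this, of N]
  also have "(polar q (padic_vec N (padic_of_int_vec (axes 0))) (padic_vec N (padic_of_int_vec (axes 0)))
        * polar q (padic_vec N (padic_of_int_vec (axes 1))) (padic_vec N (padic_of_int_vec (axes 1)))
      - polar q (padic_vec N (padic_of_int_vec (axes 0))) (padic_vec N (padic_of_int_vec (axes 1)))
        * polar q (padic_vec N (padic_of_int_vec (axes 1))) (padic_vec N (padic_of_int_vec (axes 0))))
      mod int p ^ N =
      (polar q (axes 0) (axes 0) * polar q (axes 1) (axes 1)
        - polar q (axes 0) (axes 1) * polar q (axes 1) (axes 0)) mod int p ^ N"
    by (intro mod_diff_cong mod_mult_cong polar_padic_vec[OF q(1)])
  finally show ?thesis unfolding axis_minor_def axes_def by simp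
qed

lemma min_disc_ord_2_eq_0:
  assumes "\<not> int p dvd axis_minor"
  shows "min_disc_ord p q 2 = 0"
proof -
  obtain L where L: "padic_basis p 2 (\<lambda>l. padic_of_int_vec (axes l)) L" "padic_primitive p L"
    using axes_primitive by blast
  have "min_disc_ord p q 2 \<le> 0"
    by (rule min_disc_ord_le[OF L]) (use assms in \<open>simp add: axes_disc dvd_eq_mod_eq_0\<close>)
  then show ?thesis by simp
qed

lemma min_disc_ord_2_ge:
  assumes d: "\<And>v w. int p ^ m dvd polar q v v * polar q w w - polar q v w * polar q w v"
  shows "min_disc_ord p q 2 \<ge> m"
proof -
  obtain L where L: "padic_basis p 2 (\<lambda>l. padic_of_int_vec (axes l)) L" "padic_primitive p L"
    using axes_primitive by blast
  have "axis_minor \<noteq> 0" using axis_minor_pos by simp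
  then obtain M where "axis_minor mod int p ^ Suc M \<noteq> 0" by (rule exists_power_not_dvd)
  then have "padic_scaled_disc p q 2 (\<lambda>l. padic_of_int_vec (axes l)) (Suc M) \<noteq> 0"
    unfolding axes_disc .
  then have "padic_scaled_disc p q 2 (\<lambda>l. padic_of_int_vec (axes l)) \<noteq> \<zero>\<^bsub>padic_int p\<^esub>"
    by (auto simp: padic_zero_nth)
  then show ?thesis
    by (rule min_disc_ord_ge[OF L], subst scaled_disc_2_nth[OF q(1)])
      (use d in \<open>simp_all add: mod_eq_0_iff_dvd\<close>)
qed

end

end

lemma finite_prime_int_dvd:
  assumes "(D :: int) \<noteq> 0"
  shows "finite {p :: nat. int p dvd D}"
proof -
  have "{p :: nat. int p dvd D} \<subseteq> {..nat \<bar>D\<bar>}"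
  proof
    fix p assume "p \<in> {p :: nat. int p dvd D}"
    then have "\<bar>int p\<bar> \<le> \<bar>D\<bar>" using dvd_imp_le_int[OF assms] by blast
    then show "p \<in> {..nat \<bar>D\<bar>}" by simp
  qed
  then show ?thesis by (rule finite_subset) simp
qed

text \<open>A product over an infinite index set is 1 by convention, so finiteness is what gives
  \<open>m_div\<close> its meaning. At primes dividing neither the norm of e_1 nor
  \<open>axis_minor\<close>, the line of e_1 and the plane of e_1 and e_2 show that both minima
  vanish.\<close>

lemma finite_elementary_divisor:
  fixes q :: "int ^ 4 \<Rightarrow> int"
  assumes q: "integral_quadratic_form q" "positive_definite q"
  shows "finite {p. Factorial_Ring.prime p \<and> elementary_divisor p q 1 \<noteq> 0}"
    and "finite {p. Factorial_Ring.prime p \<and> elementary_divisor p q 2 \<noteq> 0}"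
proof -
  define x :: "int ^ 4" where "x = axis 1 1"
  have "x \<noteq> 0" unfolding x_def by (simp add: axis_eq_0_iff)
  then have D1: "polar q x x \<noteq> 0" using polar_self_pos[OF q] by fastforce
  have D2: "axis_minor q \<noteq> 0" using axis_minor_pos[OF two_is_prime_nat q] by simp
  have m1: "min_disc_ord p q 1 = 0" if "Factorial_Ring.prime p" "\<not> int p dvd polar q x x" for p
    using min_disc_ord_1_le[OF that(1) q(1), of x 1 0] that(2) unfolding x_def by (simp add: axis_def)
  have "{p. Factorial_Ring.prime p \<and> elementary_divisor p q 1 \<noteq> 0} \<subseteq> {p. int p dvd polar q x x}"
  proof
    fix p assume "p \<in> {p. Factorial_Ring.prime p \<and> elementary_divisor p q 1 \<noteq> 0}"
    then have "Factorial_Ring.prime p" "min_disc_ord p q 1 \<noteq> 0" unfolding elementary_divisor_def by auto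
    then show "p \<in> {p. int p dvd polar q x x}" using m1[of p] by auto
  qed
  then show "finite {p. Factorial_Ring.prime p \<and> elementary_divisor p q 1 \<noteq> 0}"
    using finite_prime_int_dvd[OF D1] finite_subset by blast
  have "{p. Factorial_Ring.prime p \<and> elementary_divisor p q 2 \<noteq> 0} \<subseteq>
      {p. int p dvd polar q x x} \<union> {p. int p dvd axis_minor q}"
  proof
    fix p assume "p \<in> {p. Factorial_Ring.prime p \<and> elementary_divisor p q 2 \<noteq> 0}"
    then have "Factorial_Ring.prime p" "min_disc_ord p q 1 \<noteq> 0 \<or> min_disc_ord p q 2 \<noteq> 0"
      unfolding elementary_divisor_def by auto
    then show "p \<in> {p. int p dvd polar q x x} \<union> {p. int p dvd axis_minor q}"
      using m1[of p] min_disc_ord_2_eq_0[OF _ q, of p] by (cases "int p dvd polar q x x") auto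
  qed
  then show "finite {p. Factorial_Ring.prime p \<and> elementary_divisor p q 2 \<noteq> 0}"
    using finite_prime_int_dvd[OF D1] finite_prime_int_dvd[OF D2] finite_subset by blast
qed

section \<open>Rational extension of integral forms\<close>

definition rvec :: "int ^ 'n \<Rightarrow> rat ^ 'n" where "rvec v = (\<chi> i. of_int (v $ i))"

definition column_matrix :: "('m \<Rightarrow> int ^ 'n) \<Rightarrow> rat ^ 'm ^ 'n" where
  "column_matrix w = (\<chi> k i. of_int (w i $ k))"

lemma rvec_nth [simp]: "rvec v $ i = of_int (v $ i)"
  unfolding rvec_def by simp

lemma column_matrix_mult_nth: "(column_matrix w *v x) $ k = (\<Sum>i\<in>UNIV. of_int (w i $ k) * x $ i)"
  unfolding column_matrix_def matrix_vector_mult_def by simp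

lemma column_matrix_mult: "column_matrix w *v x = (\<Sum>i\<in>UNIV. x $ i *s rvec (w i))"
  by (simp add: vec_eq_iff column_matrix_mult_nth mult.commute)

lemma column_matrix_mult_axis: "column_matrix w *v axis i 1 = rvec (w i)"
  by (simp add: vec_eq_iff column_matrix_mult_nth axis_def if_distrib[of "\<lambda>x. _ * x"] cong: if_cong)

lemma clear_denominators:
  fixes x :: "rat ^ 'n"
  obtains m :: int and v :: "int ^ 'n" where "m > 0" "of_int m *s x = rvec v"
proof -
  define den where "den i = snd (quotient_of (x $ i))" for i
  have den: "den i > 0" for i unfolding den_def by (rule quotient_of_denom_pos')
  have num: "of_int (den i) * x $ i = of_int (fst (quotient_of (x $ i)))" for i
    using quotient_of_div[of "x $ i" "fst (quotient_of (x $ i))" "den i"] den[of i]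
    unfolding den_def by (simp add: field_simps)
  define m where "m = (\<Prod>i\<in>UNIV. den i)"
  define v :: "int ^ 'n" where "v = (\<chi> i. (\<Prod>j\<in>UNIV - {i}. den j) * fst (quotient_of (x $ i)))"
  have "m > 0" unfolding m_def using den by (intro prod_pos) auto
  moreover have "of_int m * x $ i = of_int (v $ i)" for i
  proof -
    have "m = (\<Prod>j\<in>UNIV - {i}. den j) * den i"
      unfolding m_def by (subst prod.remove[of _ i]) (auto simp: mult.commute)
    then have "of_int m * x $ i = of_int (\<Prod>j\<in>UNIV - {i}. den j) * (of_int (den i) * x $ i)" by simp
    then show ?thesis unfolding num v_def by simp
  qed
  then have "of_int m *s x = rvec v" by (simp add: vec_eq_iff)
  ultimately show ?thesis using that by blast
qed

lemma inj_imp_surj_column_matrix: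
  fixes A :: "rat ^ 'n ^ 'n"
  assumes "\<And>x. A *v x = 0 \<Longrightarrow> x = 0"
  obtains x where "A *v x = y"
proof -
  have "\<exists>B. B ** A = mat 1" unfolding matrix_left_invertible_ker using assms by simp
  then obtain B where "B ** A = mat 1" by (elim exE)
  then have "A ** B = mat 1" by (simp add: matrix_left_right_inverse)
  then have "A *v (B *v y) = y" by (simp add: matrix_vector_mul_assoc)
  then show ?thesis using that by blast
qed

lemma surj_imp_inj_column_matrix:
  fixes A :: "rat ^ 'n ^ 'n"
  assumes "\<And>y. \<exists>x. A *v x = y" and "A *v x = A *v x'"
  shows "x = x'"
proof -
  obtain B where "A ** B = mat 1"
    using assms(1) matrix_right_invertible_surjective[of A] unfolding surj_def by metis
  then have "B ** A = mat 1" by (simp add: matrix_left_right_inverse)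
  then have "B *v (A *v z) = z" for z by (simp add: matrix_vector_mul_assoc)
  then show ?thesis using assms(2) by metis
qed

lemma of_int_det:
  fixes A :: "int ^ 'n ^ 'n"
  shows "det ((\<chi> i j. of_int (A $ i $ j)) :: rat ^ 'n ^ 'n) = of_int (det A)"
  unfolding det_def by simp

text \<open>By Cramer's rule det(A) x_k is the determinant of A with one column replaced by A x,
  whose entries are in Z_(p). With a Gram matrix for A, this bounds the denominators of dual
  vectors.\<close>

lemma cramer_loc:
  fixes A :: "int ^ 'n ^ 'n" and x :: "rat ^ 'n"
  assumes p: "Factorial_Ring.prime p" and "\<And>k. (\<Sum>l\<in>UNIV. of_int (A $ k $ l) * x $ l) \<in> loc p"
  shows "of_int (det A) * x $ k \<in> loc p"
proof -
  define A' :: "rat ^ 'n ^ 'n" where "A' = (\<chi> i j. of_int (A $ i $ j))"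
  have "det (\<chi> i j. if j = k then (A' *v x) $ i else A' $ i $ j) = x $ k * det A'"
    by (rule cramer_lemma)
  moreover have "det A' = of_int (det A)" unfolding A'_def by (rule of_int_det)
  moreover have "det (\<chi> i j. if j = k then (A' *v x) $ i else A' $ i $ j) \<in> loc p"
    using assms by (intro loc_det) (auto simp: A'_def matrix_vector_mult_def)
  ultimately show ?thesis by (simp add: mult.commute)
qed

context int_bilinear
begin

definition pairing :: "rat ^ 'n \<Rightarrow> rat ^ 'n \<Rightarrow> rat" where
  "pairing X Y = (\<Sum>k\<in>UNIV. X $ k * (\<Sum>l\<in>UNIV. of_int (B (axis k 1) (axis l 1)) * Y $ l))"

text \<open>The Gram matrix on the standard basis. For the polar form of q it is twice
  \<open>gram q\<close>, hence integral even where \<open>gram q\<close> has half-integers.\<close>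

definition bmat :: "int ^ 'n ^ 'n" where "bmat = (\<chi> k l. B (axis k 1) (axis l 1))"

lemma pairing_add_left: "pairing (X + X') Y = pairing X Y + pairing X' Y"
  and pairing_scale_left: "pairing (c *s X) Y = c * pairing X Y"
  and pairing_add_right: "pairing X (Y + Y') = pairing X Y + pairing X Y'"
  and pairing_scale_right: "pairing X (c *s Y) = c * pairing X Y"
  unfolding pairing_def by (simp_all add: algebra_simps sum.distrib sum_distrib_left)

lemma pairing_zero: "pairing 0 Y = 0" "pairing X 0 = 0"
  unfolding pairing_def by simp_all

lemma pairing_sum_left: "pairing (sum f A) Y = (\<Sum>i\<in>A. pairing (f i) Y)"
  by (induction A rule: infinite_finite_induct) (simp_all add: pairing_zero pairing_add_left)

lemma pairing_sum_right: "pairing X (sum f A) = (\<Sum>i\<in>A. pairing X (f i))"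
  by (induction A rule: infinite_finite_induct) (simp_all add: pairing_zero pairing_add_right)

lemma pairing_rvec: "pairing (rvec v) (rvec w) = of_int (B v w)"
  unfolding pairing_def expand[of v w] by (simp add: sum_distrib_left mult_ac)

lemma pairing_column_matrix:
  "pairing (column_matrix v *v x) (column_matrix w *v y) =
     (\<Sum>i\<in>UNIV. \<Sum>j\<in>UNIV. x $ i * y $ j * of_int (B (v i) (w j)))"
  unfolding column_matrix_mult pairing_sum_left pairing_scale_left
  unfolding pairing_sum_right pairing_scale_right pairing_rvec
  by (simp add: sum_distrib_left mult_ac)

lemma pairing_axis: "pairing (axis k 1) Y = (\<Sum>l\<in>UNIV. of_int (bmat $ k $ l) * Y $ l)"
  unfolding pairing_def bmat_def
  by (subst sum.remove[of _ k]) (auto simp: axis_def intro!: sum.neutral)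

text \<open>A kernel vector, cleared of denominators, would have norm zero.\<close>

lemma det_bmat_nonzero:
  assumes "\<And>v. v \<noteq> 0 \<Longrightarrow> B v v \<noteq> 0"
  shows "det bmat \<noteq> 0"
proof -
  define A :: "rat ^ 'n ^ 'n" where "A = (\<chi> i j. of_int (bmat $ i $ j))"
  have "x = 0" if x: "A *v x = 0" for x
  proof -
    obtain m v where m: "m > 0" "of_int m *s x = rvec v" by (rule clear_denominators)
    have "pairing (axis k 1) x = 0" for k
      unfolding pairing_axis using arg_cong[OF x, of "\<lambda>v. v $ k"]
      by (simp add: A_def matrix_vector_mult_def)
    then have "pairing X x = 0" for X
      by (subst vector_eq_sum_axis[of X]) (simp add: pairing_sum_left pairing_scale_left)
    then have "pairing (rvec v) (of_int m *s x) = 0" by (simp add: pairing_scale_right)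
    then have "B v v = 0" unfolding m(2) pairing_rvec by simp
    then have "v = 0" using assms by blast
    then have "of_int m *s x = 0" unfolding m(2) by (simp add: vec_eq_iff)
    then show "x = 0" using m(1) by (simp add: vec_eq_iff)
  qed
  then have "\<exists>C. C ** A = mat 1" unfolding matrix_left_invertible_ker by blast
  then have "det A \<noteq> 0" using invertible_left_inverse invertible_det_nz by blast
  then show ?thesis unfolding A_def of_int_det by simp
qed

end

section \<open>Counting local lattices\<close>

text \<open>The preimage of Z_(p)^n under the linear map sending e_i to w i. For w i = \<iota>(e_i)
  it is the localization of the preimage of Z^4 under \<iota>; for w i = \<iota>(f_i) it is the same
  lattice in coordinates along f.\<close>

definition local_lattice :: "int \<Rightarrow> ('m \<Rightarrow> int ^ 'n) \<Rightarrow> (rat ^ 'm) set" where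
  "local_lattice p w = {x. \<forall>k. (column_matrix w *v x) $ k \<in> loc p}"

lemma local_lattice_change_basis:
  fixes f :: "4 \<Rightarrow> int ^ 4"
  assumes hom: "module_hom (*s) (*s) (\<iota> :: int ^ 4 \<Rightarrow> int ^ 4)"
  shows "column_matrix (\<lambda>i. \<iota> (axis i 1)) *v (column_matrix f *v x) = column_matrix (\<lambda>i. \<iota> (f i)) *v x"
proof -
  have i: "\<iota> (f i) $ k = (\<Sum>j\<in>UNIV. f i $ j * \<iota> (axis j 1) $ k)" for i k
  proof -
    have "\<iota> (f i) = \<iota> (\<Sum>j\<in>UNIV. f i $ j *s axis j 1)" by (simp only: vector_eq_sum_axis[symmetric])
    also have "\<dots> = (\<Sum>j\<in>UNIV. f i $ j *s \<iota> (axis j 1))"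
      by (simp add: module_hom.sum[OF hom] module_hom.scale[OF hom])
    finally show ?thesis by simp
  qed
  have "(\<Sum>i\<in>UNIV. of_int (\<iota> (axis i 1) $ k) * (\<Sum>j\<in>UNIV. of_int (f j $ i) * x $ j)) =
      (\<Sum>j\<in>UNIV. of_int (\<iota> (f j) $ k) * x $ j)" for k
    unfolding i by (simp add: sum_distrib_left sum_distrib_right mult_ac) (rule sum.swap)
  then show ?thesis by (simp add: vec_eq_iff column_matrix_mult_nth)
qed

lemma (in int_bilinear) orthogonal_column_matrix:
  assumes "\<And>i j. i \<noteq> j \<Longrightarrow> B (w i) (w j) = 0"
  shows "pairing (column_matrix w *v x) (column_matrix w *v y) = (\<Sum>i\<in>UNIV. of_int (B (w i) (w i)) * x $ i * y $ i)"
proof -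
  have "(\<Sum>j\<in>UNIV. x $ i * y $ j * of_int (B (w i) (w j))) = of_int (B (w i) (w i)) * x $ i * y $ i" for i
    using assms by (subst sum.remove[of _ i]) (auto intro!: sum.neutral)
  then show ?thesis unfolding pairing_column_matrix by simp
qed

lemma polar_representation:
  assumes "\<iota> \<in> representations q Q"
  shows "polar Q (\<iota> v) (\<iota> w) = polar q v w"
proof -
  have "module_hom (*s) (*s) \<iota>" "\<And>v. Q (\<iota> v) = q v"
    using assms unfolding representations_def by (auto simp: fun_eq_iff)
  then show ?thesis unfolding polar_def by (metis module_hom.add)
qed

text \<open>Since \<iota> transports the polar form of q to that of Q, such a y pairs integrally
  with every e_k under q, and Cramer's rule for the Gram matrix of q applies.\<close>

lemma local_lattice_bounded:
  fixes q Q :: "int ^ 4 \<Rightarrow> int"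
  assumes p: "Factorial_Ring.prime p"
    and q: "integral_quadratic_form q" and Q: "integral_quadratic_form Q"
    and \<iota>: "\<iota> \<in> representations q Q" and y: "y \<in> local_lattice p (\<lambda>i. \<iota> (axis i 1))"
  shows "of_int (det (int_bilinear.bmat (polar q))) * y $ k \<in> loc p"
proof (rule cramer_loc[OF p])
  interpret q: int_bilinear "polar q" by (rule int_bilinear_polar[OF q])
  interpret Q: int_bilinear "polar Q" by (rule int_bilinear_polar[OF Q])
  define w where "w i = \<iota> (axis i 1)" for i
  fix k
  have "(\<Sum>l\<in>UNIV. of_int (q.bmat $ k $ l) * y $ l) =
      (\<Sum>l\<in>UNIV. y $ l * Q.pairing (rvec (w k)) (rvec (w l)))"
    unfolding q.bmat_def Q.pairing_rvec w_def polar_representation[OF \<iota>] by (simp add: mult.commute)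
  also have "\<dots> = Q.pairing (rvec (w k)) (column_matrix w *v y)"
    unfolding column_matrix_mult by (simp add: Q.pairing_sum_right Q.pairing_scale_right)
  also have "\<dots> \<in> loc p"
    unfolding Q.pairing_def using y p unfolding local_lattice_def w_def[symmetric]
    by (intro loc_sum loc_mult) auto
  finally show "(\<Sum>l\<in>UNIV. of_int (q.bmat $ k $ l) * y $ l) \<in> loc p" .
qed

lemma local_lattice_good_prime:
  fixes q Q :: "int ^ 4 \<Rightarrow> int"
  assumes p: "Factorial_Ring.prime p"
    and q: "integral_quadratic_form q" and Q: "integral_quadratic_form Q"
    and \<iota>: "\<iota> \<in> representations q Q" and "\<not> p dvd det (int_bilinear.bmat (polar q))"
  shows "local_lattice p (\<lambda>i. \<iota> (axis i 1)) = {y. \<forall>k. y $ k \<in> loc p}"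
proof (intro equalityI subsetI CollectI allI)
  fix y k assume "y \<in> local_lattice p (\<lambda>i. \<iota> (axis i 1))"
  from local_lattice_bounded[OF p q Q \<iota> this, of k] show "y $ k \<in> loc p"
    by (rule loc_cancel[OF p assms(5)])
next
  fix y :: "rat ^ 4" assume "y \<in> {y. \<forall>k. y $ k \<in> loc p}"
  then show "y \<in> local_lattice p (\<lambda>i. \<iota> (axis i 1))"
    unfolding local_lattice_def column_matrix_mult_nth using p by (auto intro!: loc_sum loc_mult)
qed

text \<open>The duality condition is Cramer's rule for the Gram matrix of Q, tested against the
  preimages of the standard basis vectors. The denominators are bounded in standard coordinates by
  the Gram determinant of q; the passage to coordinates along f costs a factor K.\<close>

lemma local_lattice_overlattice:
  fixes q Q :: "int ^ 4 \<Rightarrow> int" and f :: "4 \<Rightarrow> int ^ 4"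
  assumes p: "Factorial_Ring.prime p"
    and q: "integral_quadratic_form q" and Q: "integral_quadratic_form Q"
    and \<iota>: "\<iota> \<in> representations q Q"
    and orth: "\<And>i j. i \<noteq> j \<Longrightarrow> polar q (f i) (f j) = 0" and d: "\<And>i. polar q (f i) (f i) \<noteq> 0"
    and inj: "\<And>x x'. column_matrix f *v x = column_matrix f *v x' \<Longrightarrow> x = x'"
    and K: "K \<noteq> 0" "\<And>x. \<exists>c. K *s x = (\<Sum>i\<in>UNIV. c i *s f i)"
    and nz: "det (int_bilinear.bmat (polar q)) \<noteq> 0" "det (int_bilinear.bmat (polar Q)) \<noteq> 0"
  shows "orthogonal_overlattices.overlattice p (det (int_bilinear.bmat (polar Q)))
    (\<lambda>i. polar q (f i) (f i)) (multiplicity p (det (int_bilinear.bmat (polar q)) * K))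
    (local_lattice p (\<lambda>i. \<iota> (f i)))"
proof -
  interpret q: int_bilinear "polar q" by (rule int_bilinear_polar[OF q])
  interpret Q: int_bilinear "polar Q" by (rule int_bilinear_polar[OF Q])
  define w where "w i = \<iota> (f i)" for i
  have hom: "module_hom (*s) (*s) \<iota>" using \<iota> unfolding representations_def by blast
  interpret O: orthogonal_overlattices p "det Q.bmat" "\<lambda>i. polar q (f i) (f i)"
    "multiplicity p (det q.bmat * K)"
    by unfold_locales (use p d nz in auto)
  have pw: "polar Q (w i) (w j) = polar q (f i) (f j)" for i j
    unfolding w_def by (rule polar_representation[OF \<iota>])
  have bil: "O.bil x y = Q.pairing (column_matrix w *v x) (column_matrix w *v y)" for x y
    unfolding O.bil_def by (subst Q.orthogonal_column_matrix) (auto simp: pw orth)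
  have inj_w: "x = 0" if x: "column_matrix w *v x = 0" for x
  proof -
    have "O.bil x (axis i 1) = 0" for i unfolding bil x by (rule Q.pairing_zero)
    moreover have "O.bil x (axis i 1) = of_int (polar q (f i) (f i)) * x $ i" for i
      unfolding O.bil_def by (subst sum.remove[of _ i]) (auto simp: axis_def intro!: sum.neutral)
    ultimately show ?thesis using d by (simp add: vec_eq_iff)
  qed
  show ?thesis
    unfolding O.overlattice_def w_def[symmetric]
  proof (intro conjI allI ballI impI)
    show "loc_module p (local_lattice p w)"
      unfolding loc_module_def local_lattice_def using p
      by (auto simp: matrix_vector_right_distrib vector_smult_lid matrix_vector_mult_scaleR
          vec.scale simp flip: vector_scalar_mult_def)
    show "axis i 1 \<in> local_lattice p w" for i
      by (simp add: local_lattice_def column_matrix_mult_axis p)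
    show "O.bil x y \<in> loc p" if "x \<in> local_lattice p w" "y \<in> local_lattice p w" for x y
      using that p unfolding bil Q.pairing_def local_lattice_def by (intro loc_sum loc_mult) auto
    show "of_int (det Q.bmat) *s x \<in> local_lattice p w" if x: "\<forall>y\<in>local_lattice p w. O.bil x y \<in> loc p" for x
    proof -
      have "of_int (det Q.bmat) * (column_matrix w *v x) $ k \<in> loc p" for k
      proof (rule cramer_loc[OF p])
        fix k
        obtain y where y: "column_matrix w *v y = axis k 1" using inj_imp_surj_column_matrix[OF inj_w] by blast
        then have "y \<in> local_lattice p w" unfolding local_lattice_def using p by (auto simp: axis_def)
        moreover have "O.bil x y = O.bil y x" unfolding O.bil_def by (simp add: mult_ac)
        ultimately have "O.bil y x \<in> loc p" using x by metis
        then have "Q.pairing (axis k 1) (column_matrix w *v x) \<in> loc p" unfolding bil y .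
        then show "(\<Sum>l\<in>UNIV. of_int (Q.bmat $ k $ l) * (column_matrix w *v x) $ l) \<in> loc p"
          unfolding Q.pairing_axis .
      qed
      then show ?thesis unfolding local_lattice_def by (simp add: column_matrix_mult_nth sum_distrib_left mult_ac)
    qed
    fix x i assume x: "x \<in> local_lattice p w"
    define y where "y = column_matrix f *v x"
    have "y \<in> local_lattice p (\<lambda>i. \<iota> (axis i 1))"
      using x unfolding local_lattice_def y_def mem_Collect_eq local_lattice_change_basis[OF hom] w_def .
    then have Dy: "of_int (det q.bmat) * y $ k \<in> loc p" for k
      by (rule local_lattice_bounded[OF p q Q \<iota>])
    have "\<forall>j. \<exists>c. K *s axis j 1 = (\<Sum>i\<in>UNIV. c i *s f i)" using K(2) by blast
    from choice[OF this] obtain c where c: "\<And>j. K *s axis j 1 = (\<Sum>i\<in>UNIV. c j i *s f i)" by blast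
    \<comment> \<open>The coordinates of K y along f, read off from the expansions of K e_j. By
      uniqueness z = K x, so the bound for the denominators of y carries over to x.\<close>
    define z :: "rat ^ 4" where "z = (\<chi> i. \<Sum>j\<in>UNIV. y $ j * of_int (c j i))"
    have rK: "of_int K *s axis j 1 = (\<Sum>i\<in>UNIV. of_int (c j i) *s rvec (f i))" for j
    proof -
      have "(of_int K *s axis j 1 :: rat ^ 4) $ k = (\<Sum>i\<in>UNIV. of_int (c j i) *s rvec (f i)) $ k" for k
      proof -
        have "(of_int K *s axis j 1 :: rat ^ 4) $ k = of_int ((K *s axis j 1) $ k)"
          by (simp add: axis_def)
        also have "\<dots> = (\<Sum>i\<in>UNIV. of_int (c j i) *s rvec (f i)) $ k" unfolding c by simp
        finally show ?thesis .
      qed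
      then show ?thesis unfolding vec_eq_iff by blast
    qed
    have "column_matrix f *v z = of_int K *s y"
    proof -
      have "of_int K *s y = (\<Sum>j\<in>UNIV. y $ j *s (of_int K *s axis j 1))"
        unfolding vec_eq_iff
        by (simp add: axis_def if_distrib[of "\<lambda>x. _ * x"] mult.commute cong: if_cong)
      also have "\<dots> = (\<Sum>j\<in>UNIV. \<Sum>i\<in>UNIV. (y $ j * of_int (c j i)) *s rvec (f i))"
        unfolding rK by (simp add: vec_eq_iff sum_distrib_left mult_ac)
      also have "\<dots> = (\<Sum>i\<in>UNIV. \<Sum>j\<in>UNIV. (y $ j * of_int (c j i)) *s rvec (f i))" by (rule sum.swap)
      also have "\<dots> = column_matrix f *v z"
        unfolding column_matrix_mult z_def by (simp add: vec_eq_iff sum_distrib_right)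
      finally show ?thesis by simp
    qed
    also have "\<dots> = column_matrix f *v (of_int K *s x)"
      unfolding y_def by (simp add: vec_eq_iff column_matrix_mult_nth sum_distrib_left mult_ac)
    finally have "z = of_int K *s x" by (rule inj)
    then have "of_int K * x $ i = (\<Sum>j\<in>UNIV. y $ j * of_int (c j i))"
      unfolding z_def by (simp add: vec_eq_iff)
    then have "of_int (det q.bmat) * (of_int K * x $ i) =
        (\<Sum>j\<in>UNIV. of_int (det q.bmat) * y $ j * of_int (c j i))"
      by (simp add: sum_distrib_left mult.assoc)
    also have "\<dots> \<in> loc p" by (intro loc_sum[OF p] loc_mult[OF p Dy loc_of_int[OF p]])
    finally have DK: "of_int (det q.bmat * K) * x $ i \<in> loc p" by (simp add: mult.assoc)
    define D e where "D = det q.bmat * K" and "e = multiplicity p (det q.bmat * K)"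
    have nu: "D \<noteq> 0" "\<not> is_unit p" using nz K p unfolding D_def by auto
    obtain u where u: "D = p ^ e * u" "\<not> p dvd u"
      using multiplicity_decompose'[OF nu] unfolding e_def D_def by blast
    have "of_int u * (x $ i * of_int p ^ e) = of_int D * x $ i" unfolding u(1) by simp
    also have "\<dots> \<in> loc p" using DK unfolding D_def .
    finally show "x $ i * of_int p ^ multiplicity p (det q.bmat * K) \<in> loc p"
      unfolding e_def[symmetric] by (rule loc_cancel[OF p u(2)])
  qed
qed

section \<open>From orthogonal systems to elementary divisors and the local count\<close>

lemma rvec_inject: "rvec v = rvec w \<longleftrightarrow> v = w"
  by (simp add: vec_eq_iff)

lemma positive_definite_orthogonal_basis:
  fixes q :: "int ^ 4 \<Rightarrow> int"
  assumes q: "integral_quadratic_form q" "positive_definite q" and p: "Factorial_Ring.prime (p :: int)"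
  defines "s \<equiv> multiplicity p 2"
  obtains f :: "4 \<Rightarrow> int ^ 4" and K where "K \<noteq> 0" "multiplicity p K \<le> 4 * s"
    "\<And>i j. i \<noteq> j \<Longrightarrow> polar q (f i) (f j) = 0"
    "\<And>x. \<exists>c. K *s x = (\<Sum>i\<in>UNIV. c i *s f i)"
    "\<exists>i. f 1 $ i = 1"
    "\<And>m x y. p ^ (m + s) dvd polar q (f 1) (f 1) \<Longrightarrow> p ^ m dvd polar q x y"
    "\<And>m i. p ^ (m + s) dvd polar q (f 2) (f 2) \<Longrightarrow> i = 3 \<or> i = 4 \<Longrightarrow> p ^ m dvd polar q (f i) (f i)"
    "\<And>i. polar q (f i) (f i) > 0"
    "\<And>y. \<exists>x. column_matrix f *v x = y"
    "\<And>x x'. column_matrix f *v x = column_matrix f *v x' \<Longrightarrow> x = x'"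
proof -
  obtain f :: "4 \<Rightarrow> int ^ 4" and K where h: "K \<noteq> 0" "multiplicity p K \<le> 4 * s"
    "\<And>i j. i \<noteq> j \<Longrightarrow> polar q (f i) (f j) = 0"
    "\<And>x. \<exists>c. K *s x = (\<Sum>i\<in>UNIV. c i *s f i)"
    "\<exists>i. f 1 $ i = 1"
    "\<And>m x y. p ^ (m + s) dvd polar q (f 1) (f 1) \<Longrightarrow> p ^ m dvd polar q x y"
    "\<And>m i. p ^ (m + s) dvd polar q (f 2) (f 2) \<Longrightarrow> i = 3 \<or> i = 4 \<Longrightarrow> p ^ m dvd polar q (f i) (f i)"
    by (rule orthogonal_basis_4[OF int_bilinear_polar[OF q(1)] p, folded s_def]) (rule that; assumption)
  have surj: "\<exists>x. column_matrix f *v x = y" for y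
  proof -
    obtain m v where m: "m > 0" "of_int m *s y = rvec v" by (rule clear_denominators)
    obtain c where c: "K *s v = (\<Sum>i\<in>UNIV. c i *s f i)" using h(4) by blast
    define x :: "rat ^ 4" where "x = (\<chi> i. of_int (c i) / of_int (m * K))"
    have "(column_matrix f *v x) $ k = y $ k" for k
    proof -
      have "of_int (m * K) * (column_matrix f *v x) $ k = (\<Sum>i\<in>UNIV. of_int (c i) * of_int (f i $ k))"
        using m(1) h(1) unfolding column_matrix_mult_nth x_def by (simp add: sum_distrib_left field_simps)
      also have "\<dots> = of_int ((K *s v) $ k)" unfolding c by simp
      also have "\<dots> = of_int K * rvec v $ k" by simp
      also have "\<dots> = of_int (m * K) * y $ k" unfolding m(2)[symmetric] by simp
      finally show ?thesis using m(1) h(1) by simp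
    qed
    then show ?thesis unfolding vec_eq_iff by blast
  qed
  have inj: "x = x'" if "column_matrix f *v x = column_matrix f *v x'" for x x'
    using surj_imp_inj_column_matrix[of "column_matrix f"] surj that by blast
  have pos: "polar q (f i) (f i) > 0" for i
  proof (rule polar_self_pos[OF q])
    show "f i \<noteq> 0"
    proof
      assume "f i = 0"
      then have "column_matrix f *v axis i 1 = column_matrix f *v 0"
        unfolding column_matrix_mult_axis by (simp add: vec_eq_iff)
      then have "axis i 1 = (0 :: rat ^ 4)" by (rule inj)
      then show False by (simp add: axis_eq_0_iff)
    qed
  qed
  show ?thesis by (rule that[OF h pos surj inj])
qed

lemma det_polar_nonzero:
  assumes "integral_quadratic_form q" "positive_definite q"
  shows "det (int_bilinear.bmat (polar q)) \<noteq> 0"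
  using int_bilinear.det_bmat_nonzero[OF int_bilinear_polar[OF assms(1)]] polar_self_pos[OF assms]
  by (metis less_irrefl)

text \<open>By minimality of the first norm up to s, and with f_1 as competitor, the rank-one
  minimum lies between kappa_1 - s and kappa_1. In rank two, K^4 times any minor is by Cauchy-Binet
  a sum of products d_i d_j times squares over i < j. Here 18 s is 2 s, from the two minimality
  losses, plus 16 s, the largest possible order of K^4.\<close>

lemma elementary_divisor_bounds:
  fixes q :: "int ^ 4 \<Rightarrow> int" and p :: nat and f :: "4 \<Rightarrow> int ^ 4"
  assumes q: "integral_quadratic_form q" "positive_definite q" and p: "Factorial_Ring.prime p"
  defines "s \<equiv> multiplicity (int p) 2"
  assumes K: "K \<noteq> 0" "multiplicity (int p) K \<le> 4 * s" "\<And>x. \<exists>c. K *s x = (\<Sum>i\<in>UNIV. c i *s f i)"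
    and orth: "\<And>i j. i \<noteq> j \<Longrightarrow> polar q (f i) (f j) = 0"
    and f1: "\<exists>i. f 1 $ i = 1"
    and min1: "\<And>m x y. int p ^ (m + s) dvd polar q (f 1) (f 1) \<Longrightarrow> int p ^ m dvd polar q x y"
    and min2: "\<And>m i. int p ^ (m + s) dvd polar q (f 2) (f 2) \<Longrightarrow> i = 3 \<or> i = 4 \<Longrightarrow>
      int p ^ m dvd polar q (f i) (f i)"
    and pos: "\<And>i. polar q (f i) (f i) > 0"
  shows "int (multiplicity (int p) (polar q (f 1) (f 1))) \<le> elementary_divisor p q 1 + int s"
    and "int (multiplicity (int p) (polar q (f 2) (f 2))) \<le> elementary_divisor p q 2 + 18 * int s"
proof -
  interpret int_bilinear "polar q" by (rule int_bilinear_polar[OF q(1)])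
  have pp: "Factorial_Ring.prime (int p)" using p by simp
  then have up: "\<not> is_unit (int p)" and pe: "prime_elem (int p)" by auto
  define d where "d i = polar q (f i) (f i)" for i
  define k1 k2 where "k1 = multiplicity (int p) (d 1)" and "k2 = multiplicity (int p) (d 2)"
  have d0: "d i \<noteq> 0" for i using pos[of i] unfolding d_def by simp
  have k1: "int p ^ m dvd d 1 \<longleftrightarrow> m \<le> k1" and k2: "int p ^ m dvd d 2 \<longleftrightarrow> m \<le> k2" for m
    using d0 up unfolding k1_def k2_def by (simp_all add: power_dvd_iff_le_multiplicity)
  have all: "int p ^ (k1 - s) dvd polar q x y" for x y
  proof (cases "s \<le> k1")
    case True
    then have "int p ^ ((k1 - s) + s) dvd polar q (f 1) (f 1)" using k1[of k1] unfolding d_def by simp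
    then show ?thesis by (rule min1)
  qed simp
  have "k1 - s \<le> min_disc_ord p q 1" by (rule min_disc_ord_1_ge[OF p q]) (rule all)
  then show "int (multiplicity (int p) (polar q (f 1) (f 1))) \<le> elementary_divisor p q 1 + int s"
    unfolding elementary_divisor_def k1_def d_def by simp
  have m1: "min_disc_ord p q 1 \<le> k1"
  proof -
    obtain i where "f 1 $ i = 1" using f1 by blast
    moreover have "\<not> int p ^ Suc k1 dvd polar q (f 1) (f 1)" using k1[of "Suc k1"] unfolding d_def by simp
    ultimately show ?thesis by (rule min_disc_ord_1_le[OF p q(1)])
  qed
  have dj: "int p ^ (k2 - s) dvd d j" if "j \<noteq> 1" for j
  proof (cases "s \<le> k2")
    case True
    then have "int p ^ ((k2 - s) + s) dvd polar q (f 2) (f 2)" using k2[of k2] unfolding d_def by simp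
    then have "int p ^ (k2 - s) dvd d 3" "int p ^ (k2 - s) dvd d 4" using min2 unfolding d_def by blast+
    moreover have "int p ^ (k2 - s) dvd d 2" unfolding k2 by simp
    ultimately show ?thesis using that exhaust_4[of j] by auto
  qed simp
  \<comment> \<open>In a pair i < j the index j is not 1, so d_j has order at least kappa_2 - s; the
    other factor has order at least kappa_1 - s.\<close>
  have dd: "int p ^ ((k1 - s) + (k2 - s)) dvd d i * d j" if "j \<noteq> 1" for i j
    using all[of "f i" "f i"] dj[OF that] unfolding d_def power_add by (rule mult_dvd_mono)
  have "int p ^ (k1 + k2 - 18 * s) dvd polar q v v * polar q w w - polar q v w * polar q w v" for v w
  proof -
    define mn where "mn = polar q v v * polar q w w - polar q v w * polar q w v"
    obtain c e where c: "K *s v = (\<Sum>i\<in>UNIV. c i *s f i)" and e: "K *s w = (\<Sum>i\<in>UNIV. e i *s f i)"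
      using K(3) by metis
    have comb: "polar q (\<Sum>i\<in>UNIV. g i *s f i) (\<Sum>i\<in>UNIV. h i *s f i) = (\<Sum>i\<in>UNIV. d i * g i * h i)"
      for g h :: "4 \<Rightarrow> int"
    proof -
      have "polar q (\<Sum>i\<in>UNIV. g i *s f i) (\<Sum>i\<in>UNIV. h i *s f i) =
          (\<Sum>i\<in>UNIV. g i * (\<Sum>j\<in>UNIV. h j * polar q (f i) (f j)))"
        unfolding sum_left unfolding sum_right by (simp add: scale_left scale_right sum_distrib_left mult_ac)
      also have "\<dots> = (\<Sum>i\<in>UNIV. d i * g i * h i)"
      proof (rule sum.cong)
        fix i
        have "(\<Sum>j\<in>UNIV. h j * polar q (f i) (f j)) = h i * d i"
          unfolding d_def using orth by (subst sum.remove[of _ i]) (auto intro!: sum.neutral)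
        then show "g i * (\<Sum>j\<in>UNIV. h j * polar q (f i) (f j)) = d i * g i * h i" by simp
      qed simp
      finally show ?thesis .
    qed
    have "K ^ 4 * mn = polar q (K *s v) (K *s v) * polar q (K *s w) (K *s w)
        - polar q (K *s v) (K *s w) * polar q (K *s w) (K *s v)"
      unfolding mn_def by (simp add: scale_left scale_right algebra_simps power4_eq_xxxx)
    also have "\<dots> = d 1 * d 2 * (c 1 * e 2 - c 2 * e 1)\<^sup>2 + d 1 * d 3 * (c 1 * e 3 - c 3 * e 1)\<^sup>2
        + d 1 * d 4 * (c 1 * e 4 - c 4 * e 1)\<^sup>2 + d 2 * d 3 * (c 2 * e 3 - c 3 * e 2)\<^sup>2
        + d 2 * d 4 * (c 2 * e 4 - c 4 * e 2)\<^sup>2 + d 3 * d 4 * (c 3 * e 4 - c 4 * e 3)\<^sup>2"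
      unfolding c e unfolding comb unfolding sum_4
      by (simp add: power2_eq_square algebra_simps)
    also have "int p ^ ((k1 - s) + (k2 - s)) dvd \<dots>"
      by (intro dvd_add dvd_mult2 dd) simp_all
    finally have dv: "int p ^ ((k1 - s) + (k2 - s)) dvd K ^ 4 * mn" .
    show ?thesis
    proof (cases "mn = 0")
      case False
      have "(k1 - s) + (k2 - s) \<le> multiplicity (int p) (K ^ 4 * mn)"
        using dv False K(1) up by (simp add: power_dvd_iff_le_multiplicity)
      also have "\<dots> = 4 * multiplicity (int p) K + multiplicity (int p) mn"
        using False K(1) by (simp add: prime_elem_multiplicity_mult_distrib[OF pe]
            prime_elem_multiplicity_power_distrib[OF pe])
      finally have "k1 + k2 - 18 * s \<le> multiplicity (int p) mn" using K(2) by simp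
      then show ?thesis unfolding mn_def[symmetric] by (rule multiplicity_dvd')
    qed (simp add: mn_def)
  qed
  then have "k1 + k2 - 18 * s \<le> min_disc_ord p q 2" by (rule min_disc_ord_2_ge[OF p q])
  then show "int (multiplicity (int p) (polar q (f 2) (f 2))) \<le> elementary_divisor p q 2 + 18 * int s"
    using m1 unfolding elementary_divisor_def k2_def d_def by simp
qed

text \<open>The lattices are counted in coordinates along f. Origin of the constants: 16 = 4 * 4
  from the two counts of square roots, and n + 1 <= ord(D) + 4 s + 1 with s <= 1 gives 5^4 = 625,
  together 10000. The exponent 5 ord(\<beta>) comes from the last generator, and 10 s = s + 9 s from
  replacing kappa_1 and half of kappa_2 by the elementary divisors. The function \<open>nat\<close>
  accommodates a negative second divisor.\<close>

lemma card_local_lattices: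
  fixes q Q :: "int ^ 4 \<Rightarrow> int" and p :: nat
  assumes q: "integral_quadratic_form q" "positive_definite q"
    and Q: "integral_quadratic_form Q" "positive_definite Q" and p: "Factorial_Ring.prime p"
  defines "D \<equiv> det (int_bilinear.bmat (polar q))" and "\<beta> \<equiv> det (int_bilinear.bmat (polar Q))"
  defines "S \<equiv> (\<lambda>\<iota>. local_lattice (int p) (\<lambda>i. \<iota> (axis i 1))) ` representations q Q"
  shows "finite S \<and> card S \<le> 10000 * Suc (multiplicity (int p) D) ^ 4 *
    p ^ (5 * multiplicity (int p) \<beta> + 10 * multiplicity (int p) 2) *
    (p ^ nat (elementary_divisor p q 1) * p ^ (nat (elementary_divisor p q 2) div 2))"
proof -
  define s where "s = multiplicity (int p) 2"
  have pp: "Factorial_Ring.prime (int p)" using p by simp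
  then have up: "\<not> is_unit (int p)" and pe: "prime_elem (int p)" by auto
  have p2: "p \<ge> 2" using p prime_ge_2_nat by blast
  obtain f :: "4 \<Rightarrow> int ^ 4" and K where h: "K \<noteq> 0" "multiplicity (int p) K \<le> 4 * s"
    "\<And>i j. i \<noteq> j \<Longrightarrow> polar q (f i) (f j) = 0"
    "\<And>x. \<exists>c. K *s x = (\<Sum>i\<in>UNIV. c i *s f i)"
    "\<exists>i. f 1 $ i = 1"
    "\<And>m x y. int p ^ (m + s) dvd polar q (f 1) (f 1) \<Longrightarrow> int p ^ m dvd polar q x y"
    "\<And>m i. int p ^ (m + s) dvd polar q (f 2) (f 2) \<Longrightarrow> i = 3 \<or> i = 4 \<Longrightarrow> int p ^ m dvd polar q (f i) (f i)"
    "\<And>i. polar q (f i) (f i) > 0"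
    "\<And>y. \<exists>x. column_matrix f *v x = y"
    "\<And>x x'. column_matrix f *v x = column_matrix f *v x' \<Longrightarrow> x = x'"
    by (rule positive_definite_orthogonal_basis[OF q pp, folded s_def]) (rule that; assumption)
  have D0: "D \<noteq> 0" and \<beta>0: "\<beta> \<noteq> 0"
    unfolding D_def \<beta>_def using det_polar_nonzero q Q by auto
  have d0: "polar q (f i) (f i) \<noteq> 0" for i using h(8)[of i] by simp
  define n where "n = multiplicity (int p) (D * K)"
  interpret O: orthogonal_overlattices "int p" \<beta> "\<lambda>i. polar q (f i) (f i)" n
    by unfold_locales (use pp d0 \<beta>0 in auto)
  define S' where "S' = (\<lambda>\<iota>. local_lattice (int p) (\<lambda>i. \<iota> (f i))) ` representations q Q"
  have "S' \<subseteq> {L. O.overlattice L}"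
    unfolding S'_def n_def D_def \<beta>_def
    using local_lattice_overlattice[OF pp q(1) Q(1) _ h(3) d0 h(10) h(1,4)
        D0[unfolded D_def] \<beta>0[unfolded \<beta>_def]] by blast
  then have S': "finite S'" "card S' \<le> card {L. O.overlattice L}"
    using O.card_overlattices by (auto intro: finite_subset card_mono)
  have SS: "S = (\<lambda>L. (\<lambda>x. column_matrix f *v x) ` L) ` S'"
  proof -
    have "local_lattice (int p) (\<lambda>i. \<iota> (axis i 1)) =
        (\<lambda>x. column_matrix f *v x) ` local_lattice (int p) (\<lambda>i. \<iota> (f i))" if "\<iota> \<in> representations q Q" for \<iota>
    proof -
      have hom: "module_hom (*s) (*s) \<iota>" using that unfolding representations_def by blast
      have "column_matrix f *v x \<in> local_lattice (int p) (\<lambda>i. \<iota> (axis i 1)) \<longleftrightarrow>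
          x \<in> local_lattice (int p) (\<lambda>i. \<iota> (f i))" for x
        unfolding local_lattice_def mem_Collect_eq local_lattice_change_basis[OF hom] ..
      then show ?thesis using h(9) by (auto simp: image_iff) metis
    qed
    then show ?thesis unfolding S_def S'_def image_image by (intro image_cong) auto
  qed
  have fin: "finite S" unfolding SS using S'(1) by simp
  have "card S \<le> card S'" unfolding SS by (rule card_image_le[OF S'(1)])
  also have "\<dots> \<le> card {L. O.overlattice L}" by (rule S'(2))
  also have "\<dots> \<le> Suc n ^ 4 * (p ^ O.kap 1 * (4 * p ^ (O.kap 2 div 2)) * (4 * p ^ (2 * O.bord) * p ^ (3 * O.bord)))"
    using O.card_overlattices by simp
  also have "\<dots> = 16 * Suc n ^ 4 * p ^ (5 * O.bord) * (p ^ O.kap 1 * p ^ (O.kap 2 div 2))"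
    by (simp add: add_ac flip: power_add)
  also have "\<dots> \<le> 16 * (5 * Suc (multiplicity (int p) D)) ^ 4 * p ^ (5 * O.bord) *
      (p ^ (nat (elementary_divisor p q 1) + s) * p ^ (nat (elementary_divisor p q 2) div 2 + 9 * s))"
  proof (intro mult_mono power_mono power_increasing)
    have "p ^ s \<le> 2" using prime_power_multiplicity_two_le[OF pp] unfolding s_def by simp
    moreover have "2 ^ s \<le> p ^ s" by (rule power_mono[OF p2]) simp
    ultimately have "(2 :: nat) ^ s \<le> 2 ^ 1" by simp
    then have "s \<le> 1" by (simp only: power_increasing_iff one_less_numeral_iff semiring_norm)
    moreover have "n = multiplicity (int p) D + multiplicity (int p) K"
      unfolding n_def using D0 h(1) by (rule prime_elem_multiplicity_mult_distrib[OF pe])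
    ultimately show "Suc n \<le> 5 * Suc (multiplicity (int p) D)" using h(2) by simp
    note eb = elementary_divisor_bounds[OF q p h(1) h(2)[unfolded s_def] h(4,3,5)
        h(6)[unfolded s_def] h(7)[unfolded s_def] h(8), folded s_def]
    show "O.kap 1 \<le> nat (elementary_divisor p q 1) + s" using eb(1) unfolding O.kap_def by simp
    show "O.kap 2 div 2 \<le> nat (elementary_divisor p q 2) div 2 + 9 * s" using eb(2) unfolding O.kap_def by simp
  qed (use p2 in auto)
  also have "\<dots> = 10000 * Suc (multiplicity (int p) D) ^ 4 * p ^ (5 * O.bord + 10 * s) *
      (p ^ nat (elementary_divisor p q 1) * p ^ (nat (elementary_divisor p q 2) div 2))"
  proof -
    have "p ^ (10 * s) = p ^ s * p ^ (9 * s)" by (simp flip: power_add)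
    moreover have "(5 * Suc (multiplicity (int p) D)) ^ 4 = 625 * Suc (multiplicity (int p) D) ^ 4"
      unfolding power_mult_distrib by simp
    ultimately show ?thesis by (simp only: power_add) simp
  qed
  finally show ?thesis using fin unfolding O.bord_def s_def by simp
qed

section \<open>Representations\<close>

text \<open>An orthogonal system, for the arbitrary choice p = 2, diagonalizes the form: 2 K^2 n is
  a sum of squares c_i^2 with positive integer weights, so every |c_i| is at most 2 K^2 n.\<close>

lemma finite_level_set:
  fixes Q :: "int ^ 4 \<Rightarrow> int"
  assumes Q: "integral_quadratic_form Q" "positive_definite Q"
  shows "finite {v. Q v = n}"
proof -
  interpret int_bilinear "polar Q" by (rule int_bilinear_polar[OF Q(1)])
  have two: "Factorial_Ring.prime (2 :: int)" by simp
  obtain f :: "4 \<Rightarrow> int ^ 4" and K where K: "K \<noteq> 0" "\<And>x. \<exists>c. K *s x = (\<Sum>i\<in>UNIV. c i *s f i)"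
    and orth: "\<And>i j. i \<noteq> j \<Longrightarrow> polar Q (f i) (f j) = 0" and pos: "\<And>i. polar Q (f i) (f i) > 0"
    by (rule positive_definite_orthogonal_basis[OF Q two]) (rule that; assumption)
  define M where "M = 2 * K\<^sup>2 * n"
  let ?C = "PiE UNIV (\<lambda>_ :: 4. {-M..M})"
  have "(\<lambda>v. K *s v) ` {v. Q v = n} \<subseteq> (\<lambda>c. \<Sum>i\<in>UNIV. c i *s f i) ` ?C"
  proof clarify
    fix v assume n: "n = Q v"
    obtain c where c: "K *s v = (\<Sum>i\<in>UNIV. c i *s f i)" using K(2) by blast
    have "M = polar Q (K *s v) (K *s v)"
      unfolding M_def n polar_self[OF Q(1)] quadratic_form_scale[OF Q(1)] by simp
    also have "\<dots> = (\<Sum>i\<in>UNIV. \<Sum>j\<in>UNIV. c i * (c j * polar Q (f i) (f j)))"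
      unfolding c unfolding sum_left unfolding sum_right
      by (simp add: scale_left scale_right mult_ac)
    also have "\<dots> = (\<Sum>i\<in>UNIV. (c i)\<^sup>2 * polar Q (f i) (f i))"
    proof (rule sum.cong)
      fix i show "(\<Sum>j\<in>UNIV. c i * (c j * polar Q (f i) (f j))) = (c i)\<^sup>2 * polar Q (f i) (f i)"
        using orth by (subst sum.remove[of _ i]) (auto simp: power2_eq_square intro!: sum.neutral)
    qed simp
    finally have M: "M = (\<Sum>i\<in>UNIV. (c i)\<^sup>2 * polar Q (f i) (f i))" .
    have nonneg: "0 \<le> (c j)\<^sup>2 * polar Q (f j) (f j)" for j
      using less_imp_le[OF pos[of j]] by (intro mult_nonneg_nonneg) auto
    have "c i \<in> {-M..M}" for i
    proof -
      have "(c i)\<^sup>2 * 1 \<le> (c i)\<^sup>2 * polar Q (f i) (f i)"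
        using pos[of i] by (intro mult_left_mono) auto
      also have "\<dots> \<le> M"
        unfolding M
        by (rule member_le_sum[where i = i and A = UNIV and f = "\<lambda>i. (c i)\<^sup>2 * polar Q (f i) (f i)"])
          (use nonneg in auto)
      finally have "(c i)\<^sup>2 \<le> M" by simp
      moreover have "\<bar>c i\<bar> \<le> (c i)\<^sup>2"
      proof (cases "c i = 0")
        case False
        then have "\<bar>c i\<bar> * 1 \<le> \<bar>c i\<bar> * \<bar>c i\<bar>" by (intro mult_left_mono) auto
        then show ?thesis by (simp add: power2_eq_square)
      qed simp
      ultimately show ?thesis by auto
    qed
    then have "c \<in> ?C" by auto
    then show "K *s v \<in> (\<lambda>c. \<Sum>i\<in>UNIV. c i *s f i) ` ?C" using c by blast
  qed
  moreover have "finite ?C" by (intro finite_PiE) auto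
  ultimately have "finite ((\<lambda>v. K *s v) ` {v. Q v = n})" using finite_surj by blast
  moreover have "inj_on (\<lambda>v. K *s v) {v. Q v = n}"
    using K(1) by (auto simp: inj_on_def vec_eq_iff)
  ultimately show ?thesis by (rule finite_imageD)
qed

lemma representation_axis_expand:
  assumes "module_hom (*s) (*s) (\<iota> :: int ^ 'n \<Rightarrow> int ^ 'm)"
  shows "\<iota> v = (\<Sum>j\<in>UNIV. v $ j *s \<iota> (axis j 1))"
proof -
  have "\<iota> v = \<iota> (\<Sum>j\<in>UNIV. v $ j *s axis j 1)" by (simp only: vector_eq_sum_axis[symmetric])
  also have "\<dots> = (\<Sum>j\<in>UNIV. v $ j *s \<iota> (axis j 1))"
    by (simp add: module_hom.sum[OF assms] module_hom.scale[OF assms])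
  finally show ?thesis .
qed

lemma column_matrix_mult_rvec:
  assumes "module_hom (*s) (*s) (\<iota> :: int ^ 'n \<Rightarrow> int ^ 'm)"
  shows "column_matrix (\<lambda>i. \<iota> (axis i 1)) *v rvec v = rvec (\<iota> v)"
  unfolding vec_eq_iff column_matrix_mult_nth by (subst representation_axis_expand[OF assms]) (simp add: mult.commute)

lemma finite_representations:
  fixes q Q :: "int ^ 4 \<Rightarrow> int"
  assumes Q: "integral_quadratic_form Q" "positive_definite Q"
  shows "finite (representations q Q)"
proof -
  have "(\<lambda>\<iota> i. \<iota> (axis i 1)) ` representations q Q \<subseteq> PiE UNIV (\<lambda>i :: 4. {v. Q v = q (axis i 1)})"
    unfolding representations_def by (auto simp: fun_eq_iff)
  moreover have "finite (PiE UNIV (\<lambda>i :: 4. {v. Q v = q (axis i 1)}))"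
    by (intro finite_PiE finite_level_set[OF Q]) auto
  ultimately have "finite ((\<lambda>\<iota> i. \<iota> (axis i 1)) ` representations q Q)" by (rule finite_subset)
  moreover have "inj_on (\<lambda>\<iota> i. \<iota> (axis i 1)) (representations q Q)"
  proof (rule inj_onI)
    fix \<iota> \<iota>' assume "\<iota> \<in> representations q Q" "\<iota>' \<in> representations q Q"
      and eq: "(\<lambda>i. \<iota> (axis i 1)) = (\<lambda>i. \<iota>' (axis i 1))"
    then have hom: "module_hom (*s) (*s) \<iota>" "module_hom (*s) (*s) \<iota>'" unfolding representations_def by auto
    show "\<iota> = \<iota>'"
    proof
      fix v show "\<iota> v = \<iota>' v"
        unfolding representation_axis_expand[OF hom(1), of v] representation_axis_expand[OF hom(2), of v]
        using fun_cong[OF eq] by simp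
    qed
  qed
  ultimately show ?thesis by (rule finite_imageD)
qed

text \<open>If all localizations agree, then \<open>\<iota>' \<circ> \<iota>\<^sup>-\<^sup>1\<close> is integral.\<close>

lemma same_local_lattices_imp_isometry:
  fixes q Q :: "int ^ 4 \<Rightarrow> int"
  assumes q: "integral_quadratic_form q" "positive_definite q"
    and Q: "integral_quadratic_form Q" "positive_definite Q"
    and \<iota>: "\<iota> \<in> representations q Q" and \<iota>': "\<iota>' \<in> representations q Q"
    and eq: "\<And>p. Factorial_Ring.prime p \<Longrightarrow>
      local_lattice p (\<lambda>i. \<iota> (axis i 1)) = local_lattice p (\<lambda>i. \<iota>' (axis i 1))"
  shows "\<exists>g\<in>representations Q Q. \<iota>' = g \<circ> \<iota>"
proof -
  have hom: "module_hom (*s) (*s) \<iota>" "module_hom (*s) (*s) \<iota>'"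
    and Q\<iota>: "Q (\<iota> v) = q v" "Q (\<iota>' v) = q v" for v
    using \<iota> \<iota>' unfolding representations_def by (auto simp: fun_eq_iff)
  define A where "A = column_matrix (\<lambda>i. \<iota> (axis i 1))"
  define A' where "A' = column_matrix (\<lambda>i. \<iota>' (axis i 1))"
  have Arv: "A *v rvec v = rvec (\<iota> v)" "A' *v rvec v = rvec (\<iota>' v)" for v
    unfolding A_def A'_def by (rule column_matrix_mult_rvec[OF hom(1)], rule column_matrix_mult_rvec[OF hom(2)])
  have Q0: "Q 0 = 0" using quadratic_form_scale[OF Q(1), of 0 0] by simp
  have "x = 0" if x: "A *v x = 0" for x
  proof -
    obtain m v where m: "m > 0" "of_int m *s x = rvec v" by (rule clear_denominators)
    have "rvec (\<iota> v) = of_int m *s (A *v x)"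
      unfolding Arv[symmetric] m(2)[symmetric] by (simp add: vec.scale)
    then have "\<iota> v = 0" unfolding x by (simp add: vec_eq_iff)
    then have "q v = 0" using Q\<iota>(1)[of v] Q0 by simp
    then have "v = 0" using q(2) unfolding positive_definite_def by force
    then have "of_int m *s x = 0" unfolding m(2) by (simp add: vec_eq_iff)
    then show "x = 0" using m(1) by (simp add: vec_eq_iff)
  qed
  then have "\<exists>C. C ** A = mat 1" unfolding matrix_left_invertible_ker by simp
  then obtain C where C: "C ** A = mat 1" by (elim exE)
  then have C': "A ** C = mat 1" by (simp add: matrix_left_right_inverse)
  \<comment> \<open>The matrix of \<iota>' after the inverse of \<iota>. The preimage of an integral
    z under \<iota> lies in all local lattices of \<iota>, hence in those of \<iota>', so U z is
    integral at every prime.\<close>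
  define U where "U = A' ** C"
  have "(U *v rvec z) $ k \<in> \<int>" for z k
  proof (rule loc_all_primes_imp_int)
    fix p :: int assume p: "Factorial_Ring.prime p"
    have "A *v (C *v rvec z) = rvec z" using C' by (simp add: matrix_vector_mul_assoc)
    then have "C *v rvec z \<in> local_lattice p (\<lambda>i. \<iota> (axis i 1))"
      unfolding local_lattice_def A_def[symmetric] using p by simp
    then have "C *v rvec z \<in> local_lattice p (\<lambda>i. \<iota>' (axis i 1))" unfolding eq[OF p] .
    then show "(U *v rvec z) $ k \<in> loc p"
      unfolding local_lattice_def A'_def[symmetric] U_def by (simp add: matrix_vector_mul_assoc)
  qed
  then have int: "of_int \<lfloor>(U *v rvec z) $ k\<rfloor> = (U *v rvec z) $ k" for z k by (auto elim!: Ints_cases)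
  define g where "g z = (\<chi> k. \<lfloor>(U *v rvec z) $ k\<rfloor>)" for z
  have g: "rvec (g z) = U *v rvec z" for z unfolding g_def by (simp add: vec_eq_iff int)
  have g_add: "g (x + y) = g x + g y" for x y
  proof -
    have "rvec (x + y) = rvec x + rvec y" "rvec (g x + g y) = rvec (g x) + rvec (g y)"
      by (simp_all add: vec_eq_iff)
    then have "rvec (g (x + y)) = rvec (g x + g y)" by (simp add: g matrix_vector_right_distrib)
    then show ?thesis unfolding rvec_inject .
  qed
  have g_scale: "g (c *s x) = c *s g x" for c x
  proof -
    have "rvec (c *s x) = of_int c *s rvec x" "rvec (c *s g x) = of_int c *s rvec (g x)"
      by (simp_all add: vec_eq_iff)
    then have "rvec (g (c *s x)) = rvec (c *s g x)" by (simp add: g vec.scale)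
    then show ?thesis unfolding rvec_inject .
  qed
  have hom_g: "module_hom (*s) (*s) g"
    using hom(1) g_add g_scale unfolding module_hom_def module_hom_axioms_def by blast
  have comp: "g (\<iota> v) = \<iota>' v" for v
  proof -
    have "rvec (g (\<iota> v)) = A' *v (C *v (A *v rvec v))"
      unfolding g Arv U_def by (simp add: matrix_vector_mul_assoc)
    also have "C *v (A *v rvec v) = rvec v" using C by (simp add: matrix_vector_mul_assoc)
    also have "A' *v rvec v = rvec (\<iota>' v)" by (rule Arv(2))
    finally show ?thesis unfolding rvec_inject .
  qed
  have "Q (g z) = Q z" for z
  proof -
    \<comment> \<open>Some positive multiple of z is a value of \<iota>; on such values g preserves
      Q because both representations pull Q back to q.\<close>
    obtain m v where m: "m > 0" "of_int m *s (C *v rvec z) = rvec v" by (rule clear_denominators)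
    have "rvec (\<iota> v) = of_int m *s (A *v (C *v rvec z))"
      unfolding Arv[symmetric] m(2)[symmetric] by (simp add: vec.scale)
    also have "A *v (C *v rvec z) = rvec z" using C' by (simp add: matrix_vector_mul_assoc)
    also have "of_int m *s rvec z = rvec (m *s z)" by (simp add: vec_eq_iff)
    finally have z: "\<iota> v = m *s z" unfolding rvec_inject .
    have "m\<^sup>2 * Q z = Q (\<iota> v)" unfolding z quadratic_form_scale[OF Q(1)] ..
    also have "\<dots> = Q (\<iota>' v)" unfolding Q\<iota> ..
    also have "\<dots> = m\<^sup>2 * Q (g z)"
      unfolding comp[symmetric] z g_scale quadratic_form_scale[OF Q(1)] ..
    finally show ?thesis using m(1) by simp
  qed
  then have "g \<in> representations Q Q" unfolding representations_def using hom_g by (auto simp: fun_eq_iff)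
  moreover have "\<iota>' = g \<circ> \<iota>" using comp by (auto simp: fun_eq_iff)
  ultimately show ?thesis by blast
qed

text \<open>At primes not dividing the Gram determinant of q the local lattice is Z_(p)^4 for every
  representation. The tuple of lattices at the finitely many others thus fixes the representation up
  to an isometry of Q, that is, an element of \<open>representations Q Q\<close>.\<close>

lemma card_representations_le:
  fixes q Q :: "int ^ 4 \<Rightarrow> int"
  assumes q: "integral_quadratic_form q" "positive_definite q"
    and Q: "integral_quadratic_form Q" "positive_definite Q"
  defines "P \<equiv> {p :: nat. Factorial_Ring.prime p \<and> int p dvd det (int_bilinear.bmat (polar q))}"
  shows "card (representations q Q) \<le>
    (\<Prod>p\<in>P. card ((\<lambda>\<iota>. local_lattice (int p) (\<lambda>i. \<iota> (axis i 1))) ` representations q Q))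
      * card (representations Q Q)"
proof -
  define S where "S p = (\<lambda>\<iota>. local_lattice (int p) (\<lambda>i. \<iota> (axis i 1))) ` representations q Q" for p :: nat
  define F where "F \<iota> = restrict (\<lambda>p :: nat. local_lattice (int p) (\<lambda>i. \<iota> (axis i 1))) P"
    for \<iota> :: "int ^ 4 \<Rightarrow> int ^ 4"
  have finP: "finite P"
    unfolding P_def using finite_prime_int_dvd[OF det_polar_nonzero[OF q]] by (rule finite_subset[rotated]) auto
  have finS: "finite (S p)" for p unfolding S_def using finite_representations[OF Q] by simp
  have "F ` representations q Q \<subseteq> PiE P S" unfolding F_def S_def by auto
  then have "card (F ` representations q Q) \<le> card (PiE P S)"
    by (intro card_mono finite_PiE finP finS)
  also have "\<dots> = (\<Prod>p\<in>P. card (S p))" by (rule card_PiE[OF finP])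
  finally have im: "card (F ` representations q Q) \<le> (\<Prod>p\<in>P. card (S p))" .
  have fiber: "finite {\<iota>' \<in> representations q Q. F \<iota>' = F \<iota>} \<and>
      card {\<iota>' \<in> representations q Q. F \<iota>' = F \<iota>} \<le> card (representations Q Q)"
    if \<iota>: "\<iota> \<in> representations q Q" for \<iota>
  proof -
    have "{\<iota>' \<in> representations q Q. F \<iota>' = F \<iota>} \<subseteq> (\<lambda>g. g \<circ> \<iota>) ` representations Q Q"
    proof
      fix \<iota>' assume h: "\<iota>' \<in> {\<iota>' \<in> representations q Q. F \<iota>' = F \<iota>}"
      have "local_lattice p (\<lambda>i. \<iota> (axis i 1)) = local_lattice p (\<lambda>i. \<iota>' (axis i 1))"
        if p: "Factorial_Ring.prime p" for p
      proof (cases "p dvd det (int_bilinear.bmat (polar q))")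
        case True
        obtain n where n: "p = int n" using prime_gt_0_int[OF p] zero_less_imp_eq_int by blast
        have "n \<in> P" using True p unfolding P_def n by simp
        moreover have "F \<iota>' n = F \<iota> n" using h by simp
        ultimately show ?thesis unfolding F_def n by simp
      next
        case False
        then show ?thesis using local_lattice_good_prime[OF p q(1) Q(1)] h \<iota> by simp
      qed
      then obtain g where "g \<in> representations Q Q" "\<iota>' = g \<circ> \<iota>"
        using same_local_lattices_imp_isometry[OF q Q \<iota>, of \<iota>'] h by blast
      then show "\<iota>' \<in> (\<lambda>g. g \<circ> \<iota>) ` representations Q Q" by blast
    qed
    then show ?thesis
      using surj_card_le[OF finite_representations[OF Q]] finite_representations[OF Q] finite_subset[rotated]
      by blast
  qed
  have "finite (representations q Q) \<and> card (representations q Q) \<le>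
      (\<Prod>p\<in>P. card (S p)) * card (representations Q Q)"
    by (rule card_fibers_le[where f = F, OF _ im]) (use fiber finite_representations[OF Q] in auto)
  then show ?thesis unfolding S_def by simp
qed

section \<open>Products over primes\<close>

text \<open>Bernoulli's inequality for y = x^(1/4) gives (n + 1) h <= y^n with h = min(1, y - 1);
  the fourth power of this is the claim.\<close>

lemma polynomial_le_exponential:
  fixes x :: real
  assumes "x > 1"
  obtains B where "B \<ge> 1" "\<And>n. real (Suc n) ^ 4 \<le> B * x ^ n"
proof -
  define y where "y = x powr (1 / 4)"
  have y: "y > 1" unfolding y_def using assms by (intro gr_one_powr) auto
  have y4: "y ^ 4 = x" unfolding y_def using assms by (simp add: powr_powr flip: powr_realpow)
  define h where "h = min 1 (y - 1)"
  have h: "0 < h" "h \<le> 1" "h \<le> y - 1" using y unfolding h_def by auto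
  have le: "real (Suc n) * h \<le> y ^ n" for n
  proof -
    have "real (Suc n) * h \<le> 1 + real n * (y - 1)"
      using h mult_left_mono[of h "y - 1" "real n"] by (simp add: algebra_simps)
    also have "\<dots> \<le> (1 + (y - 1)) ^ n" using y by (intro Bernoulli_inequality) simp
    finally show ?thesis by simp
  qed
  show ?thesis
  proof (rule that[of "(1 / h) ^ 4"])
    show "1 \<le> (1 / h) ^ 4" using h by (intro one_le_power) simp
    fix n
    have "(real (Suc n) * h) ^ 4 \<le> (y ^ n) ^ 4" using le h by (intro power_mono) auto
    also have "(y ^ n) ^ 4 = (y ^ 4) ^ n" by (simp add: mult.commute flip: power_mult)
    finally have "real (Suc n) ^ 4 * h ^ 4 \<le> x ^ n" unfolding y4 power_mult_distrib .
    then show "real (Suc n) ^ 4 \<le> (1 / h) ^ 4 * x ^ n"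
      using h by (simp add: power_one_over divide_simps)
  qed
qed

lemma abs_eq_prod_primes:
  fixes D :: int
  assumes "D \<noteq> 0"
  shows "(\<Prod>p | Factorial_Ring.prime p \<and> int p dvd D. int p ^ multiplicity (int p) D) = \<bar>D\<bar>"
proof -
  have "prime_factors D = int ` {p. Factorial_Ring.prime p \<and> int p dvd D}"
  proof (intro equalityI subsetI)
    fix x assume "x \<in> prime_factors D"
    then have x: "Factorial_Ring.prime x" "x dvd D" by (auto simp: in_prime_factors_iff)
    then obtain n where "x = int n" using prime_gt_0_int zero_less_imp_eq_int by blast
    then show "x \<in> int ` {p. Factorial_Ring.prime p \<and> int p dvd D}" using x by auto
  qed (use assms in \<open>auto simp: in_prime_factors_iff\<close>)
  then have "(\<Prod>x\<in>prime_factors D. x ^ multiplicity x D) =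
      (\<Prod>p | Factorial_Ring.prime p \<and> int p dvd D. int p ^ multiplicity (int p) D)"
    by (simp add: prod.reindex)
  then show ?thesis using prod_prime_factors[OF assms] by simp
qed

text \<open>The argument of the classical divisor bound. For p >= (16 A)^(1/\<epsilon>) and n >= 1
  one has A (n + 1)^4 <= (16 A)^n <= p^(\<epsilon> n) without any constant; each of the finitely
  many smaller primes costs the constant A B0, and C is the product of these.\<close>

lemma prod_multiplicity_le_powr:
  fixes A \<epsilon> :: real
  assumes A: "A \<ge> 1" and \<epsilon>: "\<epsilon> > 0"
  obtains C where "C > 0"
    "\<And>D :: int. D \<noteq> 0 \<Longrightarrow> (\<Prod>p | Factorial_Ring.prime p \<and> int p dvd D.
        A * real (Suc (multiplicity (int p) D)) ^ 4) \<le> C * real_of_int \<bar>D\<bar> powr \<epsilon>"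
proof -
  obtain B0 where B0: "B0 \<ge> 1" "\<And>n. real (Suc n) ^ 4 \<le> B0 * (2 powr \<epsilon>) ^ n"
    using polynomial_le_exponential[of "2 powr \<epsilon>"] gr_one_powr[of 2 \<epsilon>] \<epsilon> by auto
  define X where "X = (16 * A) powr (1 / \<epsilon>)"
  define T where "T = {p :: nat. real p < X}"
  have T: "finite T" unfolding T_def
    by (rule finite_subset[of _ "{..nat \<lceil>X\<rceil>}"]) (auto, linarith)
  define c where "c p = (if p \<in> T then A * B0 else 1)" for p :: nat
  have c1: "c p \<ge> 1" for p unfolding c_def using A B0 by (auto simp: mult_ge1_I)
  have factor: "A * real (Suc n) ^ 4 \<le> c p * (real p powr \<epsilon>) ^ n" if p: "Factorial_Ring.prime p" and n: "n \<ge> 1" for p n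
  proof (cases "p \<in> T")
    case True
    have "real p \<ge> 2" using prime_ge_2_nat[OF p] by simp
    then have "2 powr \<epsilon> \<le> real p powr \<epsilon>" using \<epsilon> by (intro powr_mono2) auto
    then have "(2 powr \<epsilon>) ^ n \<le> (real p powr \<epsilon>) ^ n" by (intro power_mono) auto
    then have "real (Suc n) ^ 4 \<le> B0 * (real p powr \<epsilon>) ^ n"
      using B0(2)[of n] mult_left_mono[of "(2 powr \<epsilon>) ^ n" "(real p powr \<epsilon>) ^ n" B0] B0(1) by linarith
    then have "A * real (Suc n) ^ 4 \<le> A * (B0 * (real p powr \<epsilon>) ^ n)" using A by (intro mult_left_mono) auto
    then show ?thesis using True unfolding c_def by (simp add: mult.assoc)
  next
    case False
    then have "X \<le> real p" unfolding T_def by simp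
    then have "X powr \<epsilon> \<le> real p powr \<epsilon>" using \<epsilon> unfolding X_def by (intro powr_mono2) auto
    moreover have "X powr \<epsilon> = 16 * A" unfolding X_def using \<epsilon> A by (simp add: powr_powr)
    ultimately have pe: "16 * A \<le> real p powr \<epsilon>" by simp
    have "real (Suc n) \<le> 2 ^ n"
      using less_exp[of n] by (metis Suc_leI of_nat_le_iff of_nat_numeral of_nat_power)
    then have "real (Suc n) ^ 4 \<le> (2 ^ n) ^ 4" by (intro power_mono) auto
    also have "(2 ^ n) ^ 4 = ((2 :: real) ^ 4) ^ n" by (simp only: power_mult[symmetric] mult.commute)
    also have "\<dots> = 16 ^ n" by simp
    finally have "real (Suc n) ^ 4 \<le> 16 ^ n" .
    moreover have "A \<le> A ^ n" using A n by (simp add: self_le_power)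
    ultimately have "A * real (Suc n) ^ 4 \<le> A ^ n * 16 ^ n" using A by (intro mult_mono) auto
    also have "\<dots> = (16 * A) ^ n" by (simp add: power_mult_distrib)
    also have "\<dots> \<le> (real p powr \<epsilon>) ^ n" using pe A by (intro power_mono) auto
    finally show ?thesis using False unfolding c_def by simp
  qed
  show ?thesis
  proof (rule that[of "\<Prod>p\<in>T. c p"])
    show "(\<Prod>p\<in>T. c p) > 0" using c1 by (intro prod_pos) (auto intro: less_le_trans[OF zero_less_one])
    fix D :: int assume D: "D \<noteq> 0"
    define P where "P = {p. Factorial_Ring.prime p \<and> int p dvd D}"
    have finP: "finite P" unfolding P_def using finite_prime_int_dvd[OF D] by (rule finite_subset[rotated]) auto
    have "(\<Prod>p\<in>P. A * real (Suc (multiplicity (int p) D)) ^ 4) \<le>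
        (\<Prod>p\<in>P. c p * (real p powr \<epsilon>) ^ multiplicity (int p) D)"
    proof (rule prod_mono, intro conjI)
      fix p assume "p \<in> P"
      then have p: "Factorial_Ring.prime p" "int p dvd D" unfolding P_def by auto
      then have "multiplicity (int p) D \<ge> 1" using D by (intro multiplicity_geI) auto
      then show "A * real (Suc (multiplicity (int p) D)) ^ 4 \<le> c p * (real p powr \<epsilon>) ^ multiplicity (int p) D"
        by (rule factor[OF p(1)])
    qed (use A in auto)
    also have "\<dots> = (\<Prod>p\<in>P. c p) * (\<Prod>p\<in>P. (real p powr \<epsilon>) ^ multiplicity (int p) D)"
      by (rule prod.distrib)
    also have "\<dots> \<le> (\<Prod>p\<in>T. c p) * (\<Prod>p\<in>P. (real p powr \<epsilon>) ^ multiplicity (int p) D)"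
    proof (rule mult_right_mono)
      have "(\<Prod>p\<in>P. c p) = (\<Prod>p\<in>P \<inter> T. c p)"
        using finP by (intro prod.mono_neutral_right) (auto simp: c_def)
      also have "\<dots> \<le> (\<Prod>p\<in>T. c p)" using T c1
        by (intro prod_mono2) (auto intro: order_trans[OF zero_le_one])
      finally show "(\<Prod>p\<in>P. c p) \<le> (\<Prod>p\<in>T. c p)" .
    qed (auto intro!: prod_nonneg)
    also have "(\<Prod>p\<in>P. (real p powr \<epsilon>) ^ multiplicity (int p) D) = (\<Prod>p\<in>P. (real p ^ multiplicity (int p) D) powr \<epsilon>)"
    proof (rule prod.cong)
      fix p assume "p \<in> P"
      then have "p > 0" unfolding P_def using prime_gt_0_nat by auto
      then show "(real p powr \<epsilon>) ^ multiplicity (int p) D = (real p ^ multiplicity (int p) D) powr \<epsilon>"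
        by (simp add: powr_powr mult.commute flip: powr_realpow)
    qed simp
    also have "\<dots> = (\<Prod>p\<in>P. real p ^ multiplicity (int p) D) powr \<epsilon>"
      by (rule prod_powr_distrib[symmetric])
    also have "(\<Prod>p\<in>P. real p ^ multiplicity (int p) D) = real_of_int \<bar>D\<bar>"
      unfolding abs_eq_prod_primes[OF D, symmetric] P_def by simp
    finally show "(\<Prod>p | Factorial_Ring.prime p \<and> int p dvd D.
        A * real (Suc (multiplicity (int p) D)) ^ 4) \<le> (\<Prod>p\<in>T. c p) * real_of_int \<bar>D\<bar> powr \<epsilon>"
      unfolding P_def .
  qed
qed

section \<open>Comparison of the local main terms with m_1 and m_2'\<close>

lemma int_Greatest_ge:
  fixes k :: int
  assumes "P k" "\<And>y. P y \<Longrightarrow> y \<le> b"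
  shows "k \<le> (GREATEST x. P x)"
proof -
  let ?S = "{x. P x \<and> k \<le> x}"
  have fin: "finite ?S" by (rule finite_subset[of _ "{k..b}"]) (use assms in auto)
  have ne: "?S \<noteq> {}" using assms(1) by auto
  have M: "Max ?S \<in> ?S" using fin ne by (rule Max_in)
  have "(GREATEST x. P x) = Max ?S"
  proof (rule Greatest_equality)
    show "P (Max ?S)" using M by simp
    fix y assume "P y"
    then show "y \<le> Max ?S" using M Max_ge[OF fin, of y] by (cases "k \<le> y") auto
  qed
  then show ?thesis using M by simp
qed

lemma prod_le_m_div_1:
  fixes q :: "int ^ 4 \<Rightarrow> int"
  assumes q: "integral_quadratic_form q" "positive_definite q" and P: "finite P" "\<And>p. p \<in> P \<Longrightarrow> Factorial_Ring.prime p"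
  shows "real (\<Prod>p\<in>P. p ^ nat (elementary_divisor p q 1)) \<le> real_of_rat (m_div 1 q)"
proof -
  define T where "T = {p. Factorial_Ring.prime p \<and> elementary_divisor p q 1 \<noteq> 0}"
  have T: "finite T" unfolding T_def by (rule finite_elementary_divisor(1)[OF q])
  have "m_div 1 q = of_nat (\<Prod>p\<in>T. p ^ nat (elementary_divisor p q 1))"
    unfolding m_div_def T_def[symmetric] of_nat_prod
    by (intro prod.cong) (auto simp: power_int_def elementary_divisor_def)
  then have "real_of_rat (m_div 1 q) = real (\<Prod>p\<in>T. p ^ nat (elementary_divisor p q 1))"
    by (simp only: of_rat_of_nat_eq)
  moreover have "(\<Prod>p\<in>P. p ^ nat (elementary_divisor p q 1)) \<le> (\<Prod>p\<in>T. p ^ nat (elementary_divisor p q 1))"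
  proof -
    have "(\<Prod>p\<in>P. p ^ nat (elementary_divisor p q 1)) = (\<Prod>p\<in>P \<inter> T. p ^ nat (elementary_divisor p q 1))"
      using P by (intro prod.mono_neutral_right) (auto simp: T_def)
    also have "\<dots> \<le> (\<Prod>p\<in>T. p ^ nat (elementary_divisor p q 1))"
    proof (rule dvd_imp_le)
      show "(\<Prod>p\<in>P \<inter> T. p ^ nat (elementary_divisor p q 1)) dvd (\<Prod>p\<in>T. p ^ nat (elementary_divisor p q 1))"
        using T by (intro prod_dvd_prod_subset) auto
      show "0 < (\<Prod>p\<in>T. p ^ nat (elementary_divisor p q 1))"
        by (intro prod_pos) (auto simp: T_def dest: prime_gt_0_nat)
    qed
    finally show ?thesis .
  qed
  ultimately show ?thesis by (simp only: of_nat_le_iff)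
qed

text \<open>Separating positive from negative exponents writes \<open>m_div 2 q\<close> as X / Y
  with X and Y positive and coprime, so X is the numerator also when an exponent is negative. The
  square of the product divides X, which makes the product a competitor in \<open>m2'\<close>; all
  competitors are at most X, so the greatest one exists.\<close>

lemma prod_le_m2':
  fixes q :: "int ^ 4 \<Rightarrow> int"
  assumes q: "integral_quadratic_form q" "positive_definite q" and P: "finite P" "\<And>p. p \<in> P \<Longrightarrow> Factorial_Ring.prime p"
  shows "int (\<Prod>p\<in>P. p ^ (nat (elementary_divisor p q 2) div 2)) \<le> m2' q"
proof -
  define T where "T = {p. Factorial_Ring.prime p \<and> elementary_divisor p q 2 \<noteq> 0}"
  have T: "finite T" unfolding T_def by (rule finite_elementary_divisor(2)[OF q])
  define e where "e p = elementary_divisor p q 2" for p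
  define X Y where "X = (\<Prod>p\<in>T. int p ^ nat (e p))" and "Y = (\<Prod>p\<in>T. int p ^ nat (- e p))"
  have pos: "X > 0" "Y > 0" unfolding X_def Y_def
    by (auto intro!: prod_pos simp: T_def dest: prime_gt_0_nat)
  have "m_div 2 q = (\<Prod>p\<in>T. of_nat p ^ nat (e p) / of_nat p ^ nat (- e p))"
    unfolding m_div_def T_def[symmetric] e_def
    by (intro prod.cong) (auto simp: power_int_def field_simps)
  then have md: "m_div 2 q = Fract X Y"
    unfolding X_def Y_def Fract_of_int_quotient by (simp add: prod_dividef)
  have "coprime X Y"
    unfolding X_def Y_def
  proof (intro prod_coprime_left prod_coprime_right)
    fix p r assume "p \<in> T" "r \<in> T"
    then have pr: "Factorial_Ring.prime (int p)" "Factorial_Ring.prime (int r)" unfolding T_def by auto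
    show "coprime (int p ^ nat (e p)) (int r ^ nat (- e r))"
    proof (cases "p = r")
      case True
      then have "nat (e p) = 0 \<or> nat (- e r) = 0" by auto
      then show ?thesis by auto
    next
      case False
      then have "coprime (int p) (int r)" using primes_coprime[OF pr] by simp
      then show ?thesis by simp
    qed
  qed
  then have num: "fst (quotient_of (m_div 2 q)) = X" unfolding md quotient_of_Fract using pos by simp
  define m where "m = (\<Prod>p\<in>P. p ^ (nat (e p) div 2))"
  have "int m ^ 2 = (\<Prod>p\<in>P. int p ^ (2 * (nat (e p) div 2)))"
    unfolding m_def by (simp add: prod_power_distrib mult.commute flip: power_mult)
  also have "\<dots> dvd (\<Prod>p\<in>P. int p ^ nat (e p))" by (intro prod_dvd_prod le_imp_power_dvd) simp
  also have "(\<Prod>p\<in>P. int p ^ nat (e p)) = (\<Prod>p\<in>P \<inter> T. int p ^ nat (e p))"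
    using P by (intro prod.mono_neutral_right) (auto simp: T_def e_def)
  also have "\<dots> dvd X" unfolding X_def using T by (intro prod_dvd_prod_subset) auto
  finally have "int m ^ 2 dvd fst (quotient_of (m_div 2 q))" unfolding num .
  moreover have "y \<le> X" if "y ^ 2 dvd fst (quotient_of (m_div 2 q))" for y
  proof -
    have "y\<^sup>2 \<le> X" using that pos unfolding num by (intro zdvd_imp_le)
    moreover have "y \<le> y\<^sup>2"
    proof (cases "y \<le> 0")
      case False
      then have "y * 1 \<le> y * y" by (intro mult_left_mono) auto
      then show ?thesis by (simp add: power2_eq_square)
    qed (auto intro: order_trans)
    ultimately show ?thesis by simp
  qed
  ultimately have "int m \<le> m2' q" unfolding m2'_def by (rule int_Greatest_ge)
  then show ?thesis unfolding m_def e_def .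
qed

text \<open>The polar Gram matrix is twice \<open>gram q\<close>, and its four rows contribute
  2^4.\<close>

lemma det_bmat_eq_disc:
  fixes q :: "int ^ 4 \<Rightarrow> int"
  assumes "integral_quadratic_form q"
  shows "of_int (det (int_bilinear.bmat (polar q))) = 16 * disc q"
proof -
  interpret int_bilinear "polar q" by (rule int_bilinear_polar[OF assms])
  have "gram q = (\<chi> i. (1 / 2) *s (\<chi> j. of_int (bmat $ i $ j)))"
    unfolding gram_def bilin_def bmat_def by (simp add: vec_eq_iff)
  then have "disc q = (\<Prod>i\<in>(UNIV :: 4 set). 1 / 2) * det (\<chi> i j. of_int (bmat $ i $ j))"
    unfolding disc_def by (simp only: det_rows_mul)
  then show ?thesis unfolding of_int_det by (simp add: power_one_over)
qed

theorem theoremB2: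
  fixes Q :: "int ^ 4 \<Rightarrow> int" and \<epsilon> :: real
  assumes "integral_quadratic_form Q" and "positive_definite Q" and "\<epsilon> > 0"
  shows "\<exists>C > 0. \<forall>q :: int ^ 4 \<Rightarrow> int.
           integral_quadratic_form q \<longrightarrow> positive_definite q \<longrightarrow>
             finite (representations q Q) \<and>
             real (card (representations q Q))
               \<le> C * real_of_rat (m_div 1 q) * real_of_int (m2' q) * \<bar>real_of_rat (disc q)\<bar> powr \<epsilon>"
proof -
  note Q = assms(1,2)
  define \<beta> where "\<beta> = det (int_bilinear.bmat (polar Q))"
  have \<beta>0: "\<beta> \<noteq> 0" unfolding \<beta>_def by (rule det_polar_nonzero[OF Q])
  \<comment> \<open>The powers of p lost in the local counts. They are 1 unless p divides 2 \<beta>,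
    so over any finite set of primes their product is at most the one over T, which depends on Q
    only.\<close>
  define c where "c p = p ^ (5 * multiplicity (int p) \<beta> + 10 * multiplicity (int p) 2)" for p :: nat
  define T where "T = {p :: nat. Factorial_Ring.prime p \<and> int p dvd 2 * \<beta>}"
  have "finite {p :: nat. int p dvd 2 * \<beta>}" using \<beta>0 by (intro finite_prime_int_dvd) simp
  then have T: "finite T" by (rule finite_subset[rotated]) (auto simp: T_def)
  have c1: "c p = 1" if "Factorial_Ring.prime p" "p \<notin> T" for p
  proof -
    have "\<not> int p dvd 2" "\<not> int p dvd \<beta>" using that unfolding T_def by auto
    then show ?thesis unfolding c_def by (simp add: not_dvd_imp_multiplicity_0)
  qed
  obtain C where C: "C > 0" "\<And>D :: int. D \<noteq> 0 \<Longrightarrow> (\<Prod>p | Factorial_Ring.prime p \<and> int p dvd D.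
        10000 * real (Suc (multiplicity (int p) D)) ^ 4) \<le> C * real_of_int \<bar>D\<bar> powr \<epsilon>"
    using prod_multiplicity_le_powr[of 10000 \<epsilon>] assms(3) by auto
  define w where "w = card (representations Q Q)"
  \<comment> \<open>\<open>Suc w\<close> in place of \<open>w\<close> makes positivity immediate;
    \<open>16 powr \<epsilon>\<close> converts the polar Gram determinant into disc q.\<close>
  define C' where "C' = real (Suc w) * real (\<Prod>p\<in>T. c p) * C * 16 powr \<epsilon>"
  have cT: "(\<Prod>p\<in>T. c p) > 0"
    by (intro prod_pos) (auto simp: c_def T_def dest: prime_gt_0_nat)
  have "finite (representations q Q) \<and> real (card (representations q Q))
      \<le> C' * real_of_rat (m_div 1 q) * real_of_int (m2' q) * \<bar>real_of_rat (disc q)\<bar> powr \<epsilon>"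
    if q: "integral_quadratic_form q" "positive_definite q" for q :: "int ^ 4 \<Rightarrow> int"
  proof
    show "finite (representations q Q)" by (rule finite_representations[OF Q])
    define D where "D = det (int_bilinear.bmat (polar q))"
    have D0: "D \<noteq> 0" unfolding D_def by (rule det_polar_nonzero[OF q])
    define P where "P = {p :: nat. Factorial_Ring.prime p \<and> int p dvd D}"
    have P: "finite P" "\<And>p. p \<in> P \<Longrightarrow> Factorial_Ring.prime p"
      using finite_subset[OF _ finite_prime_int_dvd[OF D0], of P] unfolding P_def by auto
    define f where "f p = 10000 * Suc (multiplicity (int p) D) ^ 4" for p :: nat
    define m1 where "m1 = (\<Prod>p\<in>P. p ^ nat (elementary_divisor p q 1))"
    define m2 where "m2 = (\<Prod>p\<in>P. p ^ (nat (elementary_divisor p q 2) div 2))"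
    have "card (representations q Q) \<le>
        (\<Prod>p\<in>P. card ((\<lambda>\<iota>. local_lattice (int p) (\<lambda>i. \<iota> (axis i 1))) ` representations q Q)) * w"
      unfolding P_def D_def w_def by (rule card_representations_le[OF q Q])
    also have "\<dots> \<le> (\<Prod>p\<in>P. f p * c p *
        (p ^ nat (elementary_divisor p q 1) * p ^ (nat (elementary_divisor p q 2) div 2))) * Suc w"
      unfolding f_def c_def D_def \<beta>_def
      by (intro mult_mono prod_mono conjI) (use card_local_lattices[OF q Q] P(2) in auto)
    also have "\<dots> = (\<Prod>p\<in>P. f p) * (\<Prod>p\<in>P. c p) * (m1 * m2) * Suc w"
      unfolding m1_def m2_def by (simp only: prod.distrib)
    also have "\<dots> \<le> (\<Prod>p\<in>P. f p) * (\<Prod>p\<in>T. c p) * (m1 * m2) * Suc w"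
    proof (intro mult_right_mono mult_left_mono)
      have "(\<Prod>p\<in>P. c p) = (\<Prod>p\<in>P \<inter> T. c p)"
        using P c1 by (intro prod.mono_neutral_right) auto
      also have "\<dots> \<le> (\<Prod>p\<in>T. c p)"
        by (rule dvd_imp_le[OF _ cT]) (use T in \<open>intro prod_dvd_prod_subset, auto\<close>)
      finally show "(\<Prod>p\<in>P. c p) \<le> (\<Prod>p\<in>T. c p)" .
    qed auto
    finally have "real (card (representations q Q)) \<le>
        real ((\<Prod>p\<in>P. f p) * (\<Prod>p\<in>T. c p) * (m1 * m2) * Suc w)" by (simp only: of_nat_le_iff)
    also have "\<dots> = real (\<Prod>p\<in>P. f p) * (real (Suc w) * real (\<Prod>p\<in>T. c p)) * (real m1 * real m2)"
      by (simp only: of_nat_mult mult_ac)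
    also have "\<dots> \<le> (C * (16 powr \<epsilon> * \<bar>real_of_rat (disc q)\<bar> powr \<epsilon>)) * (real (Suc w) * real (\<Prod>p\<in>T. c p))
        * (real_of_rat (m_div 1 q) * real_of_int (m2' q))"
    proof (intro mult_mono)
      have "real (\<Prod>p\<in>P. f p) = (\<Prod>p\<in>P. 10000 * real (Suc (multiplicity (int p) D)) ^ 4)"
        unfolding f_def by (simp del: of_nat_Suc)
      also have "\<dots> \<le> C * real_of_int \<bar>D\<bar> powr \<epsilon>" unfolding P_def by (rule C(2)[OF D0])
      also have "real_of_int \<bar>D\<bar> = 16 * \<bar>real_of_rat (disc q)\<bar>"
      proof -
        have "real_of_rat (of_int D) = real_of_rat (16 * disc q)"
          unfolding D_def by (simp only: det_bmat_eq_disc[OF q(1)])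
        then have "real_of_int D = 16 * real_of_rat (disc q)" by (simp add: of_rat_mult)
        then show ?thesis by (simp only: of_int_abs abs_mult abs_numeral)
      qed
      also have "(16 * \<bar>real_of_rat (disc q)\<bar>) powr \<epsilon> = 16 powr \<epsilon> * \<bar>real_of_rat (disc q)\<bar> powr \<epsilon>"
        by (rule powr_mult)
      finally show "real (\<Prod>p\<in>P. f p) \<le> C * (16 powr \<epsilon> * \<bar>real_of_rat (disc q)\<bar> powr \<epsilon>)" .
      show "real m1 \<le> real_of_rat (m_div 1 q)" unfolding m1_def by (rule prod_le_m_div_1[OF q P])
      have m2: "int m2 \<le> m2' q" unfolding m2_def by (rule prod_le_m2'[OF q P])
      then show "real m2 \<le> real_of_int (m2' q)" by (metis of_int_le_iff of_int_of_nat_eq)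
      show "0 \<le> real_of_rat (m_div 1 q)"
        using prod_le_m_div_1[OF q P] by (meson of_nat_0_le_iff order_trans)
    qed (use C(1) in \<open>auto intro!: mult_nonneg_nonneg prod_nonneg\<close>)
    also have "\<dots> = C' * real_of_rat (m_div 1 q) * real_of_int (m2' q) * \<bar>real_of_rat (disc q)\<bar> powr \<epsilon>"
      unfolding C'_def by (simp only: mult_ac)
    finally show "real (card (representations q Q)) \<le>
        C' * real_of_rat (m_div 1 q) * real_of_int (m2' q) * \<bar>real_of_rat (disc q)\<bar> powr \<epsilon>" .
  qed
  moreover have "C' > 0" unfolding C'_def using cT C(1) by (intro mult_pos_pos) (simp_all only: of_nat_0_less_iff, auto)
  ultimately show ?thesis by blast
qed

end
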